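(* Let $d\ge1$ and let $S$ and $T$ be hyperbolic endomorphisms of the torus $\mathbb{T}^d=\mathbb{R}^d/\mathbb{Z}^d$. Let $\mathfrak{s}_-$ be the subspace of $\mathbb{R}^d$ contracted by $S$ and $\mathfrak{t}_-$ the subspace of $\mathbb{R}^d$ contracted by $T$. Assume that both $\mathfrak{s}_-$ and $\mathfrak{t}_-$ are nontrivial and that they span $\mathbb{R}^d$. Then $$\dim\big(Eq(S)\cap ND(T)\big)=d,$$ where $\dim$ denotes Hausdorff dimension.
   Context: An endomorphism $S$ of $\mathbb{T}^d$ is identified with a nonsingular $d\times d$ integer matrix, acting on both $\mathbb{R}^d$ and $\mathbb{T}^d$. It is hyperbolic if no eigenvalue of the matrix has modulus $1$ (so no eigenvalue has modulus $0$ or $1$). The subspace $\mathfrak{s}_-\subset\mathbb{R}^d$ contracted by $S$ is the real subspace corresponding to the generalized eigenspaces of $S$ for eigenvalues of modulus less than $1$, i.e. $\mathbb{R}^d\cap\bigoplus_{|\lambda|<1}\ker_{\mathbb{C}^d}(S-\lambda)^d$; $\mathfrak{t}_-$ is defined in the same way for $T$. Nontrivial means different from $\{0\}$. "They span $\mathbb{R}^d$" means $\mathfrak{s}_-+\mathfrak{t}_-=\mathbb{R}^d$. Let $m$ be the Haar probability measure on $\mathbb{T}^d$. Then $$Eq(S)=\Big\{x\in\mathbb{T}^d:\ \tfrac1N\sum_{n=0}^{N-1}f(S^nx)\to\int f\,dm\ (N\to\infty)\ \text{for all } f\in C(\mathbb{T}^d)\Big\},$$ $D(T)=\{x\in\mathbb{T}^d:\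 \overline{\{T^nx: n\ge 0\}}=\mathbb{T}^d\}$ and $ND(T)=\mathbb{T}^d\setminus D(T)$. *)

theory Defs
  imports "HOL-Analysis.Analysis"
begin

section \<open>The torus\<close>

definition int_lattice :: "(real ^ 'n) set" where
  "int_lattice = {v. \<forall>i. v $ i \<in> \<int>}"

lemma int_lattice_0 [simp]: "0 \<in> int_lattice"
  by (simp add: int_lattice_def)

lemma int_lattice_add: "u \<in> int_lattice \<Longrightarrow> v \<in> int_lattice \<Longrightarrow> u + v \<in> int_lattice"
  by (simp add: int_lattice_def)

lemma int_lattice_minus: "v \<in> int_lattice \<Longrightarrow> - v \<in> int_lattice"
  by (simp add: int_lattice_def)

lemma int_lattice_diff: "u \<in> int_lattice \<Longrightarrow> v \<in> int_lattice \<Longrightarrow> u - v \<in> int_lattice"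
  by (simp add: int_lattice_def)

lemma int_lattice_diff_commute: "x - y \<in> int_lattice \<longleftrightarrow> y - x \<in> int_lattice"
  using int_lattice_minus[of "x - y"] int_lattice_minus[of "y - x"] by auto

lemma closed_int_lattice: "closed (int_lattice :: (real ^ 'n) set)"
proof -
  have "closed {v :: real ^ 'n. v $ i \<in> \<int>}" for i
    using closed_vimage[OF closed_Ints, of "\<lambda>v::real ^ 'n. v $ i"]
    by (simp add: vimage_def continuous_on_component)
  then show ?thesis
    by (auto simp: int_lattice_def Collect_all_eq intro!: closed_INT)
qed

lemma countable_int_lattice: "countable (int_lattice :: (real ^ 'n) set)"
  unfolding int_lattice_def by (rule countable_vector) (simp add: countable_int)

definition torus_rel :: "real ^ 'n \<Rightarrow> real ^ 'n \<Rightarrow> bool" where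
  "torus_rel x y \<longleftrightarrow> x - y \<in> int_lattice"

lemma equivp_torus_rel: "equivp torus_rel"
proof (rule equivpI)
  show "reflp torus_rel" by (simp add: reflp_def torus_rel_def)
  show "symp torus_rel" by (auto simp: symp_def torus_rel_def int_lattice_diff_commute)
  show "transp torus_rel"
    unfolding transp_def torus_rel_def using int_lattice_add by fastforce
qed

quotient_type (overloaded) 'n torus = "real ^ 'n" / "torus_rel :: real ^ 'n \<Rightarrow> real ^ 'n \<Rightarrow> bool"
  by (rule equivp_torus_rel)

lift_definition torus_proj :: "real ^ 'n \<Rightarrow> 'n torus" is "\<lambda>x. x" .

lemma torus_proj_eq_iff: "torus_proj x = torus_proj y \<longleftrightarrow> x - y \<in> int_lattice"
  by transfer (simp add: torus_rel_def)

lemma torus_proj_cases: obtains y where "x = torus_proj y"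
  by (induct x) (metis torus_proj.abs_eq)

instantiation torus :: (finite) ab_group_add
begin

lift_definition zero_torus :: "'a torus" is 0 .

lift_definition plus_torus :: "'a torus \<Rightarrow> 'a torus \<Rightarrow> 'a torus" is "(+)"
  unfolding torus_rel_def add_diff_add by (rule int_lattice_add)

lift_definition minus_torus :: "'a torus \<Rightarrow> 'a torus \<Rightarrow> 'a torus" is "(-)"
proof -
  fix x x' y y' :: "real ^ 'a"
  assume "torus_rel x x'" "torus_rel y y'"
  then have "(x - x') - (y - y') \<in> int_lattice"
    unfolding torus_rel_def by (rule int_lattice_diff)
  then show "torus_rel (x - y) (x' - y')"
    by (simp add: torus_rel_def algebra_simps)
qed

lift_definition uminus_torus :: "'a torus \<Rightarrow> 'a torus" is uminus
  unfolding torus_rel_def using int_lattice_minus by fastforce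

instance
  by standard (transfer; simp add: torus_rel_def algebra_simps)+

end

lemma torus_proj_add: "torus_proj (x + y) = torus_proj x + torus_proj y"
  by transfer (simp add: torus_rel_def)

text \<open>The flat quotient metric \<open>dist (x + \<int>\<^sup>d) (y + \<int>\<^sup>d) = inf {\<parallel>x - y - v\<parallel> | v \<in> \<int>\<^sup>d}\<close>.\<close>

lemma infdist_int_lattice_shift:
  assumes "v \<in> int_lattice"
  shows "infdist (x + v) int_lattice = infdist x int_lattice"
proof -
  have *: "infdist (x + v) int_lattice \<le> infdist x int_lattice" if "v \<in> int_lattice"
    for x v :: "real ^ 'b"
  proof -
    have "infdist (x + v) int_lattice \<le> dist x a" if "a \<in> int_lattice" for a
      using infdist_le[of "a + v" int_lattice "x + v"] int_lattice_add[OF that \<open>v \<in> int_lattice\<close>]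
      by simp
    then show ?thesis
      by (subst (2) infdist_def) (auto intro!: cINF_greatest intro: int_lattice_0)
  qed
  show ?thesis
    using *[OF assms, of x] *[OF int_lattice_minus[OF assms], of "x + v"] by simp
qed

lemma infdist_int_lattice_minus: "infdist (- x) int_lattice = infdist x int_lattice"
proof -
  have *: "infdist (- x) int_lattice \<le> infdist x int_lattice" for x :: "real ^ 'b"
  proof -
    have "infdist (- x) int_lattice \<le> dist x a" if "a \<in> int_lattice" for a
      using infdist_le[of "- a" int_lattice "- x"] int_lattice_minus[OF that]
      by (simp add: dist_minus)
    then show ?thesis
      by (subst (2) infdist_def) (auto intro!: cINF_greatest intro: int_lattice_0)
  qed
  show ?thesis using *[of x] *[of "- x"] by simp
qed

instantiation torus :: (finite) metric_space
begin

lift_definition dist_torus :: "'a torus \<Rightarrow> 'a torus \<Rightarrow> real"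
  is "\<lambda>x y. infdist (x - y) int_lattice"
proof -
  fix x x' y y' :: "real ^ 'a"
  assume "torus_rel x x'" "torus_rel y y'"
  then have "(x - x') - (y - y') \<in> int_lattice"
    unfolding torus_rel_def by (rule int_lattice_diff)
  from infdist_int_lattice_shift[OF this, of "x' - y'"]
  show "infdist (x - y) int_lattice = infdist (x' - y') int_lattice"
    by (simp add: algebra_simps)
qed

definition uniformity_torus :: "('a torus \<times> 'a torus) filter" where
  "uniformity_torus = (INF e\<in>{0 <..}. principal {(x, y). dist x y < e})"

definition open_torus :: "'a torus set \<Rightarrow> bool" where
  "open_torus U \<longleftrightarrow> (\<forall>x\<in>U. \<forall>\<^sub>F (x', y) in uniformity. x' = x \<longrightarrow> y \<in> U)"

instance
proof
  fix x y z :: "'a torus"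
  show "dist x y = 0 \<longleftrightarrow> x = y"
  proof transfer
    fix x y :: "real ^ 'a"
    have "(int_lattice :: (real ^ 'a) set) \<noteq> {}"
      using int_lattice_0 by blast
    from in_closed_iff_infdist_zero[OF closed_int_lattice this, of "x - y"]
    show "infdist (x - y) int_lattice = 0 \<longleftrightarrow> torus_rel x y"
      by (simp add: torus_rel_def)
  qed
  show "dist x y \<le> dist x z + dist y z"
  proof transfer
    fix x y z :: "real ^ 'a"
    have *: "infdist (x - y) int_lattice \<le> infdist (x - z) int_lattice + dist (y - z) a"
      if "a \<in> int_lattice" for a
    proof -
      have "infdist (x - y) int_lattice \<le> infdist (x - z - a) int_lattice + dist (x - y) (x - z - a)"
        by (rule infdist_triangle)
      also have "infdist (x - z - a) int_lattice = infdist (x - z) int_lattice"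
        using infdist_int_lattice_shift[OF int_lattice_minus[OF that], of "x - z"] by simp
      also have "dist (x - y) (x - z - a) = norm ((z + a) - y)"
        by (simp add: dist_norm algebra_simps)
      also have "\<dots> = dist (y - z) a"
        by (simp add: dist_norm norm_minus_commute algebra_simps)
      finally show ?thesis by simp
    qed
    have "infdist (x - y) int_lattice - infdist (x - z) int_lattice \<le> infdist (y - z) int_lattice"
      using * by (subst (3) infdist_def) (force intro!: cINF_greatest intro: int_lattice_0)
    then show "infdist (x - y) int_lattice
        \<le> infdist (x - z) int_lattice + infdist (y - z) int_lattice"
      by simp
  qed
qed (simp_all add: uniformity_torus_def open_torus_def)

end

lemma dist_torus_proj:
  fixes x y :: "real ^ 'a"
  shows "dist (torus_proj x) (torus_proj y) = (INF v\<in>int_lattice. norm (x - y - v))"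
proof -
  have "dist (torus_proj x) (torus_proj y) = infdist (x - y) int_lattice"
    by transfer simp
  also have "\<dots> = (INF v\<in>int_lattice. norm (x - y - v))"
  proof -
    have "(int_lattice :: (real ^ 'a) set) \<noteq> {}"
      using int_lattice_0 by blast
    then show ?thesis by (simp add: infdist_notempty dist_norm)
  qed
  finally show ?thesis .
qed

lemma continuous_on_torus_proj: "continuous_on A torus_proj"
proof -
  have "dist (torus_proj x) (torus_proj y) \<le> dist x y" for x y :: "real ^ 'b"
    using infdist_le[of 0 int_lattice "x - y"] by transfer (simp add: dist_norm)
  then show ?thesis
    unfolding continuous_on_iff using order_le_less_trans by blast
qed

lemma measurable_torus_proj [measurable]: "torus_proj \<in> borel_measurable borel"
  by (rule borel_measurable_continuous_onI) (rule continuous_on_torus_proj)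

definition unit_cube :: "(real ^ 'n) set" where
  "unit_cube = {x. \<forall>i. 0 \<le> x $ i \<and> x $ i < 1}"

text \<open>Haar probability measure, realised as the image of Lebesgue measure on the fundamental
  domain \<open>[0,1)\<^sup>d\<close>; the lemmas \<open>emeasure_torus_haar_UNIV\<close> and \<open>torus_haar_translation\<close> below
  give the characterising properties.\<close>

definition torus_haar :: "'n::finite torus measure" where
  "torus_haar = distr (restrict_space lborel unit_cube) borel torus_proj"

lemma unit_cube_measurable [measurable]: "(unit_cube :: (real ^ 'n) set) \<in> sets borel"
proof -
  have "(unit_cube :: (real ^ 'n) set) = (\<Inter>i. {x. 0 \<le> x $ i \<and> x $ i < 1})"
    by (auto simp: unit_cube_def)
  also have "\<dots> \<in> sets borel"
  proof (rule sets.countable_INT')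
    have "{x :: real ^ 'n. 0 \<le> x $ i} \<inter> {x. x $ i < 1} \<in> sets borel" for i
      by (intro sets.Int borel_closed borel_open closed_Collect_le open_Collect_less
          continuous_intros)
    then show "(\<lambda>i. {x :: real ^ 'n. 0 \<le> x $ i \<and> x $ i < 1}) ` UNIV \<subseteq> sets borel"
      by (auto simp: Collect_conj_eq)
  qed auto
  finally show ?thesis .
qed

lemma emeasure_unit_cube: "emeasure lborel (unit_cube :: (real ^ 'n) set) = 1"
proof (rule antisym)
  have one [simp]: "(1 :: real ^ 'n) \<bullet> b = 1" if "b \<in> Basis" for b
    using that by (auto simp: Basis_vec_def inner_axis)
  have "(unit_cube :: (real ^ 'n) set) \<subseteq> cbox 0 1"
    by (auto simp: unit_cube_def mem_box_cart less_imp_le)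
  then have "emeasure lborel (unit_cube :: (real ^ 'n) set) \<le> emeasure lborel (cbox 0 (1 :: real ^ 'n))"
    by (intro emeasure_mono) auto
  also have "\<dots> = 1" by simp
  finally show "emeasure lborel (unit_cube :: (real ^ 'n) set) \<le> 1" .
  have "box 0 1 \<subseteq> (unit_cube :: (real ^ 'n) set)"
    by (auto simp: unit_cube_def mem_box_cart less_imp_le)
  then have "emeasure lborel (box 0 (1 :: real ^ 'n)) \<le> emeasure lborel (unit_cube :: (real ^ 'n) set)"
    by (intro emeasure_mono) auto
  moreover have "emeasure lborel (box 0 (1 :: real ^ 'n)) = 1" by simp
  ultimately show "1 \<le> emeasure lborel (unit_cube :: (real ^ 'n) set)" by simp
qed

lemma emeasure_torus_haar:
  assumes "A \<in> sets borel"
  shows "emeasure torus_haar A = emeasure lborel {x \<in> unit_cube. torus_proj x \<in> A}"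
proof -
  have m: "torus_proj \<in> measurable (restrict_space lborel unit_cube) borel"
    by (intro measurable_restrict_space1) simp
  have "emeasure torus_haar A =
      emeasure (restrict_space lborel unit_cube) (torus_proj -` A \<inter> unit_cube)"
    unfolding torus_haar_def using emeasure_distr[OF m assms] by (simp add: space_restrict_space)
  also have "\<dots> = emeasure lborel (torus_proj -` A \<inter> unit_cube)"
    by (rule emeasure_restrict_space) auto
  also have "torus_proj -` A \<inter> unit_cube = {x \<in> unit_cube. torus_proj x \<in> A}"
    by auto
  finally show ?thesis .
qed

lemma sets_torus_haar [simp, measurable_cong]: "sets torus_haar = sets borel"
  by (simp add: torus_haar_def)

lemma space_torus_haar [simp]: "space torus_haar = UNIV"
  by (simp add: torus_haar_def)

lemma emeasure_torus_haar_UNIV: "emeasure torus_haar UNIV = 1"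
  by (simp add: emeasure_torus_haar emeasure_unit_cube)

lemma emeasure_lborel_shift:
  fixes B :: "(real ^ 'n) set"
  assumes [measurable]: "B \<in> sets borel"
  shows "emeasure lborel {x. c + x \<in> B} = emeasure lborel B"
proof -
  have "emeasure lborel B = emeasure (distr lborel borel ((+) c)) B"
    by (simp add: lborel_distr_plus)
  also have "\<dots> = emeasure lborel {x. c + x \<in> B}"
    by (subst emeasure_distr) (auto simp: vimage_def)
  finally show ?thesis by simp
qed

lemma unit_cube_decomp: "\<exists>v\<in>int_lattice. x - v \<in> unit_cube"
  by (rule bexI[of _ "\<chi> i. of_int \<lfloor>x $ i\<rfloor>"])
    (auto simp: unit_cube_def int_lattice_def, linarith)

lemma unit_cube_unique:
  assumes "u \<in> int_lattice" "v \<in> int_lattice" "x - u \<in> unit_cube" "x - v \<in> unit_cube"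
  shows "u = v"
proof -
  have "u $ i = v $ i" for i
  proof -
    obtain a b where ab: "u $ i = of_int a" "v $ i = of_int b"
      using assms(1,2) unfolding int_lattice_def by (auto elim!: Ints_cases) (metis Ints_cases)
    have "\<bar>u $ i - v $ i\<bar> < 1"
      using assms(3,4) unfolding unit_cube_def by (auto simp: abs_less_iff) (smt (verit))+
    then have "\<bar>real_of_int (a - b)\<bar> < 1" using ab by simp
    then have "a = b" by linarith
    then show ?thesis using ab by simp
  qed
  then show ?thesis by (simp add: vec_eq_iff)
qed

lemma emeasure_unit_cube_partition:
  fixes B :: "(real ^ 'n) set"
  assumes [measurable]: "B \<in> sets borel"
  shows "emeasure lborel B =
    (\<integral>\<^sup>+ v. emeasure lborel {x \<in> B. x - (c + v) \<in> unit_cube} \<partial>count_space int_lattice)"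
proof -
  have "B = (\<Union>v\<in>int_lattice. {x \<in> B. x - (c + v) \<in> unit_cube})"
    using unit_cube_decomp[of "_ - c"] by (fastforce simp: diff_diff_eq)
  then have "emeasure lborel B =
      emeasure lborel (\<Union>v\<in>int_lattice. {x \<in> B. x - (c + v) \<in> unit_cube})"
    by simp
  also have "\<dots> = (\<integral>\<^sup>+ v. emeasure lborel {x \<in> B. x - (c + v) \<in> unit_cube} \<partial>count_space int_lattice)"
  proof (rule emeasure_UN_countable)
    show "disjoint_family_on (\<lambda>v. {x \<in> B. x - (c + v) \<in> unit_cube}) int_lattice"
      unfolding disjoint_family_on_def
      using unit_cube_unique[of _ _ "_ - c"] by (fastforce simp: diff_diff_eq)
  qed (auto simp: countable_int_lattice)
  finally show ?thesis .
qed

lemma emeasure_periodic_shifted_cube: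
  fixes B :: "(real ^ 'n) set"
  assumes [measurable]: "B \<in> sets borel"
    and per: "\<And>x v. v \<in> int_lattice \<Longrightarrow> v + x \<in> B \<longleftrightarrow> x \<in> B"
  shows "emeasure lborel {x \<in> B. x - c \<in> unit_cube} = emeasure lborel {x \<in> B. x \<in> unit_cube}"
proof -
  have "emeasure lborel {x \<in> B. x - c \<in> unit_cube} =
      (\<integral>\<^sup>+ v. emeasure lborel {x \<in> {x \<in> B. x - c \<in> unit_cube}. x - (0 + v) \<in> unit_cube}
        \<partial>count_space int_lattice)"
    by (rule emeasure_unit_cube_partition) measurable
  also have "\<dots> = (\<integral>\<^sup>+ v. emeasure lborel {x \<in> {x \<in> B. x \<in> unit_cube}. x - (c + - v) \<in> unit_cube}
        \<partial>count_space int_lattice)"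
  proof (rule nn_integral_cong)
    fix v :: "real ^ 'n" assume "v \<in> space (count_space int_lattice)"
    then have v: "v \<in> int_lattice" by simp
    have "emeasure lborel {x \<in> {x \<in> B. x - c \<in> unit_cube}. x - (0 + v) \<in> unit_cube} =
        emeasure lborel {x. v + x \<in> {x \<in> {x \<in> B. x - c \<in> unit_cube}. x - (0 + v) \<in> unit_cube}}"
      by (rule emeasure_lborel_shift[symmetric]) measurable
    also have "{x. v + x \<in> {x \<in> {x \<in> B. x - c \<in> unit_cube}. x - (0 + v) \<in> unit_cube}} =
        {x \<in> {x \<in> B. x \<in> unit_cube}. x - (c + - v) \<in> unit_cube}"
      using per[OF v] by (auto simp: algebra_simps)
    finally show "emeasure lborel {x \<in> {x \<in> B. x - c \<in> unit_cube}. x - (0 + v) \<in> unit_cube} =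
        emeasure lborel {x \<in> {x \<in> B. x \<in> unit_cube}. x - (c + - v) \<in> unit_cube}" .
  qed
  also have "\<dots> = (\<integral>\<^sup>+ v. emeasure lborel {x \<in> {x \<in> B. x \<in> unit_cube}. x - (c + v) \<in> unit_cube}
        \<partial>count_space int_lattice)"
    by (rule nn_integral_bij_count_space[where g = uminus], rule bij_betwI[where g = uminus])
      (auto intro: int_lattice_minus)
  also have "\<dots> = emeasure lborel {x \<in> B. x \<in> unit_cube}"
    by (rule emeasure_unit_cube_partition[symmetric]) measurable
  finally show ?thesis .
qed

lemma continuous_on_torus_translation:
  fixes a :: "'n::finite torus"
  shows "continuous_on A ((+) a)"
proof -
  have "dist (a + x) (a + y) = dist x y" for x y
    by transfer (simp add: algebra_simps)
  then show ?thesis unfolding continuous_on_iff by auto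
qed

lemma torus_haar_translation:
  fixes a :: "'n::finite torus"
  shows "distr torus_haar borel ((+) a) = torus_haar"
proof (rule measure_eqI)
  have m [measurable]: "(+) a \<in> borel_measurable borel"
    by (rule borel_measurable_continuous_onI) (rule continuous_on_torus_translation)
  obtain t where t: "a = torus_proj t" by (rule torus_proj_cases)
  fix A assume "A \<in> sets (distr torus_haar borel ((+) a))"
  then have A [measurable]: "A \<in> sets borel" by simp
  define B where "B = {x. torus_proj x \<in> A}"
  have B [measurable]: "B \<in> sets borel"
    using measurable_sets[OF measurable_torus_proj A] by (simp add: B_def vimage_def)
  have per: "v + x \<in> B \<longleftrightarrow> x \<in> B" if "v \<in> int_lattice" for v x
  proof -
    have "torus_proj (v + x) = torus_proj x" using that by (simp add: torus_proj_eq_iff)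
    then show ?thesis by (simp add: B_def)
  qed
  have "emeasure (distr torus_haar borel ((+) a)) A = emeasure torus_haar {x. a + x \<in> A}"
    by (subst emeasure_distr) (auto simp: vimage_def)
  also have "\<dots> = emeasure lborel {x \<in> unit_cube. a + torus_proj x \<in> A}"
    using measurable_sets[OF m A] by (subst emeasure_torus_haar) (auto simp: vimage_def)
  also have "{x \<in> unit_cube. a + torus_proj x \<in> A} = {x. t + x \<in> {x \<in> B. x - t \<in> unit_cube}}"
    by (auto simp: t B_def torus_proj_add)
  also have "emeasure lborel \<dots> = emeasure lborel {x \<in> B. x - t \<in> unit_cube}"
    by (rule emeasure_lborel_shift) measurable
  also have "\<dots> = emeasure lborel {x \<in> B. x \<in> unit_cube}"
    by (rule emeasure_periodic_shifted_cube) (use per in auto)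
  also have "\<dots> = emeasure torus_haar A"
    by (subst emeasure_torus_haar) (auto simp: B_def intro: arg_cong2[where f = emeasure])
  finally show "emeasure (distr torus_haar borel ((+) a)) A = emeasure torus_haar A" .
qed simp

section \<open>Toral endomorphisms\<close>

definition real_matrix :: "int ^ 'n ^ 'n \<Rightarrow> real ^ 'n ^ 'n" where
  "real_matrix M = map_matrix of_int M"

definition complex_matrix :: "int ^ 'n ^ 'n \<Rightarrow> complex ^ 'n ^ 'n" where
  "complex_matrix M = map_matrix of_int M"

lemma real_matrix_int_lattice:
  fixes M :: "int ^ 'n ^ 'n"
  assumes "v \<in> int_lattice"
  shows "real_matrix M *v v \<in> int_lattice"
  using assms by (auto simp: int_lattice_def real_matrix_def matrix_vector_mult_def
      intro!: Ints_sum Ints_mult)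

lift_definition torus_map :: "int ^ 'n ^ 'n \<Rightarrow> 'n torus \<Rightarrow> 'n torus"
  is "\<lambda>M x. real_matrix M *v x"
  unfolding torus_rel_def matrix_vector_mult_diff_distrib[symmetric]
  by (rule real_matrix_int_lattice)

definition is_eigenvalue :: "complex ^ 'n ^ 'n \<Rightarrow> complex \<Rightarrow> bool" where
  "is_eigenvalue A c \<longleftrightarrow> (\<exists>v. v \<noteq> 0 \<and> A *v v = c *s v)"

definition hyperbolic_endo :: "int ^ 'n ^ 'n \<Rightarrow> bool" where
  "hyperbolic_endo M \<longleftrightarrow>
     det M \<noteq> 0 \<and> (\<forall>c. is_eigenvalue (complex_matrix M) c \<longrightarrow> cmod c \<noteq> 1)"

definition gen_eigenspace :: "complex ^ 'n ^ 'n \<Rightarrow> complex \<Rightarrow> (complex ^ 'n) set" where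
  "gen_eigenspace A c = {v. ((\<lambda>w. A *v w - c *s w) ^^ CARD('n)) v = 0}"

text \<open>\<open>vec.span\<close> is the span over the field of scalars, here over the complex numbers.\<close>

definition contracted_subspace :: "int ^ 'n ^ 'n \<Rightarrow> (real ^ 'n) set" where
  "contracted_subspace M =
     {v. (\<chi> i. complex_of_real (v $ i)) \<in>
           vec.span (\<Union>c\<in>{c. cmod c < 1}. gen_eigenspace (complex_matrix M) c)}"

section \<open>Equidistributed and nondense orbits\<close>

definition Eq_set :: "('n::finite torus \<Rightarrow> 'n torus) \<Rightarrow> 'n torus set" where
  "Eq_set F = {x. \<forall>f :: 'n torus \<Rightarrow> complex. continuous_on UNIV f \<longrightarrow>
     (\<lambda>N. (\<Sum>n<N. f ((F ^^ n) x)) / of_nat N) \<longlonglongrightarrow> (LINT y|torus_haar. f y)}"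

definition D_set :: "('n::finite torus \<Rightarrow> 'n torus) \<Rightarrow> 'n torus set" where
  "D_set F = {x. closure {(F ^^ n) x | n. True} = UNIV}"

definition ND_set :: "('n::finite torus \<Rightarrow> 'n torus) \<Rightarrow> 'n torus set" where
  "ND_set F = UNIV - D_set F"

section \<open>Hausdorff dimension\<close>

text \<open>\<open>(diam U)\<^sup>s\<close> with the conventions \<open>(diam {})\<^sup>s = 0\<close> and \<open>0\<^sup>0 = 1\<close>
  (whereas \<open>0 powr 0 = 0\<close>).\<close>

definition diam_powr :: "real \<Rightarrow> 'a::metric_space set \<Rightarrow> ennreal" where
  "diam_powr s U = (if U = {} then 0 else if s = 0 then 1 else ennreal (diameter U powr s))"

text \<open>Boundedness is required because \<open>diameter\<close> is unspecified on unbounded sets.\<close>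

definition hausdorff_premeasure :: "real \<Rightarrow> real \<Rightarrow> 'a::metric_space set \<Rightarrow> ennreal" where
  "hausdorff_premeasure s \<delta> A =
     Inf {(\<Sum>i. diam_powr s (U i)) | U :: nat \<Rightarrow> 'a set.
            A \<subseteq> (\<Union>i. U i) \<and> (\<forall>i. bounded (U i) \<and> diameter (U i) \<le> \<delta>)}"

definition hausdorff_measure :: "real \<Rightarrow> 'a::metric_space set \<Rightarrow> ennreal" where
  "hausdorff_measure s A = (SUP \<delta>\<in>{0<..}. hausdorff_premeasure s \<delta> A)"

definition hausdorff_dim :: "'a::metric_space set \<Rightarrow> ennreal" where
  "hausdorff_dim A = Inf {ennreal s | s. 0 \<le> s \<and> hausdorff_measure s A = 0}"

end

(*
If T^n v tends to 0, then translating by v changes neither the density of T-orbits nor, for S in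
place of T, equidistribution. Write the identity of R^d as sigma + tau with linear maps sigma and
tau into the spaces contracted by S and T. Then sigma y + tau z differs from z by a vector
contracted by S and from y by a vector contracted by T, so it lifts a point of Eq(S) Int ND(T) as
soon as z lifts a point of Eq(S) and y one of ND(T): the two conditions decouple.

The points z have full Lebesgue measure: the orbit of a nonzero character under the dual of a
hyperbolic S consists of distinct characters, hence its averages tend to 0 in L2 and almost
everywhere along squares, and Weyl's criterion applies.

For the points y, choose N such that T^N expands the space complementary to the contracted one by
a large factor Lambda. Of every small ball in that space a subball of a fixed proportion has its
image in the torus away from 0; subdividing it into translates of T^(-N) balls and iterating gives
sets F n whose normalised Lebesgue measures satisfy a Frostman bound at scale Lambda^(-n) with
exponent d - O(1 / log Lambda), whether or not T is conformal. Averaging these measures against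
the Lebesgue measure of the points z preserves the bound, and compactness turns any cover of
Eq(S) Int ND(T) into a cover of some finite stage.
*)
theory Submission
  imports Defs "HOL-Computational_Algebra.Fundamental_Theorem_Algebra"
begin

text \<open>The map T need not be conformal: preimages of balls are thin ellipsoids, and counting
  balls by their diameters loses too much. All estimates are therefore made by volume. Each
  generation keeps at least a proportion \<kappa> of volume, and \<kappa> depends only on the
  projection along the contracted space, not on the expansion. Hence \<Lambda> can be chosen after
  \<kappa> with \<kappa> \<Lambda>^(d - s) \<ge> 1, which absorbs the loss for any exponent s < d.
  T^N is replaced by a linear map that is the identity along the space contracted by T. This keeps
  all volumes in R^d and makes every F n invariant under translations along that space. The
  averaging relies on it: with y + z in place of z, sigma y + tau z becomes y + tau z, which lies in
  F n together with y. Contraction is used in the form that the iterates of a vector tend to 0. Real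
  eigenvectors may be missing, so the decomposition into contracted and expanded vectors is found
  over the complex numbers, removing one root at a time from an annihilating polynomial of a vector,
  and descends by real parts.\<close>

section \<open>Splitting of hyperbolic linear maps\<close>

lemma contractive_recursion_tendsto_0:
  fixes u e :: "nat \<Rightarrow> real"
  assumes u0: "\<And>n. 0 \<le> u n" and th: "0 \<le> \<theta>" "\<theta> < 1"
    and step: "\<And>n. u (Suc n) \<le> \<theta> * u n + e n" and e: "e \<longlonglongrightarrow> 0"
  shows "u \<longlonglongrightarrow> 0"
proof (rule LIMSEQ_I)
  fix r :: real assume r: "0 < r"
  \<comment> \<open>The error level is chosen so that r/2 is the fixed point of t |-> \<theta> t +
    r/2 (1 - \<theta>).\<close>
  have "0 < r / 2 * (1 - \<theta>)" using r th by simp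
  from LIMSEQ_D[OF e this] obtain N where N: "\<And>n. n \<ge> N \<Longrightarrow> \<bar>e n\<bar> < r / 2 * (1 - \<theta>)"
    by auto
  have b: "u (N + k) \<le> \<theta> ^ k * u N + r / 2" for k
  proof (induction k)
    case 0 show ?case using r by simp
  next
    case (Suc k)
    have "u (N + Suc k) \<le> \<theta> * u (N + k) + r / 2 * (1 - \<theta>)"
      using step[of "N + k"] N[of "N + k"] by auto
    also have "\<dots> \<le> \<theta> * (\<theta> ^ k * u N + r / 2) + r / 2 * (1 - \<theta>)"
      using Suc th by (intro add_right_mono mult_left_mono)
    finally show ?case by (simp add: field_simps)
  qed
  have "(\<lambda>k. \<theta> ^ k * u N) \<longlonglongrightarrow> 0"
    using th by (intro tendsto_mult_left_zero LIMSEQ_realpow_zero) auto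
  from LIMSEQ_D[OF this, of "r / 2"] r obtain K where K: "\<And>k. k \<ge> K \<Longrightarrow> \<bar>\<theta> ^ k * u N\<bar> < r / 2"
    by auto
  show "\<exists>no. \<forall>n\<ge>no. norm (u n - 0) < r"
  proof (intro exI allI impI)
    fix n assume "n \<ge> N + K"
    then obtain k where k: "n = N + k" "k \<ge> K" by (intro that[of "n - N"]) auto
    show "norm (u n - 0) < r"
      using b[of k] K[OF k(2)] u0[of n] k(1) by auto
  qed
qed

text \<open>The dynamical form of the contracted subspace: it makes sense over the reals, where
  eigenvectors may be missing, and applied to the inverse map it describes the expanded
  space.\<close>

definition stable_space :: "('a::real_normed_vector \<Rightarrow> 'a) \<Rightarrow> 'a set" where
  "stable_space f = {v. (\<lambda>n. (f ^^ n) v) \<longlonglongrightarrow> 0}"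

lemma linear_funpow: "linear f \<Longrightarrow> linear (f ^^ n)" for f :: "'a::real_vector \<Rightarrow> 'a"
  by (induction n) (auto intro: linear_compose linear_id simp: id_def[symmetric])

lemma subspace_stable: "linear f \<Longrightarrow> subspace (stable_space f)"
proof (rule subspaceI)
  assume f: "linear f"
  note p = linear_funpow[OF f]
  show "0 \<in> stable_space f" by (simp add: stable_space_def linear_0[OF p])
  show "x + y \<in> stable_space f" if "x \<in> stable_space f" "y \<in> stable_space f" for x y
    using that tendsto_add[of "\<lambda>n. (f ^^ n) x" 0 sequentially "\<lambda>n. (f ^^ n) y" 0]
    by (simp add: stable_space_def linear_add[OF p])
  show "c *\<^sub>R x \<in> stable_space f" if "x \<in> stable_space f" for c x
    using that tendsto_scaleR[OF tendsto_const[of c], of "\<lambda>n. (f ^^ n) x" 0 sequentially]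
    by (simp add: stable_space_def linear_scale[OF p])
qed

lemma stable_commute:
  fixes f h :: "'a::euclidean_space \<Rightarrow> 'a"
  assumes h: "linear h" and c: "\<And>x. f (h x) = h (f x)" and v: "v \<in> stable_space f"
  shows "h v \<in> stable_space f"
proof -
  have "(f ^^ n) (h v) = h ((f ^^ n) v)" for n by (induction n) (auto simp: c)
  moreover have "(\<lambda>n. h ((f ^^ n) v)) \<longlonglongrightarrow> 0"
    using linear_conv_bounded_linear[of h] bounded_linear.tendsto_zero[of h] h v
    by (auto simp: stable_space_def)
  ultimately show ?thesis by (simp add: stable_space_def)
qed

text \<open>An injective endomorphism of a finite-dimensional space is onto; this supplies the
  corrections in \<open>splitting_step\<close>.\<close>

lemma linear_inj_on_subspace_surj:
  fixes h :: "'a::euclidean_space \<Rightarrow> 'a"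
  assumes h: "linear h" and P: "subspace P" and inv: "h ` P \<subseteq> P"
    and ker: "\<And>w. w \<in> P \<Longrightarrow> h w = 0 \<Longrightarrow> w = 0" and b: "b \<in> P"
  obtains b' where "b' \<in> P" "h b' = b"
proof -
  have inj: "inj_on h (span P)"
    using linear_inj_on_iff_eq_0[OF h, of P] ker P
    by (simp add: span_eq_iff[THEN iffD2, OF P])
  have "dim P \<le> dim (h ` P)" by (rule eq_refl) (rule dim_image_eq[OF h inj, symmetric])
  then have "h ` P = P"
    by (rule subspace_dim_equal[OF linear_subspace_image[OF h P] P inv])
  with b obtain b' where "b' \<in> P" "b = h b'" by (metis imageE)
  then show ?thesis by (intro that) simp_all
qed

text \<open>The iterates of v satisfy x(n+1) = c x(n) + f^n a with f^n a tending to 0, so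
  \<open>contractive_recursion_tendsto_0\<close> applies to their norms. This is what makes Jordan
  blocks harmless.\<close>

lemma stable_add_eigen_perturbation:
  fixes f :: "complex ^ 'n \<Rightarrow> complex ^ 'n"
  assumes f: "linear f" and fs: "\<And>c x. f (c *s x) = c *s f x"
    and e: "f v = c *s v + a" "cmod c < 1" "a \<in> stable_space f"
  shows "v \<in> stable_space f"
proof -
  have cs: "(f ^^ n) (c *s x) = c *s (f ^^ n) x" for c x n by (induction n) (auto simp: fs)
  have st: "(f ^^ Suc n) v = c *s (f ^^ n) v + (f ^^ n) a" for n
  proof -
    have "(f ^^ Suc n) v = (f ^^ n) (f v)" by (simp only: funpow_Suc_right o_apply)
    then show ?thesis by (simp add: e linear_add[OF linear_funpow[OF f]] cs)
  qed
  have nrm: "norm (c *s x) = cmod c * norm x" for c and x :: "complex ^ 'n"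
    by (simp add: norm_vec_def norm_mult L2_set_right_distrib)
  have "(\<lambda>n. norm ((f ^^ n) v)) \<longlonglongrightarrow> 0"
  proof (rule contractive_recursion_tendsto_0[where \<theta> = "cmod c"])
    show "(\<lambda>n. norm ((f ^^ n) a)) \<longlonglongrightarrow> 0" using e(3) by (simp add: stable_space_def tendsto_norm_zero)
    show "norm ((f ^^ Suc n) v) \<le> cmod c * norm ((f ^^ n) v) + norm ((f ^^ n) a)" for n
      unfolding st nrm[symmetric] by (rule norm_triangle_ineq)
  qed (use e in auto)
  then show ?thesis by (simp add: stable_space_def tendsto_norm_zero_iff)
qed

lemma eigenvector_in_stable_eq_0:
  fixes f :: "complex ^ 'n \<Rightarrow> complex ^ 'n"
  assumes fs: "\<And>c x. f (c *s x) = c *s f x" and e: "f w = c *s w" "1 \<le> cmod c" "w \<in> stable_space f"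
  shows "w = 0"
proof -
  have "(f ^^ n) w = (c ^ n) *s w" for n
    by (induction n) (auto simp: fs e vector_smult_assoc mult.commute)
  then have "(\<lambda>n. (c ^ n) *s w) \<longlonglongrightarrow> 0" using e by (simp add: stable_space_def)
  then have "(\<lambda>n. norm ((c ^ n) *s w)) \<longlonglongrightarrow> 0" by (rule tendsto_norm_zero)
  moreover have "norm ((c ^ n) *s w) \<ge> norm w" for n
  proof -
    have "norm ((c ^ n) *s w) = cmod c ^ n * norm w"
      by (simp add: norm_vec_def norm_mult L2_set_right_distrib norm_power)
    then show ?thesis using one_le_power[OF e(2), of n] mult_right_mono[of 1 "cmod c ^ n" "norm w"] by simp
  qed
  ultimately have "norm w \<le> 0" by (intro LIMSEQ_le_const) auto
  then show ?thesis by simp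
qed

text \<open>If \<open>cmod c < 1\<close>, then \<open>f - c\<close> maps \<open>stable_space g\<close> onto itself, so \<open>v\<close> can be corrected by a vector
  of \<open>stable_space g\<close> until \<open>f v - c *s v\<close> lies in \<open>stable_space f\<close>; the other cases are alike.\<close>

lemma splitting_step:
  fixes f g :: "complex ^ 'n \<Rightarrow> complex ^ 'n"
  assumes f: "linear f" and fs: "\<And>c x. f (c *s x) = c *s f x"
    and g: "linear g" and gs: "\<And>c x. g (c *s x) = c *s g x"
    and fg: "\<And>x. f (g x) = x" and gf: "\<And>x. g (f x) = x"
    and hyp: "\<And>c v. v \<noteq> 0 \<Longrightarrow> f v = c *s v \<Longrightarrow> cmod c \<noteq> 1"
    and ab: "f v - c *s v = a + b" "a \<in> stable_space f" "b \<in> stable_space g"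
  shows "\<exists>a b. v = a + b \<and> a \<in> stable_space f \<and> b \<in> stable_space g"
proof -
  define h where "h = (\<lambda>x. f x - c *s x)"
  have lin_cs: "linear (\<lambda>x::complex ^ 'n. c *s x)"
    by (rule linearI) (auto simp: vec_eq_iff algebra_simps)
  have h: "linear h" unfolding h_def by (intro linear_compose_sub f lin_cs)
  have g_sub: "g (x - y) = g x - g y" for x y by (rule linear_diff[OF g])
  have f_sub: "f (x - y) = f x - f y" for x y by (rule linear_diff[OF f])
  have cf: "f (h x) = h (f x)" and cg: "g (h x) = h (g x)" for x
    by (simp_all add: h_def f_sub fs g_sub gs fg gf)
  have hf: "h ` stable_space f \<subseteq> stable_space f" and hg: "h ` stable_space g \<subseteq> stable_space g"
    using stable_commute[OF h, of f] stable_commute[OF h, of g] cf cg by blast+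
  have kerf: "w = 0" if "w \<in> stable_space f" "h w = 0" "1 \<le> cmod c" for w
    using eigenvector_in_stable_eq_0[of f, OF fs _ that(3) that(1)] that(2) by (simp add: h_def)
  \<comment> \<open>For c \<noteq> 0, w is an eigenvector of g for 1/c, whose modulus is at least 1;
    for c = 0 injectivity of f decides.\<close>
  have kerg: "w = 0" if w: "w \<in> stable_space g" "h w = 0" and c: "cmod c \<le> 1" for w
  proof (cases "c = 0")
    case True
    then have "f w = 0" using w by (simp add: h_def)
    then show ?thesis by (metis gf linear_0[OF g])
  next
    case False
    have fw: "f w = c *s w" using w by (simp add: h_def)
    have "w = g (f w)" by (simp add: gf)
    then have "w = c *s g w" by (simp add: fw gs)
    then have "inverse c *s w = inverse c *s (c *s g w)" by simp
    then have "g w = inverse c *s w" using False by (simp add: vector_smult_assoc)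
    moreover have "1 \<le> cmod (inverse c)"
      using c False by (simp add: norm_inverse one_le_inverse)
    ultimately show ?thesis using eigenvector_in_stable_eq_0[of g, OF gs] w by blast
  qed
  \<comment> \<open>Solving g (h x) = x - c g x for g x shows x to be an eigenvector of g for 1/c up
    to a stable error.\<close>
  have endg: "x \<in> stable_space g" if "h x \<in> stable_space g" "cmod c > 1" for x
  proof (rule stable_add_eigen_perturbation[OF g gs])
    have c0: "c \<noteq> 0" using that by auto
    have "g (h x) = x - c *s g x" by (simp add: h_def g_sub gs gf)
    then have "c *s g x = x - g (h x)" by simp
    then have "c * (g x $ i) = x $ i - g (h x) $ i" for i
      by (metis vector_minus_component vector_smult_component)
    then show "g x = inverse c *s x + (- inverse c) *s g (h x)"
      using c0 by (simp add: vec_eq_iff field_simps)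
    show "cmod (inverse c) < 1" using that(2) by (simp add: norm_inverse inverse_less_1_iff)
    show "(- inverse c) *s g (h x) \<in> stable_space g"
    proof (rule stable_commute[where h = "\<lambda>y. (- inverse c) *s g y"])
      show "linear (\<lambda>y. (- inverse c) *s g y)"
        by (rule linearI) (auto simp: vec_eq_iff linear_add[OF g] linear_scale[OF g] algebra_simps)
    qed (use that in \<open>auto simp: gs linear_neg[OF g]\<close>)
  qed
  have endf: "x \<in> stable_space f" if "h x \<in> stable_space f" "cmod c < 1" for x
    using stable_add_eigen_perturbation[OF f fs, of x c "h x"] that by (simp add: h_def)
  have hv: "h v = a + b" using ab by (simp add: h_def)
  consider "cmod c < 1" | "cmod c > 1" | "cmod c = 1" by linarith
  then show ?thesis
  proof cases
    case 1
    obtain b' where b': "b' \<in> stable_space g" "h b' = b"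
      using linear_inj_on_subspace_surj[OF h subspace_stable[OF g] hg kerg ab(3)] 1 by auto
    have "v - b' \<in> stable_space f" using endf[of "v - b'"] 1 hv b' ab by (simp add: linear_diff[OF h])
    then show ?thesis using b' by (intro exI[of _ "v - b'"] exI[of _ b']) auto
  next
    case 2
    obtain a' where a': "a' \<in> stable_space f" "h a' = a"
      using linear_inj_on_subspace_surj[OF h subspace_stable[OF f] hf kerf ab(2)] 2 by auto
    have "v - a' \<in> stable_space g" using endg[of "v - a'"] 2 hv a' ab by (simp add: linear_diff[OF h])
    then show ?thesis using a' by (intro exI[of _ a'] exI[of _ "v - a'"]) auto
  next
    \<comment> \<open>Both parts can be corrected, because h has trivial kernel on either stable
      space; what remains is killed by h, and \<open>hyp\<close> forbids eigenvalues of modulus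
      1.\<close>
    case 3
    obtain b' where b': "b' \<in> stable_space g" "h b' = b"
      using linear_inj_on_subspace_surj[OF h subspace_stable[OF g] hg kerg ab(3)] 3 by auto
    obtain a' where a': "a' \<in> stable_space f" "h a' = a"
      using linear_inj_on_subspace_surj[OF h subspace_stable[OF f] hf kerf ab(2)] 3 by auto
    have "h (v - (a' + b')) = 0"
      using hv a' b' by (simp add: linear_diff[OF h] linear_add[OF h])
    then have "v - (a' + b') = 0" using hyp[of "v - (a' + b')" c] 3 by (auto simp: h_def)
    then have "v = a' + b'" by simp
    then show ?thesis using a' b' by blast
  qed
qed

section \<open>Annihilating polynomials of vectors and the complex splitting\<close>

definition poly_apply :: "(complex ^ 'n \<Rightarrow> complex ^ 'n) \<Rightarrow> complex poly \<Rightarrow> complex ^ 'n \<Rightarrow> complex ^ 'n"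
  where "poly_apply f q v = fold_coeffs (\<lambda>a w. a *s v + f w) q 0"

lemma poly_apply_0 [simp]: "poly_apply f 0 v = 0"
  by (simp add: poly_apply_def)

lemma poly_apply_pCons:
  assumes "linear f"
  shows "poly_apply f (pCons a q) v = a *s v + f (poly_apply f q v)"
  by (cases "q = 0 \<and> a = 0") (auto simp: poly_apply_def linear_0[OF assms])

lemma poly_apply_add:
  assumes "linear f"
  shows "poly_apply f (p + q) v = poly_apply f p v + poly_apply f q v"
  by (induction p q rule: poly_induct2)
    (auto simp: poly_apply_pCons assms linear_add[OF assms] vector_sadd_rdistrib)

text \<open>f commutes with polynomials in f, so a linear factor can be applied to the vector
  instead. Removing a root thus lowers the degree at the price of replacing v by f v - c v.\<close>

lemma poly_apply_linear_factor:
  assumes f: "linear f" and fs: "\<And>c x. f (c *s x) = c *s f x"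
  shows "poly_apply f ([:-c, 1:] * q) v = poly_apply f q (f v - c *s v)"
proof -
  have sm: "poly_apply f (smult a q) v = a *s poly_apply f q v" for a q
    by (induction q) (auto simp: poly_apply_pCons f fs vector_add_ldistrib vector_smult_assoc)
  have *: "poly_apply f q (f v - c *s v) = f (poly_apply f q v) - c *s poly_apply f q v" for q
  proof (induction q)
    case 0
    then show ?case by (simp add: linear_0[OF f])
  next
    case (pCons a q)
    have "f (poly_apply f q (f v - c *s v)) = f (f (poly_apply f q v)) - c *s f (poly_apply f q v)"
      unfolding pCons.IH by (simp add: linear_diff[OF f] fs)
    then show ?case
      by (simp add: poly_apply_pCons f linear_add[OF f] fs)
  qed
  have "poly_apply f ([:-c, 1:] * q) v = poly_apply f (smult (-c) q + pCons 0 q) v"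
    by simp
  also have "\<dots> = f (poly_apply f q v) - c *s poly_apply f q v"
    by (simp only: poly_apply_add[OF f] sm) (simp add: poly_apply_pCons f)
  finally show ?thesis by (simp add: *)
qed

lemma poly_apply_monom: "linear f \<Longrightarrow> poly_apply f (monom c n) v = (f ^^ n) (c *s v)"
  by (induction n) (auto simp: monom_0 monom_Suc poly_apply_pCons linear_0)

text \<open>More iterates of v than the real dimension are linearly dependent. Working with a single
  vector avoids the minimal polynomial of f.\<close>

lemma annihilating_poly:
  fixes f :: "complex ^ 'n \<Rightarrow> complex ^ 'n" and v :: "complex ^ 'n"
  assumes f: "linear f"
  shows "\<exists>q. q \<noteq> 0 \<and> poly_apply f q v = 0"
proof -
  define N where "N = DIM(complex ^ 'n)"
  define w where "w i = (f ^^ i) v" for i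
  have app: "poly_apply f (\<Sum>i\<le>n. monom (complex_of_real (r i)) i) v = (\<Sum>i\<le>n. r i *\<^sub>R w i)" for n r
  proof (induction n)
    have sc: "complex_of_real a *s x = a *\<^sub>R x" for a and x :: "complex ^ 'n"
      by (simp add: vec_eq_iff scaleR_conv_of_real[where 'a = complex])
    have m: "poly_apply f (monom (complex_of_real (r i)) i) v = r i *\<^sub>R w i" for i
      by (simp add: poly_apply_monom f w_def sc linear_scale[OF linear_funpow[OF f]])
    case 0 show ?case using m[of 0] by simp
    case (Suc n) then show ?case by (simp add: poly_apply_add[OF f] m)
  qed
  have cf: "coeff (\<Sum>i\<le>n. monom (complex_of_real (r i)) i) k = (if k \<le> n then of_real (r k) else 0)" for n r k
    by (simp add: coeff_sum)
  have "\<exists>r. (\<exists>k\<le>N. r k \<noteq> 0) \<and> (\<Sum>i\<le>N. r i *\<^sub>R w i) = 0"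
  proof (cases "inj_on w {..N}")
    case True
    have "dependent (w ` {..N})"
      using dependent_biggerset[of "w ` {..N}"] by (simp add: card_image[OF True]) (simp add: N_def)
    then obtain u where u: "\<exists>x\<in>w ` {..N}. u x \<noteq> 0" "(\<Sum>x\<in>w ` {..N}. u x *\<^sub>R x) = 0"
      by (auto simp: dependent_finite)
    then show ?thesis by (intro exI[of _ "u \<circ> w"]) (auto simp: sum.reindex[OF True])
  next
    \<comment> \<open>Dependence is a notion for sets and does not see repeated iterates; a
      repetition yields the relation X^i - X^j directly.\<close>
    case False
    then obtain i j where ij: "i \<le> N" "j \<le> N" "i \<noteq> j" "w i = w j" by (auto simp: inj_on_def)
    define r :: "nat \<Rightarrow> real" where "r k = (if k = i then 1 else 0) - (if k = j then 1 else 0)" for k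
    have "(\<Sum>k\<le>N. r k *\<^sub>R w k) = (\<Sum>k\<le>N. (if k = i then w k else 0) - (if k = j then w k else 0))"
      by (intro sum.cong) (auto simp: r_def)
    also have "\<dots> = 0" using ij by (simp add: sum_subtractf)
    finally show ?thesis using ij by (intro exI[of _ r] conjI) (auto simp: r_def)
  qed
  then obtain r k where r: "k \<le> N" "r k \<noteq> 0" "(\<Sum>i\<le>N. r i *\<^sub>R w i) = 0" by blast
  have "coeff (\<Sum>i\<le>N. monom (complex_of_real (r i)) i) k \<noteq> 0" using r by (simp add: cf)
  then have "(\<Sum>i\<le>N. monom (complex_of_real (r i)) i) \<noteq> 0" by (metis coeff_0)
  then show ?thesis using app r(3) by metis
qed

text \<open>Induction on the degree of an annihilating polynomial of v: for a root c the vector f v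
  - c v has an annihilator of smaller degree, and \<open>splitting_step\<close> carries its
  decomposition back to v.\<close>

lemma complex_splitting:
  fixes f g :: "complex ^ 'n \<Rightarrow> complex ^ 'n"
  assumes f: "linear f" and fs: "\<And>c x. f (c *s x) = c *s f x"
    and g: "linear g" and gs: "\<And>c x. g (c *s x) = c *s g x"
    and fg: "\<And>x. f (g x) = x" and gf: "\<And>x. g (f x) = x"
    and hyp: "\<And>c v. v \<noteq> 0 \<Longrightarrow> f v = c *s v \<Longrightarrow> cmod c \<noteq> 1"
  shows "\<exists>a b. v = a + b \<and> a \<in> stable_space f \<and> b \<in> stable_space g"
proof -
  have *: "\<exists>a b. v = a + b \<and> a \<in> stable_space f \<and> b \<in> stable_space g"
    if "q \<noteq> 0" "poly_apply f q v = 0" for q v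
    using that
  proof (induction "degree q" arbitrary: q v)
    case 0
    then obtain a where "q = [:a:]" "a \<noteq> 0" by (metis degree_eq_zeroE pCons_eq_0_iff)
    with 0 have "a *s v = 0" by (simp add: poly_apply_pCons f linear_0[OF f])
    with \<open>a \<noteq> 0\<close> have "v = 0" by (simp add: vec_eq_iff)
    then show ?case using subspace_0[OF subspace_stable[OF f]] subspace_0[OF subspace_stable[OF g]]
      by (intro exI[of _ 0]) simp
  next
    case (Suc n)
    then obtain c where "poly q c = 0"
      using fundamental_theorem_of_algebra[of q] by (auto simp: constant_degree)
    then obtain q' where q': "q = [:-c, 1:] * q'" by (metis poly_eq_0_iff_dvd dvdE)
    have q0: "q' \<noteq> 0" using q' Suc by auto
    have "degree q = Suc (degree q')" unfolding q' using q0 by (subst degree_mult_eq) auto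
    moreover have "poly_apply f q' (f v - c *s v) = 0"
      using Suc.prems(2) unfolding q' poly_apply_linear_factor[OF f fs] .
    ultimately obtain a b where "f v - c *s v = a + b" "a \<in> stable_space f" "b \<in> stable_space g"
      using Suc.hyps(1)[of q' "f v - c *s v"] Suc.hyps(2) q0 by auto
    then show ?case using splitting_step[OF f fs g gs fg gf, of v c a b] hyp by blast
  qed
  obtain q where "q \<noteq> 0" "poly_apply f q v = 0" using annihilating_poly[OF f, of v] by auto
  then show ?thesis by (rule *)
qed

section \<open>The splitting of the real space\<close>

definition cvec :: "real ^ 'n \<Rightarrow> complex ^ 'n" where
  "cvec x = (\<chi> i. complex_of_real (x $ i))"

definition re_vec :: "complex ^ 'n \<Rightarrow> real ^ 'n" where
  "re_vec z = (\<chi> i. Re (z $ i))"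

lemma linear_complex_matrix: "linear ((*v) (A :: complex ^ 'n ^ 'n))"
  by (rule linearI)
    (auto simp: vec_eq_iff matrix_vector_mult_def sum.distrib algebra_simps scaleR_sum_right)

lemma det_real_matrix: "det (real_matrix M) = of_int (det M)"
  by (simp add: det_def real_matrix_def)

lemma det_complex_matrix: "det (complex_matrix M) = of_int (det M)"
  by (simp add: det_def complex_matrix_def)

lemma re_vec_complex_matrix:
  "re_vec (complex_matrix M *v z) = real_matrix M *v re_vec z"
  by (simp add: vec_eq_iff re_vec_def complex_matrix_def real_matrix_def matrix_vector_mult_def)

lemma tendsto_re_vec: "z \<longlonglongrightarrow> 0 \<Longrightarrow> (\<lambda>n. re_vec (z n)) \<longlonglongrightarrow> 0"
proof -
  assume "z \<longlonglongrightarrow> 0"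
  then have "(\<lambda>n. Re (z n $ i)) \<longlonglongrightarrow> 0" for i
    using tendsto_Re[OF tendsto_vec_nth, of z 0 sequentially i] by simp
  then have "(\<lambda>n. \<chi> i. Re (z n $ i)) \<longlonglongrightarrow> (\<chi> i. 0)" by (intro tendsto_vec_lambda)
  then show ?thesis by (simp add: re_vec_def zero_vec_def)
qed

lemma matrix_inverse_of_det:
  fixes A :: "'a::field ^ 'n ^ 'n"
  assumes "det A \<noteq> 0"
  obtains B where "\<And>x. A *v (B *v x) = x" "\<And>x. B *v (A *v x) = x"
proof -
  obtain B where "A ** B = mat 1" "B ** A = mat 1"
    using assms unfolding invertible_det_nz[symmetric] invertible_def by blast
  then show ?thesis by (intro that[of B]) (simp_all add: matrix_vector_mul_assoc)
qed

text \<open>Taking real parts intertwines the complex matrix with the real one, and the two inverses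
  as well, so it maps a complex decomposition to a real one.\<close>

lemma hyperbolic_decomposition:
  fixes M :: "int ^ 'n ^ 'n"
  assumes M: "hyperbolic_endo M" and g: "\<And>x. g (real_matrix M *v x) = x"
    and g': "\<And>x. real_matrix M *v g x = x"
  shows "\<exists>a b. x = a + b \<and> a \<in> stable_space ((*v) (real_matrix M)) \<and> b \<in> stable_space g"
proof -
  have "det (complex_matrix M) \<noteq> 0"
    using M by (simp add: hyperbolic_endo_def det_complex_matrix)
  then obtain B where B: "\<And>x. complex_matrix M *v (B *v x) = x" "\<And>x. B *v (complex_matrix M *v x) = x"
    using matrix_inverse_of_det by blast
  have sm: "A *v (c *s x) = c *s (A *v x)" for A :: "complex ^ 'n ^ 'n" and c x
    by (simp add: vec_eq_iff matrix_vector_mult_def sum_distrib_left algebra_simps)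
  have "\<exists>a b. cvec x = a + b \<and> a \<in> stable_space ((*v) (complex_matrix M)) \<and> b \<in> stable_space ((*v) B)"
    by (rule complex_splitting)
      (use M in \<open>auto simp: B sm linear_complex_matrix hyperbolic_endo_def is_eigenvalue_def\<close>)
  then obtain a b where ab: "cvec x = a + b" "a \<in> stable_space ((*v) (complex_matrix M))" "b \<in> stable_space ((*v) B)"
    by blast
  have reB: "re_vec (B *v z) = g (re_vec z)" for z
    by (metis B(1) g re_vec_complex_matrix)
  have "((*v) (real_matrix M) ^^ n) (re_vec z) = re_vec (((*v) (complex_matrix M) ^^ n) z)" for n z
    by (induction n) (simp_all add: re_vec_complex_matrix)
  then have "re_vec a \<in> stable_space ((*v) (real_matrix M))"
    using tendsto_re_vec ab(2) by (simp add: stable_space_def)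
  moreover have "(g ^^ n) (re_vec z) = re_vec (((*v) B ^^ n) z)" for n z
    by (induction n) (simp_all add: reB)
  then have "re_vec b \<in> stable_space g"
    using tendsto_re_vec ab(3) by (simp add: stable_space_def)
  moreover have "x = re_vec a + re_vec b"
    using ab(1) by (simp add: cvec_def re_vec_def vec_eq_iff complex_eq_iff)
  ultimately show ?thesis by blast
qed

text \<open>Convergence on the finitely many vectors of an orthonormal basis of W controls all of W,
  as the coefficients are bounded by the norm of x.\<close>

lemma eventually_norm_le_on_subspace:
  fixes h :: "nat \<Rightarrow> 'a::euclidean_space \<Rightarrow> 'b::real_normed_vector"
  assumes h: "\<And>n. linear (h n)" and W: "subspace W"
    and lim: "\<And>x. x \<in> W \<Longrightarrow> (\<lambda>n. h n x) \<longlonglongrightarrow> 0" and e: "0 < e"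
  shows "\<exists>N. \<forall>n\<ge>N. \<forall>x\<in>W. norm (h n x) \<le> e * norm x"
proof -
  obtain B where B: "B \<subseteq> W" "pairwise orthogonal B" "\<And>x. x \<in> B \<Longrightarrow> norm x = 1"
    "independent B" "span B = W"
    using orthonormal_basis_subspace[OF W] by metis
  have fin: "finite B" by (rule independent_imp_finite[OF B(4)])
  have "(\<lambda>n. \<Sum>b\<in>B. norm (h n b)) \<longlonglongrightarrow> (\<Sum>b\<in>B. 0)"
    by (intro tendsto_sum tendsto_norm_zero lim) (use B in auto)
  then have "(\<lambda>n. \<Sum>b\<in>B. norm (h n b)) \<longlonglongrightarrow> 0" by simp
  from LIMSEQ_D[OF this e] obtain N where
    N: "\<And>n. n \<ge> N \<Longrightarrow> (\<Sum>b\<in>B. norm (h n b)) < e" by (auto simp: sum_nonneg)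
  have "norm (h n x) \<le> e * norm x" if "n \<ge> N" "x \<in> W" for n x
  proof -
    have "h n x = h n (\<Sum>b\<in>B. (b \<bullet> x) *\<^sub>R b)"
      using orthonormal_basis_expand[OF B(2,3) _ fin, of x] that B(5) by (simp add: inner_commute)
    also have "\<dots> = (\<Sum>b\<in>B. (b \<bullet> x) *\<^sub>R h n b)"
      by (simp add: linear_sum[OF h] linear_scale[OF h])
    also have "norm \<dots> \<le> (\<Sum>b\<in>B. norm x * norm (h n b))"
    proof (intro sum_norm_le)
      fix b assume "b \<in> B"
      then have "\<bar>b \<bullet> x\<bar> \<le> norm x" using Cauchy_Schwarz_ineq2[of b x] B(3) by simp
      then show "norm ((b \<bullet> x) *\<^sub>R h n b) \<le> norm x * norm (h n b)"
        by (simp add: mult_right_mono)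
    qed
    also have "\<dots> = norm x * (\<Sum>b\<in>B. norm (h n b))" by (simp add: sum_distrib_left)
    also have "\<dots> \<le> norm x * e" using N[OF that(1)] by (intro mult_left_mono) auto
    finally show ?thesis by (simp add: mult.commute)
  qed
  then show ?thesis by blast
qed

lemma funpow_inverse:
  fixes f g :: "'a \<Rightarrow> 'a"
  assumes "\<And>x. g (f x) = x"
  shows "(g ^^ n) ((f ^^ n) x) = x"
proof (induction n arbitrary: x)
  case (Suc n)
  have "(g ^^ Suc n) ((f ^^ Suc n) x) = (g ^^ n) (g (f ((f ^^ n) x)))"
    by (subst funpow_Suc_right) simp
  then show ?case using Suc by (simp add: assms)
qed simp

lemma inverse_stable:
  fixes f g :: "'a::euclidean_space \<Rightarrow> 'a"
  assumes "linear f" "\<And>x. g (f x) = x" "\<And>x. f (g x) = x" "v \<in> stable_space g"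
  shows "f v \<in> stable_space g"
  using stable_commute[of f g v] assms by simp

text \<open>On \<open>stable_space g\<close> the iterates \<open>g ^^ n\<close> contract uniformly, so \<open>f ^^ n\<close> expands.\<close>

lemma eventually_expanding_on_stable_inverse:
  fixes f g :: "'a::euclidean_space \<Rightarrow> 'a"
  assumes f: "linear f" and g: "linear g" and gf: "\<And>x. g (f x) = x" and fg: "\<And>x. f (g x) = x"
    and L: "0 < L"
  shows "\<exists>N. \<forall>n\<ge>N. \<forall>x\<in>stable_space g. L * norm x \<le> norm ((f ^^ n) x)"
proof -
  obtain N where N: "\<And>n x. n \<ge> N \<Longrightarrow> x \<in> stable_space g \<Longrightarrow> norm ((g ^^ n) x) \<le> inverse L * norm x"
    using eventually_norm_le_on_subspace[where h = "(^^) g" and e = "inverse L", OF linear_funpow[OF g] subspace_stable[OF g]] L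
    by (auto simp: stable_space_def)
  have "L * norm x \<le> norm ((f ^^ n) x)" if "n \<ge> N" "x \<in> stable_space g" for n x
  proof -
    have "(f ^^ n) x \<in> stable_space g"
      using that(2) by (induction n) (auto intro: inverse_stable[OF f gf fg])
    from N[OF that(1) this] have "norm x \<le> inverse L * norm ((f ^^ n) x)"
      by (simp add: funpow_inverse gf)
    then show ?thesis using L by (simp add: field_simps)
  qed
  then show ?thesis by blast
qed

text \<open>By expansion on \<open>stable_space g\<close>, the late iterates of v under f have at
  least the norm of v, yet they tend to 0.\<close>

lemma stable_inverse_disjoint:
  fixes f g :: "'a::euclidean_space \<Rightarrow> 'a"
  assumes f: "linear f" and g: "linear g" and gf: "\<And>x. g (f x) = x" and fg: "\<And>x. f (g x) = x"
    and v: "v \<in> stable_space f" "v \<in> stable_space g"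
  shows "v = 0"
proof -
  obtain N where N: "\<And>n x. n \<ge> N \<Longrightarrow> x \<in> stable_space g \<Longrightarrow> norm x \<le> norm ((f ^^ n) x)"
    using eventually_expanding_on_stable_inverse[OF f g gf fg, of 1] by auto
  have "(\<lambda>n. norm ((f ^^ n) v)) \<longlonglongrightarrow> 0" using v by (simp add: stable_space_def tendsto_norm_zero)
  then have "norm v \<le> 0" using N v(2) by (intro LIMSEQ_le_const) auto
  then show ?thesis by simp
qed

text \<open>The projection p onto the expanded space along the contracted one is chosen pointwise;
  uniqueness of the decomposition makes it linear.\<close>

lemma hyperbolic_splitting:
  fixes M :: "int ^ 'n ^ 'n"
  assumes M: "hyperbolic_endo M"
  obtains g p :: "real ^ 'n \<Rightarrow> real ^ 'n" where
    "linear g" "\<And>x. g (real_matrix M *v x) = x" "\<And>x. real_matrix M *v g x = x"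
    "linear p" "\<And>x. p x \<in> stable_space g" "\<And>x. x - p x \<in> stable_space ((*v) (real_matrix M))"
    "\<And>x. x \<in> stable_space g \<Longrightarrow> p x = x" "\<And>x. x \<in> stable_space ((*v) (real_matrix M)) \<Longrightarrow> p x = 0"
proof -
  let ?f = "(*v) (real_matrix M)"
  have "det (real_matrix M) \<noteq> 0" using M by (simp add: hyperbolic_endo_def det_real_matrix)
  then obtain B where B: "\<And>x. real_matrix M *v (B *v x) = x" "\<And>x. B *v (real_matrix M *v x) = x"
    using matrix_inverse_of_det by blast
  define g where "g = (*v) B"
  have f: "linear ?f" and g: "linear g" by (simp_all add: g_def)
  have gf: "g (?f x) = x" and fg: "?f (g x) = x" for x by (simp_all add: g_def B)
  note sf = subspace_stable[OF f] and sg = subspace_stable[OF g]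
  have "\<exists>b. b \<in> stable_space g \<and> x - b \<in> stable_space ?f" for x
    using hyperbolic_decomposition[OF M gf fg, of x] by auto
  then obtain p where p: "\<And>x. p x \<in> stable_space g" "\<And>x. x - p x \<in> stable_space ?f" by metis
  have uniq: "p x = b" if "b \<in> stable_space g" "x - b \<in> stable_space ?f" for x b
  proof -
    have "p x - b = (x - b) - (x - p x)" by simp
    then have "p x - b \<in> stable_space ?f" using subspace_diff[OF sf that(2) p(2)[of x]] by simp
    moreover have "p x - b \<in> stable_space g" by (rule subspace_diff[OF sg p(1) that(1)])
    ultimately have "p x - b = 0" by (rule stable_inverse_disjoint[OF f g gf fg])
    then show ?thesis by simp
  qed
  have "linear p"
  proof (rule linearI)
    show "p (x + y) = p x + p y" for x y
      using uniq[of "p x + p y" "x + y"] subspace_add[OF sg p(1) p(1), of x y]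
        subspace_add[OF sf p(2) p(2), of x y] by (simp add: algebra_simps)
    show "p (c *\<^sub>R x) = c *\<^sub>R p x" for c x
      using uniq[of "c *\<^sub>R p x" "c *\<^sub>R x"] subspace_scale[OF sg p(1), of c x]
        subspace_scale[OF sf p(2), of c x] by (simp add: algebra_simps)
  qed
  moreover have "p x = x" if "x \<in> stable_space g" for x
    using uniq[OF that] subspace_0[OF sf] by simp
  moreover have "p x = 0" if "x \<in> stable_space ?f" for x
    using uniq[of 0 x] that subspace_0[OF sg] by simp
  ultimately show ?thesis using that[of g p] g gf fg p by blast
qed

text \<open>Induction along a Jordan chain: A v - c v is one step lower in the chain, hence stable,
  and v is an eigenvector up to this error.\<close>

lemma gen_eigenspace_subset_stable:
  fixes A :: "complex ^ 'n ^ 'n"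
  assumes c: "cmod c < 1"
  shows "gen_eigenspace A c \<subseteq> stable_space ((*v) A)"
proof -
  let ?f = "(*v) A"
  have sm: "A *v (c *s x) = c *s (A *v x)" for c x
    by (simp add: vec_eq_iff matrix_vector_mult_def sum_distrib_left algebra_simps)
  have "v \<in> stable_space ?f" if "((\<lambda>w. A *v w - c *s w) ^^ n) v = 0" for n v
    using that
  proof (induction n arbitrary: v)
    case 0
    then show ?case by (simp add: subspace_0 subspace_stable linear_complex_matrix)
  next
    case (Suc n)
    have "A *v v - c *s v \<in> stable_space ?f"
      using Suc.prems unfolding funpow_Suc_right o_apply by (rule Suc.IH)
    then show ?case
      by (intro stable_add_eigen_perturbation[OF linear_complex_matrix sm, of v c "A *v v - c *s v"] c) auto
  qed
  then show ?thesis by (auto simp: gen_eigenspace_def)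
qed

text \<open>The link to the spectral definition: the complex stable space is a complex subspace that
  contains the generalized eigenspaces in question, hence their span. The inclusion carries the
  spanning assumption over to stable spaces.\<close>

lemma contracted_subspace_subset_stable:
  "contracted_subspace M \<subseteq> stable_space ((*v) (real_matrix M))"
proof
  fix v assume v: "v \<in> contracted_subspace M"
  let ?A = "complex_matrix M"
  have sm: "?A *v (c *s x) = c *s (?A *v x)" for c x
    by (simp add: vec_eq_iff matrix_vector_mult_def sum_distrib_left algebra_simps)
  have "vec.subspace (stable_space ((*v) ?A))"
  proof (rule vec.subspaceI)
    note s = subspace_stable[OF linear_complex_matrix, of ?A]
    show "0 \<in> stable_space ((*v) ?A)" by (rule subspace_0[OF s])
    show "x + y \<in> stable_space ((*v) ?A)" if "x \<in> stable_space ((*v) ?A)" "y \<in> stable_space ((*v) ?A)" for x y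
      by (rule subspace_add[OF s that])
    show "c *s x \<in> stable_space ((*v) ?A)" if "x \<in> stable_space ((*v) ?A)" for c x
      by (rule stable_commute[OF _ _ that]) (auto simp: sm vec_eq_iff algebra_simps intro!: linearI)
  qed
  then have "vec.span (\<Union>c\<in>{c. cmod c < 1}. gen_eigenspace ?A c) \<subseteq> stable_space ((*v) ?A)"
    by (intro vec.span_minimal) (use gen_eigenspace_subset_stable in auto)
  then have "cvec v \<in> stable_space ((*v) ?A)"
    using v by (auto simp: contracted_subspace_def cvec_def)
  then have "(\<lambda>n. re_vec (((*v) ?A ^^ n) (cvec v))) \<longlonglongrightarrow> 0"
    by (simp add: stable_space_def tendsto_re_vec)
  moreover have "re_vec (((*v) ?A ^^ n) z) = ((*v) (real_matrix M) ^^ n) (re_vec z)" for n z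
    by (induction n) (simp_all add: re_vec_complex_matrix)
  moreover have "re_vec (cvec v) = v" by (simp add: re_vec_def cvec_def)
  ultimately show "v \<in> stable_space ((*v) (real_matrix M))" by (simp add: stable_space_def)
qed

section \<open>Lebesgue measure and linear maps\<close>

lemma nn_integral_lborel_translate:
  fixes f :: "'a::euclidean_space \<Rightarrow> ennreal"
  assumes [measurable]: "f \<in> borel_measurable borel"
  shows "(\<integral>\<^sup>+x. f (c + x) \<partial>lborel) = (\<integral>\<^sup>+x. f x \<partial>lborel)"
proof -
  have "(\<integral>\<^sup>+x. f x \<partial>lborel) = (\<integral>\<^sup>+x. f x \<partial>distr lborel borel ((+) c))"
    by (simp add: lborel_distr_plus)
  also have "\<dots> = (\<integral>\<^sup>+x. f (c + x) \<partial>lborel)"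
    by (subst nn_integral_distr) auto
  finally show ?thesis by simp
qed

lemma nn_integral_lborel_uminus:
  fixes f :: "'a::euclidean_space \<Rightarrow> ennreal"
  assumes [measurable]: "f \<in> borel_measurable borel"
  shows "(\<integral>\<^sup>+x. f (- x) \<partial>lborel) = (\<integral>\<^sup>+x. f x \<partial>lborel)"
proof -
  have "(lborel :: 'a measure) = density (distr lborel borel (\<lambda>x. 0 + (-1) *\<^sub>R x)) (\<lambda>_. ennreal (\<bar>-1\<bar> ^ DIM('a)))"
    by (rule lborel_affine) simp
  then have "(\<integral>\<^sup>+x. f x \<partial>lborel) = (\<integral>\<^sup>+x. f x \<partial>distr lborel borel (\<lambda>x::'a. - x))"
    by (simp add: density_1)
  also have "\<dots> = (\<integral>\<^sup>+x. f (- x) \<partial>lborel)"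
    by (subst nn_integral_distr) auto
  finally show ?thesis by simp
qed

text \<open>Uniqueness of Haar measure, applied to the image of Lebesgue measure under the map. The
  determinant formula of the library is not used, as it needs a well-ordered index type.\<close>

lemma linear_vimage_lborel:
  fixes h h' :: "'a::euclidean_space \<Rightarrow> 'a"
  assumes h: "linear h" and h': "linear h'" and hh': "\<And>x. h (h' x) = x" and h'h: "\<And>x. h' (h x) = x"
  obtains D :: real where "0 < D"
    "\<And>A. A \<in> sets borel \<Longrightarrow> D * measure lborel (h -` A) = measure lborel A"
proof -
  have [measurable]: "h \<in> borel_measurable borel" "h' \<in> borel_measurable borel"
    using h h' by (auto intro!: borel_measurable_continuous_onI linear_continuous_on simp: linear_conv_bounded_linear)
  let ?B = "cbox 0 (One :: 'a)"
  define \<mu> where "\<mu> = distr lborel borel h"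
  have sets\<mu> [measurable_cong, simp]: "sets \<mu> = sets borel" by (simp add: \<mu>_def)
  have em: "emeasure \<mu> A = emeasure lborel (h -` A)" if "A \<in> sets borel" for A
    using that by (simp add: \<mu>_def emeasure_distr)
  have im: "h -` A = h' ` A" for A by (auto simp: hh' h'h image_iff) (metis h'h)
  have bd: "bounded (h -` ?B)" unfolding im using h'
    by (intro bounded_linear_image) (auto simp: linear_conv_bounded_linear)
  have B1: "emeasure \<mu> ?B < \<infinity>" using emeasure_bounded_finite[OF bd] by (simp add: em)
  have tr: "(\<integral>\<^sup>+x. f (c + x) \<partial>\<mu>) = (\<integral>\<^sup>+x. f x \<partial>\<mu>)" if [measurable]: "f \<in> borel_measurable borel"
    for f :: "'a \<Rightarrow> ennreal" and c
  proof -
    have "(\<integral>\<^sup>+x. f (c + x) \<partial>\<mu>) = (\<integral>\<^sup>+x. f (h (h' c + x)) \<partial>lborel)"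
      by (simp add: \<mu>_def nn_integral_distr linear_add[OF h] hh')
    also have "\<dots> = (\<integral>\<^sup>+x. f (h x) \<partial>lborel)"
      by (rule nn_integral_lborel_translate[where f = "\<lambda>x. f (h x)"]) measurable
    finally show ?thesis by (simp add: \<mu>_def nn_integral_distr)
  qed
  interpret \<mu>: sigma_finite_measure \<mu>
  proof
    have "(\<Union>n. {y. norm y \<le> real n}) = (UNIV :: 'a set)"
      by (auto intro: real_arch_simple)
    moreover have "emeasure \<mu> {y. norm y \<le> real n} \<noteq> \<infinity>" for n
    proof -
      have "bounded (h -` cball 0 (real n))" unfolding im using h'
        by (intro bounded_linear_image) (auto simp: linear_conv_bounded_linear)
      moreover have "{y::'a. norm y \<le> real n} = cball 0 (real n)" by auto
      ultimately show ?thesis using emeasure_bounded_finite by (simp add: em less_top[symmetric])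
    qed
    moreover have "{y::'a. norm y \<le> real n} \<in> sets borel" for n by measurable
    ultimately show "\<exists>A. countable A \<and> A \<subseteq> sets \<mu> \<and> \<Union> A = space \<mu> \<and> (\<forall>a\<in>A. emeasure \<mu> a \<noteq> \<infinity>)"
      by (intro exI[of _ "range (\<lambda>n. {y. norm y \<le> real n})"]) (auto simp: \<mu>_def)
  qed
  interpret P: pair_sigma_finite \<mu> "lborel :: 'a measure" ..
  have main: "emeasure \<mu> A = emeasure \<mu> ?B * emeasure lborel A" if [measurable]: "A \<in> sets borel" for A
  proof -
    \<comment> \<open>A double integral over \<mu> and Lebesgue measure: invariance of \<mu> moves
      the translation from the box to A, and Lebesgue measure then integrates A to a constant by
      translation and reflection.\<close>
    have "emeasure \<mu> A * emeasure lborel ?B = (\<integral>\<^sup>+x. indicator A x * (\<integral>\<^sup>+y. indicator ?B y \<partial>lborel) \<partial>\<mu>)"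
      by (simp add: nn_integral_multc)
    also have "\<dots> = (\<integral>\<^sup>+x. (\<integral>\<^sup>+y. indicator A x * indicator ?B (x + y) \<partial>lborel) \<partial>\<mu>)"
      by (intro nn_integral_cong)
        (subst nn_integral_cmult, simp_all add: nn_integral_lborel_translate[of "indicator ?B"])
    also have "\<dots> = (\<integral>\<^sup>+y. (\<integral>\<^sup>+x. indicator A x * indicator ?B (x + y) \<partial>\<mu>) \<partial>lborel)"
      by (rule P.Fubini'[symmetric]) measurable
    also have "\<dots> = (\<integral>\<^sup>+y. (\<integral>\<^sup>+x. indicator A (x - y) * indicator ?B x \<partial>\<mu>) \<partial>lborel)"
    proof (rule nn_integral_cong)
      fix y :: 'a
      show "(\<integral>\<^sup>+x. indicator A x * indicator ?B (x + y) \<partial>\<mu>) = (\<integral>\<^sup>+x. indicator A (x - y) * indicator ?B x \<partial>\<mu>)"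
        using tr[of "\<lambda>x. indicator A (x - y) * indicator ?B x" y] by (simp add: add.commute)
    qed
    also have "\<dots> = (\<integral>\<^sup>+x. (\<integral>\<^sup>+y. indicator A (x - y) * indicator ?B x \<partial>lborel) \<partial>\<mu>)"
      by (rule P.Fubini') measurable
    also have "\<dots> = (\<integral>\<^sup>+x. emeasure lborel A * indicator ?B x \<partial>\<mu>)"
    proof (rule nn_integral_cong)
      fix x :: 'a
      have "(\<integral>\<^sup>+y. indicator A (x - y) \<partial>lborel) = (\<integral>\<^sup>+y. indicator A (x + y) \<partial>lborel)"
        using nn_integral_lborel_uminus[of "\<lambda>y. indicator A (x + y)"] by simp
      also have "\<dots> = emeasure lborel A"
        using nn_integral_lborel_translate[of "indicator A" x] by simp
      finally show "(\<integral>\<^sup>+y. indicator A (x - y) * indicator ?B x \<partial>lborel) = emeasure lborel A * indicator ?B x"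
        by (subst nn_integral_multc) auto
    qed
    also have "\<dots> = emeasure \<mu> ?B * emeasure lborel A"
      by (subst nn_integral_cmult) (auto simp: mult.commute)
    finally show ?thesis by simp
  qed
  \<comment> \<open>E is the volume of the preimage of the unit cube, the reciprocal of the
    Jacobian.\<close>
  define E where "E = measure \<mu> ?B"
  have Ee: "emeasure \<mu> ?B = ennreal E" using B1 by (simp add: E_def emeasure_eq_ennreal_measure)
  have "E \<noteq> 0"
  proof
    assume "E = 0"
    then have "emeasure \<mu> UNIV = 0" using main[of UNIV] Ee by simp
    then show False by (simp add: em)
  qed
  then have E0: "0 < E" using measure_nonneg[of \<mu> ?B] unfolding E_def by linarith
  have "inverse E * measure lborel (h -` A) = measure lborel A" if "A \<in> sets borel" for A
  proof -
    have "measure lborel (h -` A) = E * measure lborel A"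
      using main[OF that] E0 by (simp add: em[OF that] Ee measure_def enn2real_mult)
    then show ?thesis using E0 by simp
  qed
  then show ?thesis using that[of "inverse E"] E0 by simp
qed

text \<open>The points of a separated set lie in different balls of radius r/2 of a fixed finite
  cover, which bounds their number. A separated set of greatest cardinality admits no further point
  and is therefore an r-net.\<close>

lemma maximal_separated_subset:
  fixes Y :: "'a::heine_borel set"
  assumes "bounded Y" "0 < r"
  obtains C where "finite C" "C \<subseteq> Y" "\<And>v v'. v \<in> C \<Longrightarrow> v' \<in> C \<Longrightarrow> v \<noteq> v' \<Longrightarrow> r < dist v v'"
    "\<And>y. y \<in> Y \<Longrightarrow> \<exists>v\<in>C. dist y v \<le> r"
proof -
  let ?P = "\<lambda>C. finite C \<and> C \<subseteq> Y \<and> (\<forall>v\<in>C. \<forall>v'\<in>C. v \<noteq> v' \<longrightarrow> r < dist v v')"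
  have "compact (closure Y)" using assms by simp
  then obtain K where K: "finite K" "closure Y \<subseteq> (\<Union>x\<in>K. ball x (r/2))"
    using assms(2) unfolding compact_eq_totally_bounded by (meson half_gt_zero)
  have bd: "card C \<le> card K" if C: "?P C" for C
  proof -
    have "\<forall>v\<in>C. \<exists>x\<in>K. dist x v < r/2"
      using C K(2) closure_subset[of Y] by (fastforce simp: subset_iff)
    then obtain \<phi> where \<phi>: "\<And>v. v \<in> C \<Longrightarrow> \<phi> v \<in> K \<and> dist (\<phi> v) v < r/2" by metis
    have "inj_on \<phi> C"
    proof (rule inj_onI, rule ccontr)
      fix v v' assume v: "v \<in> C" "v' \<in> C" "\<phi> v = \<phi> v'" "v \<noteq> v'"
      then have "dist v v' < r"
        using dist_triangle_half_r[of "\<phi> v" v r v'] \<phi>[of v] \<phi>[of v'] by auto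
      then show False using C v by force
    qed
    then show ?thesis using \<phi> K(1) by (intro card_inj_on_le) auto
  qed
  have "?P {}" by simp
  moreover have "\<forall>C. ?P C \<longrightarrow> card C < Suc (card K)" by (intro allI impI le_imp_less_Suc) (rule bd)
  ultimately have "\<exists>C. ?P C \<and> (\<forall>C'. ?P C' \<longrightarrow> card C' \<le> card C)"
    by (rule ex_has_greatest_nat)
  then obtain C where C: "?P C" "\<And>C'. ?P C' \<Longrightarrow> card C' \<le> card C" by (elim exE conjE) blast
  have "\<exists>v\<in>C. dist y v \<le> r" if y: "y \<in> Y" for y
  proof (rule ccontr)
    assume "\<not> ?thesis"
    then have n: "\<And>v. v \<in> C \<Longrightarrow> r < dist y v" by force
    then have "y \<notin> C" using assms(2) by force
    moreover have "?P (insert y C)" using C(1) y n by (auto simp: dist_commute)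
    ultimately show False using C(2)[of "insert y C"] C(1) by simp
  qed
  then show ?thesis using C(1) by (intro that[of C]) auto
qed

section \<open>Cantor sets avoiding lattice points\<close>

text \<open>The map \<open>h\<close> expands the range of \<open>p\<close> and is the identity on its kernel. Thus its Jacobian \<open>D\<close>
  is that of its restriction to the range of \<open>p\<close>, although all volumes are taken in the whole space.\<close>

locale expanding_projection =
  fixes h h' p :: "'a::euclidean_space \<Rightarrow> 'a" and \<Lambda> D :: real and Z :: "'a set" and e :: 'a
  assumes h: "linear h" and h': "linear h'" and hh': "\<And>x. h (h' x) = x" and h'h: "\<And>x. h' (h x) = x"
    and p: "linear p" and pp: "\<And>x. p (p x) = p x" and ph: "\<And>x. p (h x) = h (p x)"
    and hq: "\<And>x. h (x - p x) = x - p x"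
    and expand: "\<And>x. \<Lambda> * norm (p x) \<le> norm (h (p x))" and \<Lambda>: "8 \<le> \<Lambda>"
    and e: "p e = e" "norm e = 1"
    and Z: "\<And>z z'. z \<in> Z \<Longrightarrow> z' \<in> Z \<Longrightarrow> z \<noteq> z' \<Longrightarrow> 1 \<le> dist z z'"
    and D0: "0 < D" and D: "\<And>A. A \<in> sets borel \<Longrightarrow> D * measure lborel (h -` A) = measure lborel A"
begin

lemma continuous_on_lin: "linear k \<Longrightarrow> continuous_on A f \<Longrightarrow> continuous_on A (\<lambda>x. k (f x))"
  for k :: "'a \<Rightarrow> 'a"
  by (rule continuous_on_compose2[of UNIV k]) (auto simp: linear_continuous_on linear_conv_bounded_linear)

lemma measurable_lin: "linear k \<Longrightarrow> k \<in> borel_measurable borel"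
  for k :: "'a \<Rightarrow> 'a"
  by (intro borel_measurable_continuous_onI) (simp add: linear_continuous_on linear_conv_bounded_linear)

lemmas measurable_h [measurable] = measurable_lin[OF h] and measurable_p [measurable] = measurable_lin[OF p]
  and measurable_h' [measurable] = measurable_lin[OF h']

text \<open>\<open>cyl\<close> bounds the component p y and \<open>slab\<close> the complementary
  one, so together they form a product of two balls adapted to the splitting. A slab is its own
  preimage under h and serves to make volumes finite.\<close>

definition slab :: "'a \<Rightarrow> real \<Rightarrow> 'a set" where
  "slab b r = {y. norm (y - p y - b) \<le> r}"

definition cyl :: "'a \<Rightarrow> real \<Rightarrow> 'a set" where
  "cyl w r = {y. norm (p y - w) \<le> r}"

definition vol :: "real \<Rightarrow> real \<Rightarrow> real" where
  "vol a b = measure lborel (cyl 0 a \<inter> slab 0 b)"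

lemma closed_slab: "closed (slab b r)"
  unfolding slab_def by (intro closed_Collect_le continuous_on_norm continuous_on_diff continuous_on_lin[OF p] continuous_on_id continuous_on_const)

lemma closed_cyl: "closed (cyl w r)"
  unfolding cyl_def by (intro closed_Collect_le continuous_on_norm continuous_on_diff continuous_on_lin[OF p] continuous_on_id continuous_on_const)

lemma bounded_cyl_slab: "bounded (cyl w r \<inter> slab b r')"
proof (rule boundedI[where B = "r + norm w + (r' + norm b)"])
  fix y assume "y \<in> cyl w r \<inter> slab b r'"
  then have "norm (p y) \<le> r + norm w" "norm (y - p y) \<le> r' + norm b"
    using norm_triangle_ineq2[of "p y" w] norm_triangle_ineq2[of "y - p y" b] by (auto simp: cyl_def slab_def)
  then show "norm y \<le> r + norm w + (r' + norm b)"
    using norm_triangle_ineq[of "p y" "y - p y"] by simp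
qed

lemma fmeasurable_closed: "closed A \<Longrightarrow> bounded A \<Longrightarrow> A \<in> fmeasurable lborel"
  by (simp add: compact_eq_bounded_closed fmeasurable_compact)

lemma fmeasurable_closed_cyl_slab:
  "closed A \<Longrightarrow> A \<subseteq> cyl w r \<Longrightarrow> A \<inter> slab b r' \<in> fmeasurable lborel"
  by (rule fmeasurable_closed) (auto intro: closed_slab bounded_subset[OF bounded_cyl_slab, of _ w r b r'])

lemma measure_lborel_translate:
  assumes "A \<in> sets borel"
  shows "measure lborel ((+) c -` A) = measure lborel (A :: 'a set)"
proof -
  have "measure (distr lborel borel ((+) c)) A = measure lborel ((+) c -` A)"
    using assms by (subst measure_distr) auto
  then show ?thesis by (simp add: lborel_distr_plus)
qed

lemma measure_cyl_slab:
  assumes w: "p w = w" and b: "p b = 0"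
  shows "measure lborel (cyl w r \<inter> slab b r') = vol r r'"
proof -
  have "cyl 0 r \<inter> slab 0 r' = (+) (w + b) -` (cyl w r \<inter> slab b r')"
    by (auto simp: cyl_def slab_def linear_add[OF p] w b algebra_simps)
  then show ?thesis
    unfolding vol_def using measure_lborel_translate[of "cyl w r \<inter> slab b r'" "w + b"]
    by (simp add: borel_closed closed_cyl closed_slab)
qed

lemma vol_pos: assumes "0 < a" "0 < b" shows "0 < vol a b"
proof -
  let ?U = "{y. norm (p y) < a} \<inter> {y. norm (y - p y) < b}"
  have "open ?U" by (intro open_Int open_Collect_less continuous_on_norm continuous_on_diff continuous_on_lin[OF p] continuous_on_id continuous_on_const)
  moreover have "0 \<in> ?U" using assms by (simp add: linear_0[OF p])
  ultimately obtain d where d: "0 < d" "ball 0 d \<subseteq> ?U" by (meson openE)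
  have "0 < measure lborel (ball (0::'a) d)"
    using content_ball_pos[OF d(1)] by simp
  also have "\<dots> \<le> vol a b"
    unfolding vol_def
  proof (rule measure_mono_fmeasurable)
    show "ball 0 d \<subseteq> cyl 0 a \<inter> slab 0 b" using d(2) by (auto simp: cyl_def slab_def subset_iff less_imp_le)
    show "cyl 0 a \<inter> slab 0 b \<in> fmeasurable lborel"
      by (rule fmeasurable_closed_cyl_slab[OF closed_cyl order_refl])
  qed simp
  finally show ?thesis .
qed

text \<open>The guaranteed proportion of volume per generation: 1/64 is the radius that gets filled
  with children, 1/4 the radius of the cylinders that cover its image. Only p enters, so \<Lambda>
  may be chosen afterwards.\<close>

definition \<kappa> :: real where "\<kappa> = vol (1/64) 1 / vol (1/4) 1"

lemma \<kappa>_pos: "0 < \<kappa>"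
  by (simp add: \<kappa>_def vol_pos)

lemma \<kappa>_le_1: "\<kappa> \<le> 1"
proof -
  have "vol (1/64) 1 \<le> vol (1/4) 1"
    unfolding vol_def
  proof (rule measure_mono_fmeasurable)
    show "cyl 0 (1/64) \<inter> slab 0 1 \<subseteq> cyl 0 (1/4) \<inter> slab 0 1" by (auto simp: cyl_def)
    show "cyl 0 (1/4) \<inter> slab 0 1 \<in> fmeasurable lborel"
      by (rule fmeasurable_closed_cyl_slab[OF closed_cyl order_refl])
  qed (simp add: borel_closed closed_cyl closed_slab)
  then show ?thesis using vol_pos[of "1/4" 1] by (simp add: \<kappa>_def)
qed

text \<open>The points v are the centres of the children after magnification by h. Distance above
  1/4 separates the cylinders of radius 1/8 about them; the last clause puts their preimages into
  the parent and away from Z.\<close>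

definition is_family :: "'a \<Rightarrow> 'a set \<Rightarrow> bool" where
  "is_family w C \<longleftrightarrow> finite C \<and> (\<forall>v\<in>C. p v = v) \<and> (\<forall>v\<in>C. \<forall>v'\<in>C. v \<noteq> v' \<longrightarrow> 1/4 < dist v v') \<and>
     (\<forall>v\<in>C. \<forall>u. p u = u \<longrightarrow> norm (h u - v) \<le> 1/8 \<longrightarrow> norm (u - w) \<le> 1/8 \<and> (\<forall>z\<in>Z. 1/16 \<le> dist u z))"

text \<open>At most one point of \<open>Z\<close> is close to the ball of radius \<open>1/8\<close> about \<open>w\<close>, and it cannot be
  close to both of two subballs of radius \<open>1/32\<close> at opposite ends.\<close>

lemma avoiding_subball:
  assumes w: "p w = w"
  obtains w' where "p w' = w'"
    "\<And>u. norm (u - w') \<le> 1/32 \<Longrightarrow> norm (u - w) \<le> 1/8 \<and> (\<forall>z\<in>Z. 1/16 \<le> dist u z)"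
proof -
  have good: "norm (u - w) \<le> 1/8" if "norm (u - (w + s *\<^sub>R e)) \<le> 1/32" "\<bar>s\<bar> = 3/32" for u s
  proof -
    have "u - w = (u - (w + s *\<^sub>R e)) + s *\<^sub>R e" by simp
    then have "norm (u - w) \<le> norm (u - (w + s *\<^sub>R e)) + norm (s *\<^sub>R e)" by (metis norm_triangle_ineq)
    then show ?thesis using that by (simp add: e)
  qed
  \<comment> \<open>Since 3/32 + 1/32 = 1/8, both candidates lie in the ball about w, and points of
    different candidates are at least 6/32 - 2/32 = 1/8 apart. Two points within 1/16 of the same z
    are closer than that; two distinct points of Z would be at distance below 3/8.\<close>
  have "\<exists>s. \<bar>s\<bar> = 3/32 \<and> (\<forall>u. norm (u - (w + s *\<^sub>R e)) \<le> 1/32 \<longrightarrow> (\<forall>z\<in>Z. 1/16 \<le> dist u z))"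
  proof (rule ccontr)
    assume "\<not> ?thesis"
    then have n: "\<And>s. \<bar>s\<bar> = 3/32 \<Longrightarrow> \<exists>u. norm (u - (w + s *\<^sub>R e)) \<le> 1/32 \<and> (\<exists>z\<in>Z. dist u z < 1/16)"
      by (meson not_le_imp_less)
    obtain u z where u: "norm (u - (w + (3/32) *\<^sub>R e)) \<le> 1/32" "z \<in> Z" "dist u z < 1/16"
      using n[of "3/32"] by auto
    obtain u' z' where u': "norm (u' - (w + (-3/32) *\<^sub>R e)) \<le> 1/32" "z' \<in> Z" "dist u' z' < 1/16"
      using n[of "-3/32"] by auto
    have uw: "dist u w \<le> 1/8" "dist u' w \<le> 1/8" using good[OF u(1)] good[OF u'(1)] by (auto simp: dist_norm)
    have tri: "dist z z' \<le> dist u z + dist u w + dist u' w + dist u' z'"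
      using dist_triangle2[of z z' u] dist_triangle[of u z' u'] dist_triangle2[of u u' w]
      unfolding dist_commute[of z u] dist_commute[of z' u] by linarith
    have "z = z'"
    proof (rule ccontr)
      assume "z \<noteq> z'"
      with Z[OF u(2) u'(2)] tri uw u(3) u'(3) show False by simp
    qed
    then have "dist u u' < 1/8" using u(3) u'(3) dist_triangle_half_l[of u z "1/8" u'] by simp
    moreover have "dist u u' \<ge> 1/8"
    proof -
      have "(3/16) *\<^sub>R e = (u - u') - (u - (w + (3/32) *\<^sub>R e)) + (u' - (w + (-3/32) *\<^sub>R e))"
        by (simp add: algebra_simps flip: scaleR_add_left)
      then have "norm ((3/16) *\<^sub>R e) \<le> norm (u - u') + norm (u - (w + (3/32) *\<^sub>R e)) + norm (u' - (w + (-3/32) *\<^sub>R e))"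
        using norm_triangle_ineq norm_triangle_ineq4 by (smt (verit))
      then show ?thesis using u(1) u'(1) e(2) by (simp add: dist_norm)
    qed
    ultimately show False by simp
  qed
  then obtain s where s: "\<bar>s\<bar> = 3/32"
    "\<And>u. norm (u - (w + s *\<^sub>R e)) \<le> 1/32 \<Longrightarrow> \<forall>z\<in>Z. 1/16 \<le> dist u z" by auto
  show ?thesis
  proof (rule that[of "w + s *\<^sub>R e"])
    show "p (w + s *\<^sub>R e) = w + s *\<^sub>R e" by (simp add: linear_add[OF p] linear_scale[OF p] w e)
  qed (use s good in auto)
qed

section \<open>Families of children with a common cardinality\<close>

lemma expand': "p x = x \<Longrightarrow> \<Lambda> * norm x \<le> norm (h x)"
  using expand[of x] by simp

lemma ph': "p (h' x) = h' (p x)"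
  by (metis h'h hh' ph)

lemma qh: "h y - p (h y) = y - p y"
proof -
  have "h y - p (h y) = h (y - p y)" by (simp add: ph linear_diff[OF h])
  then show ?thesis by (simp add: hq)
qed

lemma qh': "h' y - p (h' y) = y - p y"
  using qh[of "h' y"] by (simp add: hh')

text \<open>A maximal 1/4-separated set in the image of a ball of radius 1/64 does it: the cylinders
  of radius 1/4 about its points cover an image of D times the original volume, and dividing by the
  volume of one cylinder gives the count.\<close>

lemma exists_family:
  assumes w: "p w = w"
  shows "\<exists>C. is_family w C \<and> \<kappa> * D \<le> card C"
proof -
  obtain w' where w': "p w' = w'"
    "\<And>u. norm (u - w') \<le> 1/32 \<Longrightarrow> norm (u - w) \<le> 1/8 \<and> (\<forall>z\<in>Z. 1/16 \<le> dist u z)"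
    using avoiding_subball[OF w] by metis
  define X where "X = {x. p x = x \<and> norm (x - w') \<le> 1/64}"
  have "bounded X"
    by (rule bounded_subset[of "cball w' (1/64)"]) (auto simp: X_def dist_norm norm_minus_commute)
  then have "bounded (h ` X)"
    by (rule bounded_linear_image) (use h in \<open>simp add: linear_conv_bounded_linear\<close>)
  then obtain C where C: "finite C" "C \<subseteq> h ` X" "\<And>v v'. v \<in> C \<Longrightarrow> v' \<in> C \<Longrightarrow> v \<noteq> v' \<Longrightarrow> 1/4 < dist v v'"
    "\<And>y. y \<in> h ` X \<Longrightarrow> \<exists>v\<in>C. dist y v \<le> 1/4"
    by (rule maximal_separated_subset[of _ "1/4"]) auto
  have pC: "p v = v" if "v \<in> C" for v using that C(2) by (auto simp: X_def ph)
  have "is_family w C"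
    unfolding is_family_def
  proof (intro conjI ballI allI impI)
    fix v u assume v: "v \<in> C" and u: "p u = u" "norm (h u - v) \<le> 1/8"
    obtain x where x: "p x = x" "norm (x - w') \<le> 1/64" "v = h x" using v C(2) by (auto simp: X_def)
    have "\<Lambda> * norm (u - x) \<le> norm (h (u - x))"
      by (rule expand') (simp add: linear_diff[OF p] u x)
    also have "\<dots> \<le> 1/8" using u by (simp add: x linear_diff[OF h])
    \<comment> \<open>The bound 8 \<le> \<Lambda> enters here: the preimage of a ball of radius 1/8
      has radius at most 1/64, and 1/64 + 1/64 = 1/32.\<close>
    finally have "8 * norm (u - x) \<le> 1/8"
      using \<Lambda> mult_right_mono[OF \<Lambda>, of "norm (u - x)"] by simp
    then have *: "norm (u - w') \<le> 1/32" using x(2) norm_triangle_ineq[of "u - x" "x - w'"] by simp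
    show "norm (u - w) \<le> 1/8" using w'(2)[OF *] by simp
    show "1/16 \<le> dist u z" if "z \<in> Z" for z using w'(2)[OF *] that by simp
  qed (use C pC in auto)
  moreover have "\<kappa> * D \<le> card C"
  proof -
    let ?A = "cyl w' (1/64) \<inter> slab 0 1"
    have A: "?A \<in> sets borel" by (intro sets.Int borel_closed closed_cyl closed_slab)
    have "D * vol (1/64) 1 = D * measure lborel ?A"
      using measure_cyl_slab[OF w'(1), of 0] by (simp add: linear_0[OF p])
    also have "\<dots> = measure lborel (h' -` ?A)"
    proof -
      have eq: "h -` (h' -` ?A) = ?A" by (auto simp: h'h)
      have "h' -` ?A \<in> sets borel" using measurable_sets[OF measurable_h' A] by simp
      from D[OF this] show ?thesis by (simp only: eq)
    qed
    also have "\<dots> \<le> measure lborel (\<Union>v\<in>C. cyl v (1/4) \<inter> slab 0 1)"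
    proof (rule measure_mono_fmeasurable)
      show "h' -` ?A \<subseteq> (\<Union>v\<in>C. cyl v (1/4) \<inter> slab 0 1)"
      proof
        fix y assume y: "y \<in> h' -` ?A"
        then have "h' (p y) \<in> X" by (simp add: X_def cyl_def ph' pp)
        then obtain v where "v \<in> C" "dist (p y) v \<le> 1/4" using C(4)[of "p y"] by (metis hh' image_eqI)
        then show "y \<in> (\<Union>v\<in>C. cyl v (1/4) \<inter> slab 0 1)"
          using y by (auto simp: cyl_def slab_def qh' dist_norm)
      qed
      show "h' -` ?A \<in> sets lborel" using measurable_sets[OF measurable_h' A] by simp
      show "(\<Union>v\<in>C. cyl v (1/4) \<inter> slab 0 1) \<in> fmeasurable lborel"
        by (intro fmeasurable.finite_UN C(1) fmeasurable_closed_cyl_slab[OF closed_cyl order_refl])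
    qed
    also have "\<dots> \<le> (\<Sum>v\<in>C. measure lborel (cyl v (1/4) \<inter> slab 0 1))"
      by (rule measure_UNION_le[OF C(1)]) (intro sets.Int; simp add: borel_closed closed_cyl closed_slab)
    also have "\<dots> = (\<Sum>v\<in>C. vol (1/4) 1)"
      by (intro sum.cong refl measure_cyl_slab) (auto simp: pC linear_0[OF p])
    also have "\<dots> = card C * vol (1/4) 1" by simp
    finally show ?thesis using vol_pos[of "1/4" 1] by (simp add: \<kappa>_def field_simps)
  qed
  ultimately show ?thesis by blast
qed

text \<open>Surplus children are discarded so that every parent has the same number of them. All
  pieces of one generation then have equal mass, which gives the exact formula in
  \<open>measure_pieces_slab\<close>.\<close>

definition m :: nat where "m = nat \<lceil>\<kappa> * D\<rceil>"

lemma m_ge: "\<kappa> * D \<le> m"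
  unfolding m_def by linarith

lemma m_pos: "0 < real m"
  using m_ge \<kappa>_pos D0 mult_pos_pos[of \<kappa> D] by linarith

definition fam :: "'a \<Rightarrow> 'a set" where
  "fam w = (SOME C. is_family w C \<and> card C = m)"

lemma fam:
  assumes "p w = w"
  shows "is_family w (fam w)" "card (fam w) = m"
proof -
  obtain C where C: "is_family w C" "\<kappa> * D \<le> card C" using exists_family[OF assms] by blast
  then have "m \<le> card C" unfolding m_def by linarith
  then obtain C' where C': "C' \<subseteq> C" "card C' = m" by (meson obtain_subset_with_card_n)
  have "is_family w C'"
    unfolding is_family_def
  proof (intro conjI)
    show "finite C'" using C(1) C'(1) by (auto simp: is_family_def intro: finite_subset)
  qed (use C(1) C'(1) in \<open>unfold is_family_def, blast+\<close>)
  then have "\<exists>C. is_family w C \<and> card C = m" using C'(2) by blast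
  then have "is_family w (fam w) \<and> card (fam w) = m" unfolding fam_def by (rule someI_ex)
  then show "is_family w (fam w)" "card (fam w) = m" by auto
qed

lemma fam_finite: "p w = w \<Longrightarrow> finite (fam w)"
  using fam(1) by (simp add: is_family_def)

lemma fam_p: "p w = w \<Longrightarrow> v \<in> fam w \<Longrightarrow> p v = v"
  using fam(1) by (simp add: is_family_def)

lemma fam_child:
  assumes "p w = w" "v \<in> fam w" "p u = u" "norm (h u - v) \<le> 1/8"
  shows "norm (u - w) \<le> 1/8" "z \<in> Z \<Longrightarrow> 1/16 \<le> dist u z"
proof -
  have *: "norm (u - w) \<le> 1/8 \<and> (\<forall>z\<in>Z. 1/16 \<le> dist u z)"
    using fam(1)[OF assms(1)] assms unfolding is_family_def by blast
  show "norm (u - w) \<le> 1/8" using * ..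
  show "z \<in> Z \<Longrightarrow> 1/16 \<le> dist u z" using * by blast
qed

lemma fam_disjoint:
  assumes "p w = w" "v \<in> fam w" "v' \<in> fam w" "v \<noteq> v'"
  shows "cyl v (1/8) \<inter> cyl v' (1/8) = {}"
proof -
  have "1/4 < dist v v'" using fam(1)[OF assms(1)] assms unfolding is_family_def by blast
  then have "\<not> (norm (p y - v) \<le> 1/8 \<and> norm (p y - v') \<le> 1/8)" for y
    using dist_triangle2[of v v' "p y"] by (simp add: dist_norm norm_minus_commute)
  then show ?thesis by (auto simp: cyl_def)
qed

text \<open>The recursion is on the magnified side: h carries the part inside a child to a full
  construction about the centre v. Every estimate thus reduces, by one application of h, to the same
  estimate about v at a lower stage.\<close>

fun pieces :: "nat \<Rightarrow> 'a \<Rightarrow> 'a set" where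
  "pieces 0 w = cyl w (1/8)"
| "pieces (Suc k) w = (\<Union>v\<in>fam w. h -` pieces k v)"

lemma closed_vimage_h: "closed A \<Longrightarrow> closed (h -` A)"
  using continuous_closed_vimage[of A h] h by (simp add: linear_continuous_at linear_conv_bounded_linear)

lemma closed_pieces: "p w = w \<Longrightarrow> closed (pieces k w)"
  by (induction k arbitrary: w) (auto intro!: closed_cyl closed_UN fam_finite closed_vimage_h dest: fam_p)

lemma vimage_cyl_subset: "p w = w \<Longrightarrow> v \<in> fam w \<Longrightarrow> h -` cyl v (1/8) \<subseteq> cyl w (1/8)"
  using fam_child(1)[of w v "p _"] by (auto simp: cyl_def ph pp)

lemma pieces_Suc_subset: "p w = w \<Longrightarrow> pieces (Suc k) w \<subseteq> pieces k w"
proof (induction k arbitrary: w)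
  case 0
  then show ?case using vimage_cyl_subset by auto
next
  case (Suc k)
  have "h -` pieces (Suc k) v \<subseteq> h -` pieces k v" if "v \<in> fam w" for v
    using Suc.IH[OF fam_p[OF Suc.prems that]] by blast
  then show ?case unfolding pieces.simps(2)[of "Suc k" w] pieces.simps(2)[of k w] by blast
qed

lemma pieces_antimono: "p w = w \<Longrightarrow> i \<le> k \<Longrightarrow> pieces k w \<subseteq> pieces i w"
  using lift_Suc_antimono_le[of "\<lambda>k. pieces k w"] pieces_Suc_subset by blast

lemma pieces_subset_cyl: "p w = w \<Longrightarrow> pieces k w \<subseteq> cyl w (1/8)"
  using pieces_antimono[of w 0 k] by simp

lemma pieces_translate:
  assumes b: "p b = 0"
  shows "p w = w \<Longrightarrow> y \<in> pieces k w \<Longrightarrow> y + b \<in> pieces k w"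
proof (induction k arbitrary: w y)
  case 0
  then show ?case by (simp add: cyl_def linear_add[OF p] b)
next
  case (Suc k)
  then obtain v where v: "v \<in> fam w" "h y \<in> pieces k v" by auto
  have "h b = b" using hq[of b] b by simp
  then have "h (y + b) \<in> pieces k v"
    using Suc.IH[OF fam_p[OF Suc.prems(1) v(1)] v(2)] by (simp add: linear_add[OF h])
  then show ?case using v(1) by auto
qed

text \<open>Stage 0 is a full cylinder and avoids nothing, so time k is controlled by stage k +
  1.\<close>

lemma pieces_avoid:
  "p w = w \<Longrightarrow> y \<in> pieces (Suc k) w \<Longrightarrow> z \<in> Z \<Longrightarrow> 1/16 \<le> dist ((h ^^ k) (p y)) z"
proof (induction k arbitrary: w y)
  case 0
  then obtain v where "v \<in> fam w" "h y \<in> cyl v (1/8)" by auto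
  then show ?case using fam_child(2)[of w v "p y" z] 0 by (simp add: cyl_def ph pp)
next
  case (Suc k)
  from Suc.prems(2) obtain v where v: "v \<in> fam w" "h y \<in> pieces (Suc k) v"
    unfolding pieces.simps(2)[of "Suc k" w] by blast
  have "1/16 \<le> dist ((h ^^ k) (p (h y))) z"
    by (rule Suc.IH[OF fam_p[OF Suc.prems(1) v(1)] v(2) Suc.prems(3)])
  then show ?case by (simp add: ph funpow_swap1)
qed

lemma sets_pieces [measurable]: "p w = w \<Longrightarrow> pieces k w \<in> sets borel"
  by (intro borel_closed closed_pieces)

text \<open>The pieces over distinct children are disjoint, so their measures add up; the slabs are
  invariant under \<open>h\<close>.\<close>

lemma measure_pieces_Suc:
  assumes w: "p w = w" and B [measurable]: "B \<in> sets borel" and bd: "bounded (cyl w (1/8) \<inter> h -` B)"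
  shows "D * measure lborel (pieces (Suc k) w \<inter> h -` B) = (\<Sum>v\<in>fam w. measure lborel (pieces k v \<inter> B))"
proof -
  let ?P = "\<lambda>v. h -` (pieces k v \<inter> B)"
  have meas: "?P v \<in> sets borel" if "v \<in> fam w" for v
  proof -
    have "pieces k v \<inter> B \<in> sets borel" using sets_pieces[OF fam_p[OF w that]] B by simp
    from measurable_sets[OF measurable_h this] show ?thesis by simp
  qed
  have sub: "?P v \<subseteq> cyl w (1/8) \<inter> h -` B" if "v \<in> fam w" for v
    using pieces_subset_cyl[OF fam_p[OF w that], of k] vimage_cyl_subset[OF w that] by blast
  have "measure lborel (\<Union>v\<in>fam w. ?P v) = (\<Sum>v\<in>fam w. measure lborel (?P v))"
  proof (rule measure_finite_Union)
    show "disjoint_family_on ?P (fam w)"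
      unfolding disjoint_family_on_def
    proof (intro ballI impI)
      fix v v' assume v: "v \<in> fam w" "v' \<in> fam w" "v \<noteq> v'"
      then show "?P v \<inter> ?P v' = {}"
        using fam_disjoint[OF w v] pieces_subset_cyl[OF fam_p[OF w v(1)], of k]
          pieces_subset_cyl[OF fam_p[OF w v(2)], of k] by blast
    qed
    show "emeasure lborel (?P v) \<noteq> \<infinity>" if "v \<in> fam w" for v
      using emeasure_bounded_finite[OF bounded_subset[OF bd sub[OF that]]] by simp
  qed (use meas fam_finite[OF w] in auto)
  moreover have "(\<Union>v\<in>fam w. ?P v) = pieces (Suc k) w \<inter> h -` B" by auto
  ultimately have "D * measure lborel (pieces (Suc k) w \<inter> h -` B) = (\<Sum>v\<in>fam w. D * measure lborel (?P v))"
    by (simp add: sum_distrib_left)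
  also have "\<dots> = (\<Sum>v\<in>fam w. measure lborel (pieces k v \<inter> B))"
    using sets_pieces[OF fam_p[OF w]] B by (intro sum.cong refl D) simp
  finally show ?thesis .
qed

lemma vimage_slab: "h -` slab b r = slab b r"
  by (auto simp: slab_def qh)

text \<open>There are m children and taking preimages divides volume by D, so a generation
  multiplies the mass by m / D.\<close>

lemma measure_pieces_slab:
  assumes b: "p b = 0"
  shows "p w = w \<Longrightarrow> measure lborel (pieces k w \<inter> slab b r) = (m / D) ^ k * vol (1/8) r"
proof (induction k arbitrary: w)
  case 0
  then show ?case by (simp add: measure_cyl_slab b)
next
  case (Suc k)
  have "D * measure lborel (pieces (Suc k) w \<inter> slab b r) = (\<Sum>v\<in>fam w. measure lborel (pieces k v \<inter> slab b r))"
    using measure_pieces_Suc[OF Suc.prems, of "slab b r" k] bounded_cyl_slab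
    by (simp add: vimage_slab borel_closed closed_slab)
  also have "\<dots> = (\<Sum>v\<in>fam w. (m / D) ^ k * vol (1/8) r)"
    using Suc.IH fam_p[OF Suc.prems] by (intro sum.cong) auto
  also have "\<dots> = m * ((m / D) ^ k * vol (1/8) r)" by (simp add: fam(2)[OF Suc.prems])
  finally show ?case using D0 by (simp add: field_simps)
qed

text \<open>The map \<sigma> is there for the induction that follows: a tube for \<sigma> is the
  preimage under h of a tube for \<sigma> composed with \<open>h'\<close>. Starting from the
  identity, balls may turn into arbitrary ellipsoids along the way.\<close>

definition tube :: "('a \<Rightarrow> 'a) \<Rightarrow> 'a \<Rightarrow> real \<Rightarrow> 'a set" where
  "tube \<sigma> a r = {y. norm (\<sigma> (p y) - a) \<le> r}"

lemma closed_tube: "linear \<sigma> \<Longrightarrow> closed (tube \<sigma> a r)"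
  unfolding tube_def
  by (intro closed_Collect_le continuous_on_norm continuous_on_diff continuous_on_lin[of \<sigma>]
      continuous_on_lin[OF p] continuous_on_id continuous_on_const)

text \<open>A set of diameter \<open>r\<close> only meets pieces of generation \<open>i\<close> that lie in its
  \<open>s\<close>-neighbourhood, where \<open>s\<close> bounds the size of those pieces; within a piece the mass is
  reduced by the fixed factor \<open>(m / D) ^ k\<close>.\<close>

lemma measure_pieces_tube:
  assumes b: "p b = 0"
  shows "p w = w \<Longrightarrow> linear \<sigma> \<Longrightarrow> (\<And>x. p x = x \<Longrightarrow> norm ((h ^^ i) x) \<le> 1/4 \<Longrightarrow> norm (\<sigma> x) \<le> s) \<Longrightarrow>
    measure lborel (pieces (i + k) w \<inter> (tube \<sigma> a r \<inter> slab b r'))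
      \<le> (m / D) ^ k * measure lborel (pieces i w \<inter> (tube \<sigma> a (r + s) \<inter> slab b r'))"
proof (induction i arbitrary: w \<sigma>)
  case 0
  show ?case
  proof (cases "pieces k w \<inter> (tube \<sigma> a r \<inter> slab b r') = {}")
    case True
    then show ?thesis using m_pos D0 by simp
  next
    case False
    then obtain y0 where y0: "y0 \<in> cyl w (1/8)" "y0 \<in> tube \<sigma> a r"
      using pieces_subset_cyl[OF 0(1), of k] by blast
    have eq: "cyl w (1/8) \<inter> (tube \<sigma> a (r + s) \<inter> slab b r') = cyl w (1/8) \<inter> slab b r'"
    proof -
      have "y \<in> tube \<sigma> a (r + s)" if "y \<in> cyl w (1/8)" for y
      proof -
        have "norm (p y - p y0) \<le> 1/4"
          using that y0(1) norm_triangle_ineq4[of "p y - w" "p y0 - w"] by (simp add: cyl_def)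
        then have "norm (\<sigma> (p y - p y0)) \<le> s" using 0(3)[of "p y - p y0"] by (simp add: linear_diff[OF p] pp)
        moreover have "\<sigma> (p y) - a = (\<sigma> (p y0) - a) + \<sigma> (p y - p y0)" by (simp add: linear_diff[OF 0(2)])
        then have "norm (\<sigma> (p y) - a) \<le> norm (\<sigma> (p y0) - a) + norm (\<sigma> (p y - p y0))"
          by (simp only: norm_triangle_ineq)
        ultimately show ?thesis using y0(2) by (simp add: tube_def)
      qed
      then show ?thesis by blast
    qed
    have "measure lborel (pieces k w \<inter> (tube \<sigma> a r \<inter> slab b r')) \<le> measure lborel (pieces k w \<inter> slab b r')"
    proof (rule measure_mono_fmeasurable)
      show "pieces k w \<inter> slab b r' \<in> fmeasurable lborel"
        by (rule fmeasurable_closed_cyl_slab[OF closed_pieces[OF 0(1)] pieces_subset_cyl[OF 0(1)]])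
      show "pieces k w \<inter> (tube \<sigma> a r \<inter> slab b r') \<in> sets lborel"
        using sets_pieces[OF 0(1), of k] by (simp add: borel_closed closed_tube[OF 0(2)] closed_slab)
    qed auto
    also have "\<dots> = (m / D) ^ k * vol (1/8) r'" by (rule measure_pieces_slab[OF b 0(1)])
    also have "vol (1/8) r' = measure lborel (pieces 0 w \<inter> (tube \<sigma> a (r + s) \<inter> slab b r'))"
      by (simp add: eq measure_cyl_slab 0(1) b)
    finally show ?thesis by simp
  qed
next
  case (Suc i)
  define \<tau> where "\<tau> = (\<lambda>x. \<sigma> (h' x))"
  have \<tau>: "linear \<tau>" unfolding \<tau>_def using linear_compose[OF h' Suc.prems(2)] by (simp add: o_def)
  have \<tau>s: "norm (\<tau> x) \<le> s" if "p x = x" "norm ((h ^^ i) x) \<le> 1/4" for x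
    unfolding \<tau>_def by (rule Suc.prems(3)) (use that in \<open>simp_all add: ph' funpow_swap1 hh'\<close>)
  have tb: "tube \<sigma> a r = h -` tube \<tau> a r" for r
    by (auto simp: tube_def \<tau>_def ph h'h)
  have vt: "tube \<sigma> a r \<inter> slab b r' = h -` (tube \<tau> a r \<inter> slab b r')" for r
    by (simp add: tb vimage_slab)
  have bt: "tube \<tau> a r \<inter> slab b r' \<in> sets borel" for r
    by (simp add: borel_closed closed_tube[OF \<tau>] closed_slab)
  have bd: "bounded (cyl w (1/8) \<inter> h -` (tube \<tau> a r \<inter> slab b r'))" for r
    by (rule bounded_subset[OF bounded_cyl_slab[of w "1/8" b r']]) (auto simp: slab_def qh)
  have "D * measure lborel (pieces (Suc (i + k)) w \<inter> (tube \<sigma> a r \<inter> slab b r'))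
      = (\<Sum>v\<in>fam w. measure lborel (pieces (i + k) v \<inter> (tube \<tau> a r \<inter> slab b r')))"
    unfolding vt by (rule measure_pieces_Suc[OF Suc.prems(1) bt bd])
  also have "\<dots> \<le> (\<Sum>v\<in>fam w. (m / D) ^ k * measure lborel (pieces i v \<inter> (tube \<tau> a (r + s) \<inter> slab b r')))"
    by (rule sum_mono) (rule Suc.IH[OF fam_p[OF Suc.prems(1)] \<tau> \<tau>s])
  also have "\<dots> = (m / D) ^ k * (D * measure lborel (pieces (Suc i) w \<inter> (tube \<sigma> a (r + s) \<inter> slab b r')))"
    unfolding vt by (simp only: measure_pieces_Suc[OF Suc.prems(1) bt bd] sum_distrib_left)
  finally have "D * measure lborel (pieces (Suc i + k) w \<inter> (tube \<sigma> a r \<inter> slab b r'))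
      \<le> D * ((m / D) ^ k * measure lborel (pieces (Suc i) w \<inter> (tube \<sigma> a (r + s) \<inter> slab b r')))"
    by (simp only: add_Suc mult.left_commute)
  then show ?case using D0 by (simp only: mult_le_cancel_left_pos)
qed

lemma expand_pow: "p x = x \<Longrightarrow> \<Lambda> ^ i * norm x \<le> norm ((h ^^ i) x)"
proof (induction i)
  case 0
  then show ?case by simp
next
  case (Suc i)
  have px: "p ((h ^^ i) x) = (h ^^ i) x" by (induction i) (simp_all add: ph Suc.prems)
  have "\<Lambda> ^ Suc i * norm x = \<Lambda> * (\<Lambda> ^ i * norm x)" by simp
  also have "\<dots> \<le> \<Lambda> * norm ((h ^^ i) x)" using Suc \<Lambda> by (intro mult_left_mono) auto
  also have "\<dots> \<le> norm (h ((h ^^ i) x))" by (rule expand'[OF px])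
  finally show ?case by simp
qed

lemma measure_cball_scale:
  assumes "0 \<le> r"
  shows "measure lborel (cball (a :: 'a) r) = r ^ DIM('a) * measure lborel (cball (0 :: 'a) 1)"
  using content_cball[OF assms, of a] content_cball[of 1 "0 :: 'a"] by simp

text \<open>Pieces of generation i have size at most 1 / (4 \<Lambda>^i), hence at most r, so those
  met by the ball stay in a ball of radius (2 K + 1) r. Its volume bounds generation i, and the
  later generations contribute the power of m / D.\<close>

lemma measure_pieces_ball_generation:
  assumes K: "0 \<le> K" "\<And>x. norm (p x) \<le> K * norm x" "\<And>x. norm (x - p x) \<le> K * norm x"
    and r: "0 \<le> r" "1 / \<Lambda> ^ i \<le> r" and i: "i \<le> n"
  shows "measure lborel (pieces n 0 \<inter> ball a r)
    \<le> (m / D) ^ (n - i) * (((2 * K + 1) * r) ^ DIM('a) * measure lborel (cball (0 :: 'a) 1))"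
proof -
  let ?b = "a - p a" and ?s = "1 / (4 * \<Lambda> ^ i)"
  have p0: "p 0 = 0" by (rule linear_0[OF p])
  have pb: "p ?b = 0" by (simp add: linear_diff[OF p] pp)
  have \<Lambda>i: "0 < \<Lambda> ^ i" using \<Lambda> by simp
  have s: "norm (id x) \<le> ?s" if "p x = x" "norm ((h ^^ i) x) \<le> 1/4" for x
    using expand_pow[OF that(1), of i] that(2) \<Lambda>i by (simp add: field_simps)
  have lin: "linear (id :: 'a \<Rightarrow> 'a)" by (rule linear_id)
  have "measure lborel (pieces n 0 \<inter> ball a r)
      \<le> measure lborel (pieces n 0 \<inter> (tube id (p a) (K * r) \<inter> slab ?b (K * r)))"
  proof (rule measure_mono_fmeasurable)
    have "ball a r \<subseteq> tube id (p a) (K * r) \<inter> slab ?b (K * r)"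
    proof
      fix y assume "y \<in> ball a r"
      then have y: "norm (y - a) \<le> r" by (simp add: dist_norm norm_minus_commute)
      have "norm (p y - p a) \<le> K * r"
        using K(2)[of "y - a"] mult_left_mono[OF y K(1)] by (simp add: linear_diff[OF p])
      moreover have "norm (y - p y - ?b) \<le> K * r"
        using K(3)[of "y - a"] mult_left_mono[OF y K(1)] by (simp add: linear_diff[OF p] algebra_simps)
      ultimately show "y \<in> tube id (p a) (K * r) \<inter> slab ?b (K * r)" by (simp add: tube_def slab_def)
    qed
    then show "pieces n 0 \<inter> ball a r \<subseteq> pieces n 0 \<inter> (tube id (p a) (K * r) \<inter> slab ?b (K * r))" by blast
    have "(pieces n 0 \<inter> tube id (p a) (K * r)) \<inter> slab ?b (K * r) \<in> fmeasurable lborel"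
      by (rule fmeasurable_closed_cyl_slab[of _ 0 "1/8"])
        (use closed_pieces[OF p0] closed_tube[OF lin] pieces_subset_cyl[OF p0, of n] in auto)
    then show "pieces n 0 \<inter> (tube id (p a) (K * r) \<inter> slab ?b (K * r)) \<in> fmeasurable lborel"
      by (simp add: Int_assoc)
  qed (simp add: p0)
  also have "\<dots> \<le> (m / D) ^ (n - i) * measure lborel (pieces i 0 \<inter> (tube id (p a) (K * r + ?s) \<inter> slab ?b (K * r)))"
    using measure_pieces_tube[OF pb p0 lin s, of i "n - i" "p a" "K * r" "K * r"]
    unfolding le_add_diff_inverse[OF i] .
  also have "\<dots> \<le> (m / D) ^ (n - i) * measure lborel (cball a ((2 * K + 1) * r))"
  proof (intro mult_left_mono measure_mono_fmeasurable)
    show "pieces i 0 \<inter> (tube id (p a) (K * r + ?s) \<inter> slab ?b (K * r)) \<subseteq> cball a ((2 * K + 1) * r)"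
    proof
      fix y assume "y \<in> pieces i 0 \<inter> (tube id (p a) (K * r + ?s) \<inter> slab ?b (K * r))"
      then have "norm (p y - p a) \<le> K * r + ?s" "norm (y - p y - ?b) \<le> K * r"
        by (auto simp: tube_def slab_def)
      moreover have "?s \<le> r" using r \<Lambda>i by (simp add: field_simps)
      moreover have "y - a = (p y - p a) + (y - p y - ?b)" by simp
      then have "norm (y - a) \<le> norm (p y - p a) + norm (y - p y - ?b)" by (simp only: norm_triangle_ineq)
      ultimately show "y \<in> cball a ((2 * K + 1) * r)"
        by (simp add: dist_norm norm_minus_commute algebra_simps)
    qed
  qed (use m_pos D0 p0 in \<open>simp_all add: borel_closed closed_tube[OF lin] closed_slab fmeasurable_compact\<close>)
  also have "measure lborel (cball a ((2 * K + 1) * r)) = ((2 * K + 1) * r) ^ DIM('a) * measure lborel (cball (0 :: 'a) 1)"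
    using K(1) r by (intro measure_cball_scale) simp
  finally show ?thesis .
qed

text \<open>With i least such that 1 / \<Lambda>^i \<le> r, the previous bound divided by the total
  mass is a constant times r^d (D / m)^i. Here D / m \<le> 1 / \<kappa> \<le> \<Lambda>^(d - s), and
  \<Lambda>^(i - 1) < 1 / r turns the power into r^(s - d) up to a factor 1 / \<kappa>.\<close>

lemma pieces_frostman:
  fixes s :: real
  assumes s: "1 \<le> \<kappa> * \<Lambda> powr (DIM('a) - s)"
  shows "\<exists>C. \<forall>n a r. 1 / \<Lambda> ^ n \<le> r \<longrightarrow> r \<le> 1 \<longrightarrow>
    measure lborel (pieces n 0 \<inter> ball a r) \<le> C * r powr s * measure lborel (pieces n 0 \<inter> slab 0 1)"
proof -
  obtain K1 where K1: "\<And>x. norm (p x) \<le> K1 * norm x" using linear_bounded[OF p] by blast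
  define K where "K = \<bar>K1\<bar> + 1"
  have K0: "0 \<le> K" by (simp add: K_def)
  have K: "norm (p x) \<le> K * norm x" "norm (x - p x) \<le> K * norm x" for x
  proof -
    have *: "norm (p x) \<le> \<bar>K1\<bar> * norm x"
      using K1[of x] by (meson abs_ge_self mult_right_mono norm_ge_zero order_trans)
    then show "norm (p x) \<le> K * norm x"
      using norm_ge_zero[of x] unfolding K_def distrib_right by linarith
    show "norm (x - p x) \<le> K * norm x"
      using * norm_triangle_ineq4[of x "p x"] by (simp add: K_def algebra_simps)
  qed
  let ?d = "DIM('a)" and ?\<omega> = "measure lborel (cball (0 :: 'a) 1)"
  define C where "C = (2 * K + 1) ^ ?d * ?\<omega> / (\<kappa> * vol (1/8) 1)"
  have v: "0 < vol (1/8) 1" by (simp add: vol_pos)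
  have p0: "p 0 = 0" by (rule linear_0[OF p])
  have "measure lborel (pieces n 0 \<inter> ball a r) \<le> C * r powr s * measure lborel (pieces n 0 \<inter> slab 0 1)"
    if r: "1 / \<Lambda> ^ n \<le> r" "r \<le> 1" for n a r
  proof -
    have r0: "0 < r" using r(1) \<Lambda> by (smt (verit) zero_less_divide_1_iff zero_less_power)
    define i where "i = (LEAST i. 1 / \<Lambda> ^ i \<le> r)"
    have i: "1 / \<Lambda> ^ i \<le> r" "i \<le> n" unfolding i_def using r(1) by (auto intro: LeastI Least_le)
    have \<kappa>i: "inverse \<kappa> ^ i \<le> inverse \<kappa> * r powr (s - ?d)"
    proof (cases i)
      case 0
      have "1 \<le> inverse \<kappa>" using \<kappa>_pos \<kappa>_le_1 by (simp add: one_le_inverse)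
      moreover have "1 \<le> r powr (s - ?d)"
      proof (cases "s \<le> ?d")
        case True
        then show ?thesis using r0 r(2) powr_mono2'[of "s - ?d" r 1] by simp
      next
        case False
        have "1 \<le> r" using i(1) 0 by simp
        then show ?thesis using r(2) by simp
      qed
      ultimately show ?thesis using 0 mult_mono[of 1 "inverse \<kappa>" 1 "r powr (s - ?d)"] \<kappa>_pos by simp
    next
      case (Suc j)
      have "\<not> 1 / \<Lambda> ^ j \<le> r" using not_less_Least[of j "\<lambda>i. 1 / \<Lambda> ^ i \<le> r"] Suc by (simp add: i_def)
      then have rj: "\<Lambda> ^ j \<le> 1 / r" using r0 \<Lambda> by (simp add: field_simps)
      have "inverse \<kappa> \<le> \<Lambda> powr (?d - s)" using s \<kappa>_pos by (simp add: field_simps)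
      then have "inverse \<kappa> ^ j \<le> (\<Lambda> powr (?d - s)) ^ j"
        using \<kappa>_pos by (intro power_mono) auto
      also have "\<dots> = (\<Lambda> ^ j) powr (?d - s)"
        using \<Lambda> by (simp add: powr_power powr_powr mult.commute flip: powr_realpow)
      also have "\<dots> \<le> (1 / r) powr (?d - s)"
      proof (cases "s \<le> ?d")
        case True
        then show ?thesis using rj \<Lambda> by (intro powr_mono2) auto
      next
        \<comment> \<open>This case contradicts the hypothesis, as \<kappa> \<le> 1 <
          \<Lambda>.\<close>
        case False
        have "\<Lambda> powr (?d - s) < 1" using False \<Lambda> by (simp add: powr_less_one)
        then have "\<kappa> * \<Lambda> powr (?d - s) < 1 * 1"
          using \<kappa>_le_1 \<kappa>_pos by (intro mult_le_less_imp_less) auto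
        then show ?thesis using s by simp
      qed
      also have "\<dots> = r powr (s - ?d)"
        using r0 by (simp add: powr_divide powr_minus_divide[symmetric] powr_minus)
      finally show ?thesis using \<kappa>_pos Suc by (simp add: mult_left_mono)
    qed
    have mD: "inverse ((m / D) ^ i) \<le> inverse \<kappa> ^ i"
    proof -
      have "\<kappa> \<le> m / D" using m_ge D0 by (simp add: field_simps)
      then have "inverse (m / D) \<le> inverse \<kappa>" using \<kappa>_pos by (rule le_imp_inverse_le)
      moreover have "0 \<le> inverse (m / D)" using D0 by simp
      ultimately have "inverse (m / D) ^ i \<le> inverse \<kappa> ^ i" by (rule power_mono)
      then show ?thesis by (simp only: power_inverse)
    qed
    have mD0: "0 < m / D" using m_pos D0 by simp
    have "measure lborel (pieces n 0 \<inter> ball a r)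
      \<le> (m / D) ^ (n - i) * (((2 * K + 1) * r) ^ ?d * ?\<omega>)"
      by (rule measure_pieces_ball_generation[OF K0 K _ i]) (use r0 in simp)
    also have "(m / D) ^ (n - i) = (m / D) ^ n * inverse ((m / D) ^ i)"
      unfolding divide_inverse[symmetric] by (rule power_diff[OF _ i(2)]) (use m_pos D0 in simp)
    also have "\<dots> * (((2 * K + 1) * r) ^ ?d * ?\<omega>)
        \<le> (m / D) ^ n * (inverse \<kappa> * r powr (s - ?d)) * (((2 * K + 1) * r) ^ ?d * ?\<omega>)"
      using mD \<kappa>i K0 r0 mD0 by (intro mult_right_mono mult_left_mono) auto
    also have "\<dots> = C * (r powr (s - ?d) * r ^ ?d) * ((m / D) ^ n * vol (1/8) 1)"
      unfolding power_mult_distrib using v \<kappa>_pos by (simp add: C_def field_simps)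
    also have "r powr (s - ?d) * r ^ ?d = r powr s"
      using r0 by (simp add: powr_realpow[symmetric] powr_add[symmetric])
    also have "(m / D) ^ n * vol (1/8) 1 = measure lborel (pieces n 0 \<inter> slab 0 1)"
      using measure_pieces_slab[of 0 0 n 1] p0 by simp
    finally show ?thesis .
  qed
  then show ?thesis by blast
qed

lemma measure_pieces_pos: "0 < measure lborel (pieces n 0 \<inter> slab 0 1)"
  using measure_pieces_slab[of 0 0 n 1] linear_0[OF p] m_pos D0 vol_pos[of "1/8" 1] by simp

end

text \<open>The outcome of the construction, free of the auxiliary map h. The choices are made in
  the order \<kappa>, \<Lambda>, N, which is possible because \<kappa> is determined by p.\<close>

lemma avoiding_sets_exist:
  fixes f g p :: "'a::euclidean_space \<Rightarrow> 'a" and s :: real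
  assumes f: "linear f" and g: "linear g" and gf: "\<And>x. g (f x) = x" and fg: "\<And>x. f (g x) = x"
    and p: "linear p" and pp: "\<And>x. p (p x) = p x" and pf: "\<And>x. p (f x) = f (p x)"
    and ex: "\<And>L. 0 < L \<Longrightarrow> \<exists>N>0. \<forall>x. L * norm (p x) \<le> norm ((f ^^ N) (p x))"
    and Z: "\<And>z z'. z \<in> Z \<Longrightarrow> z' \<in> Z \<Longrightarrow> z \<noteq> z' \<Longrightarrow> 1 \<le> dist z z'"
    and s: "s < DIM('a)" and nontriv: "\<exists>x. p x \<noteq> 0"
  obtains N F C and \<rho> :: "nat \<Rightarrow> real" and B where "0 < N" "compact B"
    "\<And>n. closed (F n)" "\<And>n. F (Suc n) \<subseteq> F n" "\<And>n y b. y \<in> F n \<Longrightarrow> p b = 0 \<Longrightarrow> y + b \<in> F n"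
    "\<And>y z k. (\<And>n. y \<in> F n) \<Longrightarrow> z \<in> Z \<Longrightarrow> 1/16 \<le> dist ((f ^^ (N * k)) (p y)) z"
    "\<And>n a r. \<rho> n \<le> r \<Longrightarrow> r \<le> 1 \<Longrightarrow> measure lborel (F n \<inter> ball a r) \<le> C * r powr s * measure lborel (F n \<inter> B)"
    "\<And>n. 0 < measure lborel (F n \<inter> B)" "\<rho> \<longlonglongrightarrow> 0"
proof -
  let ?\<kappa> = "expanding_projection.\<kappa> p"
  \<comment> \<open>The locale asks for 8; the other entry is what gives 1 \<le> \<kappa>
    \<Lambda>^(d - s).\<close>
  define \<Lambda> where "\<Lambda> = max 8 (inverse ?\<kappa> powr (1 / (DIM('a) - s)))"
  have \<Lambda>8: "8 \<le> \<Lambda>" by (simp add: \<Lambda>_def)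
  obtain N where N: "0 < N" "\<And>x. \<Lambda> * norm (p x) \<le> norm ((f ^^ N) (p x))"
    using ex[of \<Lambda>] \<Lambda>8 by auto
  define h where "h = (\<lambda>x. (f ^^ N) (p x) + (x - p x))"
  define h' where "h' = (\<lambda>x. (g ^^ N) (p x) + (x - p x))"
  have pg: "p (g x) = g (p x)" for x by (metis fg gf pf)
  have fN: "linear (f ^^ N)" and gN: "linear (g ^^ N)"
    using f g by (auto intro: linear_funpow)
  have pfN: "p ((f ^^ n) x) = (f ^^ n) (p x)" for n x by (induction n) (simp_all add: pf)
  have pgN: "p ((g ^^ n) x) = (g ^^ n) (p x)" for n x by (induction n) (simp_all add: pg)
  have inv: "(g ^^ n) ((f ^^ n) x) = x" "(f ^^ n) ((g ^^ n) x) = x" for n x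
    by (rule funpow_inverse; simp add: gf fg)+
  have lh: "linear h" and lh': "linear h'" unfolding h_def h'_def
    using linear_compose[OF p fN] linear_compose[OF p gN]
    by (auto intro!: linear_compose_add linear_compose_sub p linear_ident simp: o_def)
  have ph: "p (h x) = (f ^^ N) (p x)" and ph': "p (h' x) = (g ^^ N) (p x)" for x
    by (simp_all add: h_def h'_def linear_add[OF p] linear_diff[OF p] pp pfN pgN)
  have hh': "h (h' x) = x" for x
  proof -
    have "h (h' x) = (f ^^ N) (p (h' x)) + (h' x - p (h' x))" by (simp only: h_def)
    then show ?thesis by (simp add: ph' inv) (simp add: h'_def)
  qed
  have h'h: "h' (h x) = x" for x
  proof -
    have "h' (h x) = (g ^^ N) (p (h x)) + (h x - p (h x))" by (simp only: h'_def)
    then show ?thesis by (simp add: ph inv) (simp add: h_def)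
  qed
  obtain x0 where x0: "p x0 \<noteq> 0" using nontriv by blast
  obtain D where D: "0 < D" "\<And>A. A \<in> sets borel \<Longrightarrow> D * measure lborel (h -` A) = measure lborel A"
    using linear_vimage_lborel[OF lh lh' hh' h'h] by blast
  have hp: "h (p x) = (f ^^ N) (p x)" for x by (simp add: h_def pp)
  interpret expanding_projection h h' p \<Lambda> D Z "p x0 /\<^sub>R norm (p x0)"
  proof (rule expanding_projection.intro)
    show "p (h x) = h (p x)" for x by (simp add: ph hp)
    show "h (x - p x) = x - p x" for x
      by (simp add: h_def linear_diff[OF p] pp linear_0[OF fN])
    show "\<Lambda> * norm (p x) \<le> norm (h (p x))" for x using N(2) by (simp add: hp)
  qed (use lh lh' hh' h'h p pp \<Lambda>8 Z D x0 in \<open>auto simp: linear_scale[OF p]\<close>)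
  have "1 \<le> \<kappa> * \<Lambda> powr (DIM('a) - s)"
  proof -
    have "inverse \<kappa> = (inverse \<kappa> powr (1 / (DIM('a) - s))) powr (DIM('a) - s)"
      using s \<kappa>_pos by (simp add: powr_powr)
    also have "\<dots> \<le> \<Lambda> powr (DIM('a) - s)"
      using s by (intro powr_mono2) (auto simp: \<Lambda>_def)
    finally show ?thesis using \<kappa>_pos by (simp add: field_simps)
  qed
  then obtain C where C: "\<And>n a r. 1 / \<Lambda> ^ n \<le> r \<Longrightarrow> r \<le> 1 \<Longrightarrow>
    measure lborel (pieces n 0 \<inter> ball a r) \<le> C * r powr s * measure lborel (pieces n 0 \<inter> slab 0 1)"
    using pieces_frostman by blast
  have p0: "p 0 = 0" by (rule linear_0[OF p])
  let ?B = "cyl 0 (1/8) \<inter> slab 0 1"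
  have eq: "pieces n 0 \<inter> ?B = pieces n 0 \<inter> slab 0 1" for n
    using pieces_subset_cyl[OF p0, of n] by blast
  \<comment> \<open>h agrees with f^N only on the range of p, so avoidance is a statement about the
    orbit of p y.\<close>
  have hk: "(h ^^ k) (p y) = (f ^^ (N * k)) (p y)" for k y
  proof (induction k)
    case (Suc k)
    have "(h ^^ Suc k) (p y) = h (p ((f ^^ (N * k)) y))" using Suc by (simp add: pfN)
    also have "\<dots> = (f ^^ N) (p ((f ^^ (N * k)) y))" by (rule hp)
    finally show ?case by (simp add: pfN funpow_add)
  qed simp
  show ?thesis
  proof (rule that[of N ?B "\<lambda>n. pieces n 0" "\<lambda>n. 1 / \<Lambda> ^ n" C])
    show "compact ?B"
      using bounded_cyl_slab closed_cyl closed_slab by (auto simp: compact_eq_bounded_closed)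
    show "1/16 \<le> dist ((f ^^ (N * k)) (p y)) z" if "\<And>n. y \<in> pieces n 0" "z \<in> Z" for y z k
      using pieces_avoid[OF p0 that(1)[of "Suc k"] that(2)] by (simp add: hk)
    have "(\<lambda>n. inverse \<Lambda> ^ n) \<longlonglongrightarrow> 0" using \<Lambda>8 by (intro LIMSEQ_realpow_zero) (auto simp: inverse_less_1_iff)
    then show "(\<lambda>n. 1 / \<Lambda> ^ n) \<longlonglongrightarrow> 0" by (simp add: inverse_eq_divide power_one_over)
  qed (use N p0 C closed_pieces pieces_Suc_subset pieces_translate measure_pieces_pos in \<open>auto simp: eq\<close>)
qed

section \<open>Characters of the torus\<close>

text \<open>The infimum in the quotient metric is attained because the lattice is closed; nearby
  points of the torus therefore have equally near lifts.\<close>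

lemma torus_lift_near:
  obtains y where "torus_proj y = q" "norm (x - y) = dist (torus_proj x) q"
proof -
  obtain y0 where q: "q = torus_proj y0" by (rule torus_proj_cases)
  have ne: "(int_lattice :: (real ^ 'a) set) \<noteq> {}" using int_lattice_0 by blast
  obtain v where v: "v \<in> int_lattice" "infdist (x - y0) int_lattice = dist (x - y0) v"
    using infdist_attains_inf[OF closed_int_lattice ne] by blast
  show ?thesis
  proof (rule that[of "y0 + v"])
    show "torus_proj (y0 + v) = q" using v(1) by (simp add: q torus_proj_eq_iff)
    have "dist (torus_proj x) (torus_proj y0) = infdist (x - y0) int_lattice" by transfer simp
    then show "norm (x - (y0 + v)) = dist (torus_proj x) q"
      using v(2) by (simp add: q dist_norm algebra_simps)
  qed
qed

lemma dist_torus_proj_le: "dist (torus_proj x) (torus_proj y) \<le> norm (x - y)"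
  using infdist_le[of 0 int_lattice "x - y"] by transfer (simp add: dist_norm)

lemma continuous_on_torusI:
  fixes f :: "'n::finite torus \<Rightarrow> 'b::metric_space"
  assumes "continuous_on UNIV (\<lambda>x. f (torus_proj x))"
  shows "continuous_on UNIV f"
  unfolding continuous_on_iff
proof (intro ballI allI impI)
  fix q :: "'n torus" and e :: real assume e: "0 < e"
  obtain x where x: "q = torus_proj x" by (rule torus_proj_cases)
  obtain d where d: "0 < d" "\<And>y. dist y x < d \<Longrightarrow> dist (f (torus_proj y)) (f (torus_proj x)) < e"
    using assms e unfolding continuous_on_iff by (metis UNIV_I)
  have "dist (f q') (f q) < e" if q': "dist q' q < d" for q'
  proof -
    obtain y where "torus_proj y = q'" "norm (x - y) = dist (torus_proj x) q'" by (rule torus_lift_near)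
    then show ?thesis using d(2)[of y] q' x by (simp add: dist_norm norm_minus_commute dist_commute)
  qed
  with d(1) show "\<exists>d>0. \<forall>x'\<in>UNIV. dist x' q < d \<longrightarrow> dist (f x') (f q) < e" by blast
qed

lemma compact_torus: "compact (UNIV :: 'n::finite torus set)"
proof -
  have "UNIV = torus_proj ` (cbox 0 1 :: (real ^ 'n) set)"
  proof (rule UNIV_eq_I)
    fix q :: "'n torus"
    obtain x where x: "q = torus_proj x" by (rule torus_proj_cases)
    obtain v where v: "v \<in> int_lattice" "x - v \<in> unit_cube" using unit_cube_decomp by blast
    then have "q = torus_proj (x - v)" by (simp add: x torus_proj_eq_iff)
    moreover have "x - v \<in> cbox 0 1" using v(2) by (auto simp: unit_cube_def mem_box_cart less_imp_le)
    ultimately show "q \<in> torus_proj ` (cbox 0 1 :: (real ^ 'n) set)" by blast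
  qed
  then show ?thesis
    by (metis compact_cbox compact_continuous_image continuous_on_torus_proj)
qed

interpretation torus_haar: finite_measure "torus_haar :: 'n::finite torus measure"
  by standard (simp add: emeasure_torus_haar_UNIV)

definition pairing :: "int ^ 'n \<Rightarrow> real ^ 'n \<Rightarrow> real" where
  "pairing k x = (\<Sum>i\<in>UNIV. of_int (k $ i) * x $ i)"

lemma pairing_add: "pairing k (x + y) = pairing k x + pairing k y"
  by (simp add: pairing_def sum.distrib algebra_simps)

lemma pairing_add_left: "pairing (k + l) x = pairing k x + pairing l x"
  by (simp add: pairing_def sum.distrib algebra_simps)

lemma pairing_uminus_left: "pairing (- k) x = - pairing k x"
  by (simp add: pairing_def sum_negf)

lemma pairing_scaleR: "pairing k (c *\<^sub>R x) = c * pairing k x"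
  by (simp add: pairing_def sum_distrib_left algebra_simps)

lemma linear_pairing: "linear (pairing k)"
  by (rule linearI) (auto simp: pairing_add pairing_scaleR)

lemma pairing_axis: "pairing k (axis i 1) = of_int (k $ i)"
  unfolding pairing_def axis_def by (simp add: if_distrib cong: if_cong)

lemma pairing_axis_left: "pairing (axis i 1) x = x $ i"
  unfolding pairing_def axis_def by (simp add: if_distrib if_distribR cong: if_cong)

lemma pairing_int_lattice: "v \<in> int_lattice \<Longrightarrow> pairing k v \<in> \<int>"
  by (auto simp: pairing_def int_lattice_def intro!: Ints_sum Ints_mult)

lemma pairing_vector_matrix: "pairing (k v* M) x = pairing k (real_matrix M *v x)"
proof -
  have "pairing (k v* M) x = (\<Sum>j\<in>UNIV. \<Sum>i\<in>UNIV. of_int (k $ i) * of_int (M $ i $ j) * x $ j)"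
    by (simp add: pairing_def vector_matrix_mult_def sum_distrib_right)
  also have "\<dots> = (\<Sum>i\<in>UNIV. \<Sum>j\<in>UNIV. of_int (k $ i) * of_int (M $ i $ j) * x $ j)"
    by (rule sum.swap)
  also have "\<dots> = pairing k (real_matrix M *v x)"
    by (simp add: pairing_def real_matrix_def matrix_vector_mult_def sum_distrib_left algebra_simps)
  finally show ?thesis .
qed

lemma cis_2pi_Ints: "a - b \<in> \<int> \<Longrightarrow> cis (2 * pi * a) = cis (2 * pi * b)"
proof -
  assume "a - b \<in> \<int>"
  then obtain n where "a = b + of_int n" by (metis Ints_cases add_diff_cancel_left' diff_add_cancel add.commute)
  then have "cis (2 * pi * a) = cis (2 * pi * b) * cis (2 * pi * of_int n)"
    by (simp add: cis_mult algebra_simps)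
  then show ?thesis by (simp add: cis_multiple_2pi)
qed

lift_definition torus_char :: "int ^ 'n \<Rightarrow> 'n torus \<Rightarrow> complex"
  is "\<lambda>k x. cis (2 * pi * pairing k x)"
proof -
  fix k and x y :: "real ^ 'n"
  assume "torus_rel x y"
  then have "pairing k (x - y) \<in> \<int>" by (auto simp: torus_rel_def pairing_int_lattice)
  then show "cis (2 * pi * pairing k x) = cis (2 * pi * pairing k y)"
    by (intro cis_2pi_Ints) (simp add: linear_diff[OF linear_pairing])
qed

lemma torus_char_proj: "torus_char k (torus_proj x) = cis (2 * pi * pairing k x)"
  by transfer simp

lemma torus_char_mult: "torus_char k x * torus_char l x = torus_char (k + l) x"
  by transfer (simp add: cis_mult pairing_add_left algebra_simps)

lemma torus_char_cnj: "cnj (torus_char k x) = torus_char (- k) x"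
  by transfer (simp add: cis_cnj pairing_uminus_left)

lemma torus_char_0: "torus_char 0 x = 1"
  by transfer (simp add: pairing_def)

lemma torus_char_add: "torus_char k (x + y) = torus_char k x * torus_char k y"
  by transfer (simp add: cis_mult pairing_add algebra_simps)

lemma norm_torus_char: "norm (torus_char k x) = 1"
  by transfer simp

lemma continuous_on_torus_char: "continuous_on UNIV (torus_char k)"
proof (rule continuous_on_torusI)
  have "continuous_on UNIV (\<lambda>x. cis (2 * pi * pairing k x))"
    by (intro continuous_on_cis continuous_on_mult continuous_on_const linear_continuous_on)
      (simp add: linear_conv_bounded_linear[symmetric] linear_pairing)
  then show "continuous_on UNIV (\<lambda>x. torus_char k (torus_proj x))" by (simp add: torus_char_proj)
qed

lemma measurable_torus_char [measurable]: "torus_char k \<in> borel_measurable borel"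
  by (intro borel_measurable_continuous_onI continuous_on_torus_char)

lemma integrable_torus_char: "integrable torus_haar (torus_char k)"
  by (rule torus_haar.integrable_const_bound[where B = 1])
    (auto simp: norm_torus_char cong: measurable_cong_sets)

lemma torus_map_proj: "torus_map M (torus_proj x) = torus_proj (real_matrix M *v x)"
  by transfer (simp add: torus_rel_def)

lemma torus_map_funpow_proj: "(torus_map M ^^ n) (torus_proj x) = torus_proj (((*v) (real_matrix M) ^^ n) x)"
  by (induction n) (auto simp: torus_map_proj)

lemma pairing_vector_matrix_funpow:
  "pairing (((\<lambda>k. k v* M) ^^ n) k) x = pairing k (((*v) (real_matrix M) ^^ n) x)"
  by (induction n arbitrary: x) (auto simp: pairing_vector_matrix funpow_swap1)

lemma torus_char_funpow: "torus_char k ((torus_map M ^^ n) x) = torus_char (((\<lambda>k. k v* M) ^^ n) k) x"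
proof -
  obtain y where "x = torus_proj y" by (rule torus_proj_cases)
  then show ?thesis by (simp add: torus_map_funpow_proj torus_char_proj pairing_vector_matrix_funpow)
qed

text \<open>By invariance of Haar measure the integral \<open>I\<close> satisfies \<open>I = torus_char k a * I\<close> for every \<open>a\<close>.\<close>

lemma integral_torus_char:
  assumes k: "k \<noteq> 0"
  shows "(LINT x|torus_haar. torus_char k x) = 0"
proof -
  obtain i where i: "k $ i \<noteq> 0" using k by (auto simp: vec_eq_iff)
  define a where "a = torus_proj ((1 / (2 * of_int (k $ i))) *\<^sub>R axis i 1 :: real ^ 'a)"
  have a: "torus_char k a = - 1"
    using i by (simp add: a_def torus_char_proj pairing_scaleR pairing_axis)
  have [measurable]: "(+) a \<in> borel_measurable borel"
    by (intro borel_measurable_continuous_onI continuous_on_torus_translation)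
  have "(LINT x|torus_haar. torus_char k x) = (LINT x|distr torus_haar borel ((+) a). torus_char k x)"
    by (simp only: torus_haar_translation)
  also have "\<dots> = (LINT x|torus_haar. torus_char k (a + x))"
    by (rule integral_distr) (auto cong: measurable_cong_sets)
  also have "\<dots> = - (LINT x|torus_haar. torus_char k x)"
    by (simp add: torus_char_add a)
  finally show ?thesis by simp
qed

text \<open>If l has period q under the dual map, pairing with l takes the same value at x and at
  f^(q j) x. Letting j grow gives 0 on contracted vectors, and running backwards gives 0 on expanded
  ones, so l = 0. As the dual map has trivial kernel, two equal members of the orbit would be
  periodic and nonzero.\<close>

lemma inj_dual_orbit:
  assumes M: "hyperbolic_endo M" and k: "k \<noteq> 0"
  shows "inj (\<lambda>n. ((\<lambda>k. k v* M) ^^ n) k)"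
proof -
  let ?f = "(*v) (real_matrix M)" and ?V = "\<lambda>k. k v* M"
  obtain g p where g: "linear g" "\<And>x. g (?f x) = x" "\<And>x. ?f (g x) = x"
    and p: "\<And>x. p x \<in> stable_space g" "\<And>x. x - p x \<in> stable_space ?f"
    using hyperbolic_splitting[OF M] by (metis (no_types))
  have fg: "(?f ^^ n) ((g ^^ n) x) = x" for n x by (rule funpow_inverse) (rule g)
  have zero: "l = 0" if l: "\<And>x. pairing l x = 0" for l
    using l[of "axis _ 1"] by (simp add: pairing_axis vec_eq_iff)
  have lim: "pairing l x = 0" if st: "x \<in> stable_space F" and q: "0 < q" and per: "\<And>j. pairing l x = pairing l ((F ^^ (q * j)) x)"
    for l x q and F :: "real ^ 'a \<Rightarrow> real ^ 'a"
  proof -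
    have "(\<lambda>n. (F ^^ n) x) \<longlonglongrightarrow> 0" using st by (simp add: stable_space_def)
    then have "(\<lambda>n. pairing l ((F ^^ n) x)) \<longlonglongrightarrow> 0"
      using bounded_linear.tendsto_zero[of "pairing l"] linear_pairing linear_conv_bounded_linear by blast
    moreover have "strict_mono (\<lambda>j. q * j)" using q by (simp add: strict_mono_def)
    ultimately have "((\<lambda>n. pairing l ((F ^^ n) x)) \<circ> (\<lambda>j. q * j)) \<longlonglongrightarrow> 0"
      by (rule LIMSEQ_subseq_LIMSEQ)
    then have "(\<lambda>j. pairing l ((F ^^ (q * j)) x)) \<longlonglongrightarrow> 0" by (simp add: o_def)
    then have "(\<lambda>j::nat. pairing l x) \<longlonglongrightarrow> 0" by (simp only: per[symmetric])
    then show ?thesis by (simp add: LIMSEQ_const_iff)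
  qed
  have no_per: "l = 0" if q: "0 < q" and l: "(?V ^^ q) l = l" for l q
  proof (rule zero)
    fix x
    have lj: "(?V ^^ (q * j)) l = l" for j by (induction j) (simp_all add: funpow_add l add.commute)
    have per: "pairing l y = pairing l ((?f ^^ (q * j)) y)" for y j
      using pairing_vector_matrix_funpow[where n = "q * j" and k = l and M = M and x = y] by (simp add: lj)
    have "pairing l (x - p x) = 0" by (rule lim[OF p(2) q per])
    moreover have "pairing l y = pairing l ((g ^^ (q * j)) y)" for y j
      using per[of "(g ^^ (q * j)) y" j] by (simp add: fg)
    then have "pairing l (p x) = 0" by (rule lim[OF p(1) q])
    ultimately show "pairing l x = 0" by (simp add: linear_diff[OF linear_pairing])
  qed
  have nz: "(?V ^^ n) k \<noteq> 0" for n
  proof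
    assume "(?V ^^ n) k = 0"
    then have "pairing k ((?f ^^ n) x) = 0" for x
      using pairing_vector_matrix_funpow[where n = n and k = k and M = M and x = x] by (simp add: pairing_def)
    from this[of "(g ^^ n) _"] have "pairing k x = 0" for x by (simp add: fg)
    then show False using zero k by blast
  qed
  have neq: "(?V ^^ n) k \<noteq> (?V ^^ m) k" if "n < m" for n m
  proof
    assume eq: "(?V ^^ n) k = (?V ^^ m) k"
    have "(?V ^^ (m - n)) ((?V ^^ n) k) = (?V ^^ m) k"
      using that by (simp add: funpow_add[symmetric, THEN fun_cong, unfolded o_apply])
    then show False using no_per[of "m - n" "(?V ^^ n) k"] nz[of n] that eq by simp
  qed
  show ?thesis
    by (rule injI) (metis neq linorder_neqE_nat)
qed

section \<open>Equidistribution\<close>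

definition cesaro :: "(nat \<Rightarrow> complex) \<Rightarrow> nat \<Rightarrow> complex" where
  "cesaro a N = (\<Sum>n<N. a n) / of_nat N"

lemma cesaro_add: "cesaro (\<lambda>n. a n + b n) N = cesaro a N + cesaro b N"
  by (simp add: cesaro_def sum.distrib add_divide_distrib)

lemma cesaro_diff: "cesaro (\<lambda>n. a n - b n) N = cesaro a N - cesaro b N"
  by (simp add: cesaro_def sum_subtractf diff_divide_distrib)

lemma cesaro_cmult: "cesaro (\<lambda>n. c * a n) N = c * cesaro a N"
  by (simp add: cesaro_def sum_distrib_left)

lemma norm_cesaro_le:
  assumes "\<And>n. norm (a n) \<le> c"
  shows "norm (cesaro a N) \<le> c"
proof (cases "N = 0")
  case True
  then show ?thesis using order_trans[OF norm_ge_zero assms] by (simp add: cesaro_def)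
next
  case False
  have "norm (\<Sum>n<N. a n) \<le> (\<Sum>n<N. c)" by (rule sum_norm_le) (rule assms)
  then show ?thesis using False by (simp add: cesaro_def norm_divide field_simps)
qed

lemma cesaro_tendsto_0:
  assumes "a \<longlonglongrightarrow> 0"
  shows "cesaro a \<longlonglongrightarrow> 0"
proof (rule LIMSEQ_I)
  fix r :: real assume r: "0 < r"
  obtain M where M: "\<And>n. n \<ge> M \<Longrightarrow> norm (a n) < r / 2"
    using LIMSEQ_D[OF assms, of "r / 2"] r by auto
  define K where "K = (\<Sum>n<M. norm (a n))"
  obtain L :: nat where L: "2 * K / r < L" using reals_Archimedean2 by blast
  show "\<exists>no. \<forall>N\<ge>no. norm (cesaro a N - 0) < r"
  proof (intro exI allI impI)
    fix N assume N: "N \<ge> max (max M L) 1"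
    then have N0: "0 < real N" by simp
    have "norm (\<Sum>n<N. a n) \<le> (\<Sum>n<N. norm (a n))" by (rule norm_sum)
    also have "\<dots> = K + (\<Sum>n=M..<N. norm (a n))"
      using N unfolding K_def lessThan_atLeast0 by (intro sum.atLeastLessThan_concat[symmetric]) auto
    also have "(\<Sum>n=M..<N. norm (a n)) \<le> (\<Sum>n=M..<N. r / 2)"
    proof (rule sum_mono)
      show "norm (a n) \<le> r / 2" if "n \<in> {M..<N}" for n using M[of n] that by simp
    qed
    also have "\<dots> \<le> N * (r / 2)" using r by (simp add: mult_right_mono)
    finally have "norm (\<Sum>n<N. a n) \<le> K + N * (r / 2)" by simp
    also have "\<dots> < N * r"
    proof -
      have "2 * K / r < N" using L N by simp
      then have "2 * K < N * r" using r by (simp add: field_simps)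
      then show ?thesis by simp
    qed
    finally show "norm (cesaro a N - 0) < r" using N0 by (simp add: cesaro_def norm_divide field_simps)
  qed
qed

text \<open>Consecutive squares \<open>m\<^sup>2\<close> and \<open>(m + 1)\<^sup>2\<close> differ by \<open>2 m + 1\<close>, which is negligible compared to \<open>m\<^sup>2\<close>.\<close>

lemma cesaro_of_squares:
  assumes a: "\<And>n. norm (a n) \<le> 1" and sq: "(\<lambda>m. cesaro a (m ^ 2)) \<longlonglongrightarrow> 0"
  shows "cesaro a \<longlonglongrightarrow> 0"
proof -
  define \<mu> where "\<mu> N = nat \<lfloor>sqrt (real N)\<rfloor>" for N
  have \<mu>1: "\<mu> N ^ 2 \<le> N" for N
  proof -
    have "real (\<mu> N) \<le> sqrt (real N)" by (simp add: \<mu>_def)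
    then have "(real (\<mu> N))\<^sup>2 \<le> real N" by (metis of_nat_0_le_iff power_mono real_sqrt_pow2)
    then show ?thesis by (metis of_nat_le_iff of_nat_power)
  qed
  have \<mu>2: "N \<le> \<mu> N ^ 2 + 2 * \<mu> N" for N
  proof -
    have "sqrt (real N) < real (\<mu> N) + 1" unfolding \<mu>_def by linarith
    then have "(sqrt (real N))\<^sup>2 < (real (\<mu> N) + 1)\<^sup>2" by (intro power_strict_mono) auto
    then have "real N < real ((\<mu> N + 1) ^ 2)" by (simp add: add.commute)
    then have "N < (\<mu> N + 1) ^ 2" by (simp only: of_nat_less_iff)
    then show ?thesis by (simp add: power2_eq_square)
  qed
  have lim: "filterlim \<mu> at_top sequentially"
    unfolding filterlim_at_top
  proof
    fix Z
    have "Z \<le> \<mu> N" if "N \<ge> Z ^ 2" for N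
    proof -
      have "real (Z ^ 2) \<le> real N" using that by (simp only: of_nat_le_iff)
      then have "real Z \<le> sqrt (real N)" by (intro real_le_rsqrt) simp
      then show ?thesis unfolding \<mu>_def by (rule le_nat_floor)
    qed
    then show "\<forall>\<^sub>F N in sequentially. Z \<le> \<mu> N" by (auto simp: eventually_sequentially)
  qed
  \<comment> \<open>The terms between m^2 and N number at most 2 m and have norm at most 1; divided
    by N \<ge> m^2 they contribute at most 2 / m.\<close>
  define b where "b m = norm (cesaro a (m ^ 2)) + 2 / real m" for m
  have "(\<lambda>m. norm (cesaro a (m ^ 2)) + 2 / real m) \<longlonglongrightarrow> 0 + 0"
    by (intro tendsto_add tendsto_norm_zero sq lim_const_over_n)
  then have "b \<longlonglongrightarrow> 0" by (simp add: b_def[abs_def])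
  then have bl: "(\<lambda>N. b (\<mu> N)) \<longlonglongrightarrow> 0" by (rule filterlim_compose[OF _ lim])
  show ?thesis
  proof (rule Lim_null_comparison[OF _ bl], rule eventually_sequentiallyI)
    fix N :: nat assume N: "1 \<le> N"
    let ?m = "\<mu> N"
    have m0: "0 < ?m" using \<mu>2[of N] N by (cases "?m = 0") auto
    have "(\<Sum>n<N. a n) = (\<Sum>n<?m ^ 2. a n) + (\<Sum>n=?m ^ 2..<N. a n)"
      using \<mu>1[of N] unfolding lessThan_atLeast0 by (intro sum.atLeastLessThan_concat[symmetric]) auto
    then have "norm (\<Sum>n<N. a n) \<le> norm (\<Sum>n<?m ^ 2. a n) + norm (\<Sum>n=?m ^ 2..<N. a n)"
      by (simp only: norm_triangle_ineq)
    also have "norm (\<Sum>n=?m ^ 2..<N. a n) \<le> (\<Sum>n=?m ^ 2..<N. 1)" by (intro sum_norm_le a)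
    also have "\<dots> \<le> 2 * real ?m"
    proof -
      have "N - ?m ^ 2 \<le> 2 * ?m" using \<mu>2[of N] by linarith
      then have "real (N - ?m ^ 2) \<le> real (2 * ?m)" by (simp only: of_nat_le_iff)
      then show ?thesis by simp
    qed
    also have "norm (\<Sum>n<?m ^ 2. a n) = real ?m ^ 2 * norm (cesaro a (?m ^ 2))"
      using m0 by (simp add: cesaro_def norm_divide norm_power)
    finally have *: "norm (\<Sum>n<N. a n) \<le> real ?m ^ 2 * norm (cesaro a (?m ^ 2)) + 2 * real ?m" by simp
    also have "\<dots> = real ?m ^ 2 * b ?m" using m0 by (simp add: b_def field_simps power2_eq_square)
    also have "\<dots> \<le> real N * b ?m"
    proof (rule mult_right_mono)
      show "real ?m ^ 2 \<le> real N" using \<mu>1[of N] by (metis of_nat_le_iff of_nat_power)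
    qed (simp add: b_def)
    finally show "norm (cesaro a N) \<le> b ?m"
      using N by (simp add: cesaro_def norm_divide field_simps)
  qed
qed

text \<open>Expanding the square leaves integrals of the characters k n - k m, and injectivity makes
  all but the diagonal ones vanish.\<close>

lemma nn_integral_norm_sum_torus_char:
  assumes k: "inj k"
  shows "(\<integral>\<^sup>+x. ennreal ((norm (\<Sum>n<N. torus_char (k n) x))\<^sup>2) \<partial>torus_haar) = of_nat N"
proof -
  let ?s = "\<lambda>x. \<Sum>n<N. torus_char (k n) x"
  have eq: "complex_of_real ((norm (?s x))\<^sup>2) = (\<Sum>n<N. \<Sum>m<N. torus_char (k n - k m) x)" for x
  proof -
    have "complex_of_real ((norm (?s x))\<^sup>2) = ?s x * cnj (?s x)" by (rule complex_norm_square)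
    also have "\<dots> = (\<Sum>n<N. \<Sum>m<N. torus_char (k n) x * torus_char (- k m) x)"
      by (simp add: torus_char_cnj sum_product)
    finally show ?thesis by (simp add: torus_char_mult)
  qed
  have int0: "(LINT x|torus_haar. torus_char (k n - k m) x) = (if n = m then 1 else 0)" for n m
  proof (cases "n = m")
    case True
    have "measure (torus_haar :: 'a torus measure) UNIV = 1"
      by (simp add: measure_def emeasure_torus_haar_UNIV)
    then show ?thesis using True by (simp add: torus_char_0)
  next
    case False
    then have "k n - k m \<noteq> 0" using k by (auto dest: injD)
    then show ?thesis using False by (simp add: integral_torus_char)
  qed
  have m[measurable]: "?s \<in> borel_measurable torus_haar" by measurable
  have integrable: "integrable torus_haar (\<lambda>x. (norm (?s x))\<^sup>2)"
  proof (rule torus_haar.integrable_const_bound[where B = "(real N)\<^sup>2"])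
    have "norm (?s x) \<le> (\<Sum>n<N. 1)" for x by (rule sum_norm_le) (simp add: norm_torus_char)
    then show "AE x in torus_haar. norm ((norm (?s x))\<^sup>2) \<le> (real N)\<^sup>2"
      by (simp add: power_mono)
  qed measurable
  have "complex_of_real (LINT x|torus_haar. (norm (?s x))\<^sup>2) = (LINT x|torus_haar. complex_of_real ((norm (?s x))\<^sup>2))"
    by (rule integral_complex_of_real[symmetric])
  also have "\<dots> = (LINT x|torus_haar. (\<Sum>n<N. \<Sum>m<N. torus_char (k n - k m) x))"
    by (simp only: eq)
  also have "\<dots> = (\<Sum>n<N. \<Sum>m<N. (LINT x|torus_haar. torus_char (k n - k m) x))"
    by (subst Bochner_Integration.integral_sum; intro sum.cong refl Bochner_Integration.integrable_sum
        Bochner_Integration.integral_sum integrable_torus_char)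
  also have "\<dots> = of_nat N" by (simp add: int0)
  finally have "(LINT x|torus_haar. (norm (?s x))\<^sup>2) = real N"
    by (metis of_real_eq_iff of_real_of_nat_eq)
  then show ?thesis
    by (subst nn_integral_eq_integral[OF integrable]) (simp_all add: ennreal_of_nat_eq_real_of_nat)
qed

text \<open>The average over m^2 terms has squared L2 norm 1 / m^2, which is summable. Hence the sum
  of the squares over m is finite almost everywhere and its terms tend to 0;
  \<open>cesaro_of_squares\<close> fills the gaps.\<close>

lemma AE_cesaro_torus_char:
  assumes k: "inj k"
  shows "AE x in torus_haar. cesaro (\<lambda>n. torus_char (k n) x) \<longlonglongrightarrow> 0"
proof -
  define u where "u m x = (norm (cesaro (\<lambda>n. torus_char (k n) x) (m ^ 2)))\<^sup>2" for m x
  have u_eq: "u m x = inverse (real m ^ 4) * (norm (\<Sum>n<m ^ 2. torus_char (k n) x))\<^sup>2" for m x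
    by (simp add: u_def cesaro_def norm_divide power_divide norm_power field_simps flip: power_mult)
  have [measurable]: "u m \<in> borel_measurable torus_haar" for m
    unfolding u_eq[abs_def] by measurable
  have int: "(\<integral>\<^sup>+x. ennreal (u m x) \<partial>torus_haar) = ennreal (inverse (real m ^ 2))" for m
  proof -
    have "(\<integral>\<^sup>+x. ennreal (u m x) \<partial>torus_haar)
        = (\<integral>\<^sup>+x. ennreal (inverse (real m ^ 4)) * ennreal ((norm (\<Sum>n<m ^ 2. torus_char (k n) x))\<^sup>2) \<partial>torus_haar)"
      by (simp add: u_eq ennreal_mult')
    also have "\<dots> = ennreal (inverse (real m ^ 4)) * of_nat (m ^ 2)"
      by (subst nn_integral_cmult) (simp_all only: nn_integral_norm_sum_torus_char[OF k], measurable)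
    also have "\<dots> = ennreal (inverse (real m ^ 4) * real (m ^ 2))"
      by (subst ennreal_mult) (simp_all add: ennreal_of_nat_eq_real_of_nat)
    also have "inverse (real m ^ 4) * real (m ^ 2) = inverse (real m ^ 2)"
      by (simp add: field_simps power2_eq_square power4_eq_xxxx)
    finally show ?thesis .
  qed
  have "(\<integral>\<^sup>+x. (\<Sum>m. ennreal (u m x)) \<partial>torus_haar) = (\<Sum>m. ennreal (inverse (real m ^ 2)))"
    by (simp add: nn_integral_suminf int)
  also have "\<dots> = ennreal (\<Sum>m. inverse (real m ^ 2))"
    by (rule suminf_ennreal2) (simp_all add: inverse_power_summable)
  finally have "(\<integral>\<^sup>+x. (\<Sum>m. ennreal (u m x)) \<partial>torus_haar) \<noteq> \<infinity>" by simp
  then have "AE x in torus_haar. (\<Sum>m. ennreal (u m x)) \<noteq> \<infinity>"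
    by (intro nn_integral_PInf_AE) measurable
  then show ?thesis
  proof (rule AE_mp, intro AE_I2 impI)
    fix x assume x: "(\<Sum>m. ennreal (u m x)) \<noteq> \<infinity>"
    have "summable (\<lambda>m. u m x)"
      by (rule summable_suminf_not_top) (use x in \<open>auto simp: u_def\<close>)
    then have "(\<lambda>m. u m x) \<longlonglongrightarrow> 0" by (rule summable_LIMSEQ_zero)
    then have "(\<lambda>m. sqrt (u m x)) \<longlonglongrightarrow> sqrt 0" by (rule tendsto_real_sqrt)
    then have "(\<lambda>m. cesaro (\<lambda>n. torus_char (k n) x) (m ^ 2)) \<longlonglongrightarrow> 0"
      by (simp add: u_def tendsto_norm_zero_iff)
    then show "cesaro (\<lambda>n. torus_char (k n) x) \<longlonglongrightarrow> 0"
      by (intro cesaro_of_squares) (simp_all add: norm_torus_char)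
  qed
qed

section \<open>Trigonometric polynomials and Weyl's criterion\<close>

inductive_set trig_poly :: "('n::finite torus \<Rightarrow> complex) set" where
  char: "(\<lambda>x. c * torus_char k x) \<in> trig_poly"
| add: "f \<in> trig_poly \<Longrightarrow> g \<in> trig_poly \<Longrightarrow> (\<lambda>x. f x + g x) \<in> trig_poly"

lemma trig_poly_cmult: "f \<in> trig_poly \<Longrightarrow> (\<lambda>x. c * f x) \<in> trig_poly"
proof (induction rule: trig_poly.induct)
  case (char d k)
  then show ?case using trig_poly.char[of "c * d" k] by (simp add: mult.assoc)
next
  case (add f g)
  then show ?case using trig_poly.add[of "\<lambda>x. c * f x" "\<lambda>x. c * g x"] by (simp add: algebra_simps)
qed

lemma trig_poly_mult:
  assumes "f \<in> trig_poly" "g \<in> trig_poly"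
  shows "(\<lambda>x. f x * g x) \<in> trig_poly"
  using assms(1)
proof (induction rule: trig_poly.induct)
  case (char c k)
  show ?case using assms(2)
  proof (induction rule: trig_poly.induct)
    case (char d l)
    have "(\<lambda>x. c * torus_char k x * (d * torus_char l x)) = (\<lambda>x. (c * d) * torus_char (k + l) x)"
      by (simp add: torus_char_mult[symmetric] mult_ac)
    then show ?case by (simp only: trig_poly.char)
  next
    case (add f g)
    then show ?case
      using trig_poly.add[of "\<lambda>x. c * torus_char k x * f x" "\<lambda>x. c * torus_char k x * g x"]
      by (simp add: algebra_simps)
  qed
next
  case (add f h)
  then show ?case using trig_poly.add[of "\<lambda>x. f x * g x" "\<lambda>x. h x * g x"] by (simp add: algebra_simps)
qed

lemma continuous_on_trig_poly: "f \<in> trig_poly \<Longrightarrow> continuous_on UNIV f"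
  by (induction rule: trig_poly.induct)
    (auto intro!: continuous_on_add continuous_on_mult continuous_on_const continuous_on_torus_char)

text \<open>The coordinate characters determine every coordinate modulo 1.\<close>

lemma separating_torus_char:
  fixes x y :: "'n::finite torus"
  assumes "x \<noteq> y"
  shows "\<exists>k. torus_char k x \<noteq> torus_char k y"
proof (rule ccontr)
  assume "\<not> ?thesis"
  then have eq: "torus_char k x = torus_char k y" for k by blast
  obtain a b where ab: "x = torus_proj a" "y = torus_proj b" by (metis torus_proj_cases)
  have "a - b \<in> int_lattice"
    unfolding int_lattice_def
  proof (intro CollectI allI)
    fix i
    have "cis (2 * pi * (a $ i)) = cis (2 * pi * (b $ i))"
      using eq[of "axis i 1"] by (simp add: ab torus_char_proj pairing_axis_left)
    then have "cis (2 * pi * (a $ i) - 2 * pi * (b $ i)) = 1" by (simp flip: cis_divide)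
    then have "cos (2 * pi * (a $ i - b $ i)) = 1"
      by (simp add: complex_eq_iff algebra_simps)
    then obtain n where "2 * pi * (a $ i - b $ i) = of_int n * 2 * pi" by (auto simp: cos_one_2pi_int)
    then have "a $ i - b $ i = of_int n" by simp
    then show "(a - b) $ i \<in> \<int>" by simp
  qed
  then show False using assms by (simp add: ab torus_proj_eq_iff)
qed

lemma trig_poly_Re_Im:
  "(\<lambda>x. complex_of_real (Re (torus_char k x))) \<in> trig_poly"
  "(\<lambda>x. complex_of_real (Im (torus_char k x))) \<in> trig_poly"
proof -
  have "(\<lambda>x. complex_of_real (Re (torus_char k x))) = (\<lambda>x. (1/2) * torus_char k x + (1/2) * torus_char (- k) x)"
    by (simp add: fun_eq_iff complex_eq_iff flip: torus_char_cnj)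
  then show "(\<lambda>x. complex_of_real (Re (torus_char k x))) \<in> trig_poly"
    by (simp only: trig_poly.char trig_poly.add)
  have "(\<lambda>x. complex_of_real (Im (torus_char k x))) = (\<lambda>x. (-\<i>/2) * torus_char k x + (\<i>/2) * torus_char (- k) x)"
    by (simp add: fun_eq_iff complex_eq_iff flip: torus_char_cnj)
  then show "(\<lambda>x. complex_of_real (Im (torus_char k x))) \<in> trig_poly"
    by (simp only: trig_poly.char trig_poly.add)
qed

text \<open>Stone-Weierstrass is applied to the ring of real functions that are trigonometric
  polynomials when read as complex ones; the real and imaginary parts of f are approximated
  separately.\<close>

lemma trig_poly_dense:
  fixes f :: "'n::finite torus \<Rightarrow> complex"
  assumes f: "continuous_on UNIV f" and e: "0 < e"
  shows "\<exists>g\<in>trig_poly. \<forall>x. norm (f x - g x) < e"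
proof -
  interpret function_ring_on "{g. (\<lambda>x. complex_of_real (g x)) \<in> trig_poly}" "UNIV :: 'n torus set"
  proof
    show "compact (UNIV :: 'n torus set)" by (rule compact_torus)
    show "continuous_on UNIV g" if "g \<in> {g. (\<lambda>x. complex_of_real (g x)) \<in> trig_poly}" for g :: "'n torus \<Rightarrow> real"
    proof -
      have "continuous_on UNIV (\<lambda>x. Re (complex_of_real (g x)))"
        by (intro continuous_on_Re continuous_on_trig_poly) (use that in simp)
      then show ?thesis by simp
    qed
    show "(\<lambda>x. g x + h x) \<in> {g. (\<lambda>x. complex_of_real (g x)) \<in> trig_poly}"
      if "g \<in> {g. (\<lambda>x. complex_of_real (g x)) \<in> trig_poly}" "h \<in> {g. (\<lambda>x. complex_of_real (g x)) \<in> trig_poly}"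
      for g h :: "'n torus \<Rightarrow> real"
      using that by (simp add: trig_poly.add)
    show "(\<lambda>x. g x * h x) \<in> {g. (\<lambda>x. complex_of_real (g x)) \<in> trig_poly}"
      if "g \<in> {g. (\<lambda>x. complex_of_real (g x)) \<in> trig_poly}" "h \<in> {g. (\<lambda>x. complex_of_real (g x)) \<in> trig_poly}"
      for g h :: "'n torus \<Rightarrow> real"
      using that by (simp add: trig_poly_mult)
    show "(\<lambda>_. c) \<in> {g. (\<lambda>x::'n torus. complex_of_real (g x)) \<in> trig_poly}" for c
      using trig_poly.char[of "complex_of_real c" 0] by (simp add: torus_char_0)
    show "\<exists>g\<in>{g. (\<lambda>x. complex_of_real (g x)) \<in> trig_poly}. g x \<noteq> g y" if ne: "x \<noteq> y" for x y :: "'n torus"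
    proof -
      obtain k where k: "torus_char k x \<noteq> torus_char k y" using separating_torus_char[OF ne] by blast
      show ?thesis
      proof (cases "Re (torus_char k x) = Re (torus_char k y)")
        case True
        then have "Im (torus_char k x) \<noteq> Im (torus_char k y)" using k by (simp add: complex_eq_iff)
        then show ?thesis using trig_poly_Re_Im(2)[of k] by (intro bexI[of _ "\<lambda>x. Im (torus_char k x)"]) auto
      next
        case False
        then show ?thesis using trig_poly_Re_Im(1)[of k] by (intro bexI[of _ "\<lambda>x. Re (torus_char k x)"]) auto
      qed
    qed
  qed
  have e2: "0 < e / 2" using e by simp
  obtain g where g: "(\<lambda>x. complex_of_real (g x)) \<in> trig_poly" "\<And>x. \<bar>Re (f x) - g x\<bar> < e / 2"
    using Stone_Weierstrass_basic[OF continuous_on_Re[OF f] e2] by auto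
  obtain h where h: "(\<lambda>x. complex_of_real (h x)) \<in> trig_poly" "\<And>x. \<bar>Im (f x) - h x\<bar> < e / 2"
    using Stone_Weierstrass_basic[OF continuous_on_Im[OF f] e2] by auto
  show ?thesis
  proof (intro bexI allI)
    show "(\<lambda>x. complex_of_real (g x) + \<i> * complex_of_real (h x)) \<in> trig_poly"
      by (rule trig_poly.add[OF g(1) trig_poly_cmult[OF h(1)]])
    fix x
    have "norm (f x - (complex_of_real (g x) + \<i> * complex_of_real (h x))) \<le> \<bar>Re (f x) - g x\<bar> + \<bar>Im (f x) - h x\<bar>"
      using cmod_le[of "f x - (complex_of_real (g x) + \<i> * complex_of_real (h x))"] by simp
    then show "norm (f x - (complex_of_real (g x) + \<i> * complex_of_real (h x))) < e"
      using g(2)[of x] h(2)[of x] by simp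
  qed
qed

lemma integrable_continuous_torus:
  fixes f :: "'n::finite torus \<Rightarrow> complex"
  assumes f: "continuous_on UNIV f"
  shows "integrable torus_haar f"
proof -
  have "bounded (range f)" using compact_continuous_image[OF f compact_torus] by (rule compact_imp_bounded)
  then obtain B where "\<And>x. norm (f x) \<le> B" by (auto simp: bounded_iff)
  moreover have "f \<in> borel_measurable borel" by (rule borel_measurable_continuous_onI[OF f])
  ultimately show ?thesis
    by (intro torus_haar.integrable_const_bound[where B = B]) (auto cong: measurable_cong_sets)
qed

lemma Eq_setI_torus_char:
  fixes F :: "'n::finite torus \<Rightarrow> 'n torus"
  assumes ch: "\<And>k. k \<noteq> 0 \<Longrightarrow> cesaro (\<lambda>n. torus_char k ((F ^^ n) x)) \<longlonglongrightarrow> 0"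
  shows "x \<in> Eq_set F"
proof -
  have m1: "measure (torus_haar :: 'n torus measure) UNIV = 1"
    by (simp add: measure_def emeasure_torus_haar_UNIV)
  have trig: "cesaro (\<lambda>n. g ((F ^^ n) x)) \<longlonglongrightarrow> (LINT y|torus_haar. g y)" if "g \<in> trig_poly" for g
    using that
  proof (induction rule: trig_poly.induct)
    case (char c k)
    show ?case
    proof (cases "k = 0")
      case True
      have "(\<lambda>N. cesaro (\<lambda>n. c) N) \<longlonglongrightarrow> c"
      proof (rule tendsto_eventually, rule eventually_sequentiallyI)
        show "cesaro (\<lambda>n. c) N = c" if "1 \<le> N" for N using that by (simp add: cesaro_def)
      qed
      then show ?thesis using True m1 by (simp add: torus_char_0)
    next
      case False
      then show ?thesis
        using tendsto_mult_right_zero[OF ch[OF False], of c]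
        by (simp add: cesaro_cmult[abs_def] integral_torus_char)
    qed
  next
    case (add f g)
    have "integrable torus_haar f" "integrable torus_haar g"
      using add by (auto intro: integrable_continuous_torus continuous_on_trig_poly)
    then show ?case using tendsto_add[OF add.IH] by (simp add: cesaro_add[abs_def])
  qed
  have "cesaro (\<lambda>n. f ((F ^^ n) x)) \<longlonglongrightarrow> (LINT y|torus_haar. f y)" if f: "continuous_on UNIV f" for f
  proof (rule LIMSEQ_I)
    fix r :: real assume "0 < r"
    then have r: "0 < r / 3" by simp
    obtain g where g: "g \<in> trig_poly" "\<And>x. norm (f x - g x) < r / 3"
      using trig_poly_dense[OF f r] by blast
    have ig: "integrable torus_haar f" "integrable torus_haar g"
      using f g(1) by (auto intro: integrable_continuous_torus continuous_on_trig_poly)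
    obtain N0 where N0: "\<And>N. N \<ge> N0 \<Longrightarrow> norm (cesaro (\<lambda>n. g ((F ^^ n) x)) N - (LINT y|torus_haar. g y)) < r / 3"
      using LIMSEQ_D[OF trig[OF g(1)] r] by blast
    have "norm (cesaro (\<lambda>n. f ((F ^^ n) x)) N - (LINT y|torus_haar. f y)) < r" if N: "N \<ge> N0" for N
    proof -
      have 1: "norm (cesaro (\<lambda>n. f ((F ^^ n) x)) N - cesaro (\<lambda>n. g ((F ^^ n) x)) N) \<le> r / 3"
        unfolding cesaro_diff[symmetric] by (intro norm_cesaro_le less_imp_le g(2))
      have "(LINT y|torus_haar. f y) - (LINT y|torus_haar. g y) = (LINT y|torus_haar. f y - g y)"
        using ig by simp
      moreover have "norm (LINT y|torus_haar. f y - g y) \<le> (LINT y|(torus_haar :: 'n torus measure). r / 3)"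
      proof (rule order_trans[OF integral_norm_bound], rule Bochner_Integration.integral_mono)
        show "integrable torus_haar (\<lambda>y. norm (f y - g y))"
          using ig by (intro integrable_norm Bochner_Integration.integrable_diff)
        show "norm (f y - g y) \<le> r / 3" for y by (rule less_imp_le[OF g(2)])
      qed simp
      ultimately have 2: "norm ((LINT y|torus_haar. f y) - (LINT y|torus_haar. g y)) \<le> r / 3"
        by (simp add: m1)
      have "cesaro (\<lambda>n. f ((F ^^ n) x)) N - (LINT y|torus_haar. f y)
          = (cesaro (\<lambda>n. f ((F ^^ n) x)) N - cesaro (\<lambda>n. g ((F ^^ n) x)) N)
            + (cesaro (\<lambda>n. g ((F ^^ n) x)) N - (LINT y|torus_haar. g y))
            - ((LINT y|torus_haar. f y) - (LINT y|torus_haar. g y))" by simp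
      also have "norm \<dots> \<le> norm (cesaro (\<lambda>n. f ((F ^^ n) x)) N - cesaro (\<lambda>n. g ((F ^^ n) x)) N)
            + norm (cesaro (\<lambda>n. g ((F ^^ n) x)) N - (LINT y|torus_haar. g y))
            + norm ((LINT y|torus_haar. f y) - (LINT y|torus_haar. g y))"
        by (intro order_trans[OF norm_triangle_ineq4] add_right_mono norm_triangle_ineq)
      also have "\<dots> < r" using 1 2 N0[OF N] by simp
      finally show ?thesis .
    qed
    then show "\<exists>no. \<forall>N\<ge>no. norm (cesaro (\<lambda>n. f ((F ^^ n) x)) N - (LINT y|torus_haar. f y)) < r" by blast
  qed
  then show ?thesis by (simp add: Eq_set_def cesaro_def[abs_def])
qed

lemma AE_Eq_set:
  assumes "hyperbolic_endo M"
  shows "AE x in torus_haar. x \<in> Eq_set (torus_map M)"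
proof -
  have "countable (UNIV :: (int ^ 'a) set)"
    using countable_vector[of "\<lambda>_::'a. UNIV :: int set"] by simp
  then have "countable {k :: int ^ 'a. k \<noteq> 0}" by (rule countable_subset[rotated]) simp
  then have "AE x in torus_haar. \<forall>k\<in>{k. k \<noteq> 0}. cesaro (\<lambda>n. torus_char (((\<lambda>k. k v* M) ^^ n) k) x) \<longlonglongrightarrow> 0"
    by (intro AE_ball_countable' AE_cesaro_torus_char inj_dual_orbit assms) simp_all
  then show ?thesis
    by (rule AE_mp) (intro AE_I2 impI Eq_setI_torus_char, simp add: torus_char_funpow)
qed

text \<open>The lifts, hence the two orbits, approach each other. By uniform continuity the values
  of f differ by a null sequence, whose Cesaro averages tend to 0.\<close>

lemma Eq_set_stable:
  fixes M :: "int ^ 'n ^ 'n"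
  assumes x: "torus_proj x \<in> Eq_set (torus_map M)" and y: "y - x \<in> stable_space ((*v) (real_matrix M))"
  shows "torus_proj y \<in> Eq_set (torus_map M)"
  unfolding Eq_set_def
proof (intro CollectI allI impI)
  fix f :: "'n torus \<Rightarrow> complex" assume f: "continuous_on UNIV f"
  let ?A = "(*v) (real_matrix M)"
  let ?a = "\<lambda>z n. f ((torus_map M ^^ n) (torus_proj z))"
  have lin: "linear (?A ^^ n)" for n by (rule linear_funpow) simp
  have unif: "uniformly_continuous_on UNIV f" by (rule compact_uniformly_continuous[OF f compact_torus])
  have "(\<lambda>n. ?a y n - ?a x n) \<longlonglongrightarrow> 0"
  proof (rule LIMSEQ_I)
    fix r :: real assume "0 < r"
    then obtain d where d: "0 < d" "\<And>p q. dist p q < d \<Longrightarrow> dist (f p) (f q) < r"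
      using unif unfolding uniformly_continuous_on_def by (metis UNIV_I)
    have "(\<lambda>n. (?A ^^ n) (y - x)) \<longlonglongrightarrow> 0" using y by (simp add: stable_space_def)
    from LIMSEQ_D[OF this d(1)] obtain N where N: "\<And>n. n \<ge> N \<Longrightarrow> norm ((?A ^^ n) y - (?A ^^ n) x) < d"
      by (auto simp: linear_diff[OF lin])
    have "norm (?a y n - ?a x n - 0) < r" if "n \<ge> N" for n
    proof -
      have "dist ((torus_map M ^^ n) (torus_proj y)) ((torus_map M ^^ n) (torus_proj x)) < d"
        unfolding torus_map_funpow_proj by (rule le_less_trans[OF dist_torus_proj_le N[OF that]])
      from d(2)[OF this] show ?thesis by (simp add: dist_norm)
    qed
    then show "\<exists>no. \<forall>n\<ge>no. norm (?a y n - ?a x n - 0) < r" by blast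
  qed
  from cesaro_tendsto_0[OF this] have "(\<lambda>N. cesaro (?a y) N - cesaro (?a x) N) \<longlonglongrightarrow> 0"
    by (simp add: cesaro_diff[abs_def])
  moreover have "cesaro (?a x) \<longlonglongrightarrow> (LINT y|torus_haar. f y)"
    using x f by (simp add: Eq_set_def cesaro_def[abs_def])
  ultimately have "(\<lambda>N. (cesaro (?a y) N - cesaro (?a x) N) + cesaro (?a x) N) \<longlonglongrightarrow> 0 + (LINT y|torus_haar. f y)"
    by (rule tendsto_add)
  then show "(\<lambda>N. (\<Sum>n<N. ?a y n) / of_nat N) \<longlonglongrightarrow> (LINT y|torus_haar. f y)"
    by (simp add: cesaro_def)
qed

text \<open>Compactness is wanted for the covering argument later. The complement of
  \<open>Eq_set\<close> lies in a Borel null set; the cube minus its lift has measure 1, and inner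
  regularity gives a closed subset of positive measure.\<close>

lemma compact_Eq_set_lift:
  fixes M :: "int ^ 'n ^ 'n"
  assumes "hyperbolic_endo M"
  obtains G :: "(real ^ 'n) set" where "compact G" "0 < measure lborel G"
    "\<And>z. z \<in> G \<Longrightarrow> torus_proj z \<in> Eq_set (torus_map M)"
proof -
  obtain W where W: "{x \<in> space torus_haar. x \<notin> Eq_set (torus_map M)} \<subseteq> W"
    "emeasure torus_haar W = 0" "W \<in> sets torus_haar"
    using AE_Eq_set[OF assms] by (rule AE_E)
  then have [measurable]: "W \<in> sets borel" by simp
  define Y where "Y = {x \<in> unit_cube. torus_proj x \<in> W}"
  define U where "U = (unit_cube :: (real ^ 'n) set) - Y"
  have [measurable]: "Y \<in> sets borel" unfolding Y_def by measurable
  have UB: "U \<in> sets borel" unfolding U_def by measurable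
  have Y0: "emeasure lborel Y = 0" using W(2) by (simp add: emeasure_torus_haar Y_def)
  have "emeasure lborel U = emeasure lborel (unit_cube :: (real ^ 'n) set) - emeasure lborel Y"
    unfolding U_def by (rule emeasure_Diff) (simp_all add: Y0, auto simp: Y_def)
  then have U1: "emeasure lborel U = 1" by (simp add: Y0 emeasure_unit_cube)
  have "U \<in> sets lebesgue" using UB by simp
  \<comment> \<open>With e = 1 less than the whole measure of U is lost, so G is not null.\<close>
  then obtain G where G: "closed G" "G \<subseteq> U" "U - G \<in> lmeasurable" "emeasure lebesgue (U - G) < ennreal 1"
    by (rule sets_lebesgue_inner_closed[where e = 1]) auto
  have "(unit_cube :: (real ^ 'n) set) \<subseteq> cbox 0 1"
    by (auto simp: unit_cube_def mem_box_cart less_imp_le)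
  then have bd: "bounded G" using G(2) by (intro bounded_subset[OF bounded_cbox]) (auto simp: U_def)
  have GB: "G \<in> sets borel" using G(1) by (rule borel_closed)
  have "emeasure lborel G \<noteq> 0"
  proof
    assume G0: "emeasure lborel G = 0"
    have "emeasure lborel U \<le> emeasure lborel G + emeasure lborel (U - G)"
      using emeasure_subadditive[of G lborel "U - G"] GB UB G(2) by (simp add: Un_absorb1)
    moreover have "emeasure lborel (U - G) < 1"
      using G(4) GB UB by simp
    ultimately show False using U1 G0 by simp
  qed
  moreover have "emeasure lborel G < \<infinity>" by (rule emeasure_bounded_finite[OF bd])
  ultimately have "0 < measure lborel G" by (simp add: measure_def enn2real_positive_iff zero_less_iff_neq_zero)
  moreover have "torus_proj z \<in> Eq_set (torus_map M)" if "z \<in> G" for z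
    using that G(2) W(1) by (auto simp: U_def Y_def)
  ultimately show ?thesis using bd G(1) by (intro that[of G]) (auto simp: compact_eq_bounded_closed)
qed

section \<open>Hausdorff dimension and nondense orbits\<close>

lemma diam_powr_le:
  assumes "0 < s" "bounded U" "diameter U \<le> r" "0 \<le> r"
  shows "diam_powr s U \<le> ennreal (r powr s)"
  using assms by (auto simp: diam_powr_def diameter_ge_0 intro!: ennreal_leI powr_mono2)

text \<open>The torus is cut into N^d cubes of side 1 / N, whose diameter is estimated by the l1
  norm. Covers are sequences, so the list is padded with empty sets, which \<open>diam_powr\<close>
  counts as 0.\<close>

lemma torus_grid_cover:
  fixes N :: nat
  assumes N: "0 < N"
  obtains U :: "nat \<Rightarrow> 'n::finite torus set" where "(\<Union>i. U i) = UNIV" "\<And>i. bounded (U i)"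
    "\<And>i. diameter (U i) \<le> CARD('n) / N" "\<And>i. N ^ CARD('n) \<le> i \<Longrightarrow> U i = {}"
proof -
  let ?J = "(UNIV :: 'n set) \<rightarrow>\<^sub>E {..<N}"
  define Q where "Q j = torus_proj ` cbox (\<chi> i. real (j i) / N) (\<chi> i. (real (j i) + 1) / N)" for j :: "'n \<Rightarrow> nat"
  have "finite ?J" by (intro finite_PiE) auto
  moreover have "card ?J = N ^ CARD('n)" by (simp add: card_PiE)
  ultimately obtain e where e: "bij_betw e {0..<N ^ CARD('n)} ?J"
    using ex_bij_betw_nat_finite by metis
  define U where "U i = (if i < N ^ CARD('n) then Q (e i) else {})" for i
  have Qd: "dist a b \<le> CARD('n) / N" if "a \<in> Q j" "b \<in> Q j" for a b j
  proof -
    obtain x y where x: "a = torus_proj x" "x \<in> cbox (\<chi> i. real (j i) / N) (\<chi> i. (real (j i) + 1) / N)"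
      and y: "b = torus_proj y" "y \<in> cbox (\<chi> i. real (j i) / N) (\<chi> i. (real (j i) + 1) / N)"
      using \<open>a \<in> Q j\<close> \<open>b \<in> Q j\<close> unfolding Q_def by blast
    have "dist a b \<le> norm (x - y)" unfolding x(1) y(1) by (rule dist_torus_proj_le)
    also have "\<dots> \<le> (\<Sum>i\<in>UNIV. \<bar>(x - y) $ i\<bar>)" by (rule norm_le_l1_cart)
    also have "\<dots> \<le> (\<Sum>i\<in>(UNIV :: 'n set). 1 / N)"
    proof (rule sum_mono)
      fix i :: 'n
      have "real (j i) / N \<le> x $ i" "x $ i \<le> real (j i) / N + 1 / N" "real (j i) / N \<le> y $ i" "y $ i \<le> real (j i) / N + 1 / N"
        using x(2) y(2) by (auto simp: mem_box_cart add_divide_distrib)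
      then show "\<bar>(x - y) $ i\<bar> \<le> 1 / N" by simp
    qed
    finally show ?thesis by simp
  qed
  have cov: "\<exists>i. q \<in> U i" for q :: "'n torus"
  proof -
    obtain x where x: "q = torus_proj x" by (rule torus_proj_cases)
    obtain v where v: "v \<in> int_lattice" "x - v \<in> unit_cube" using unit_cube_decomp by blast
    define y where "y = x - v"
    have q: "q = torus_proj y" using v(1) by (simp add: x y_def torus_proj_eq_iff)
    have y01: "0 \<le> y $ i" "y $ i < 1" for i using v(2) by (auto simp: y_def unit_cube_def)
    define j where "j i = nat \<lfloor>N * y $ i\<rfloor>" for i
    have jr: "real (j i) \<le> N * y $ i" "N * y $ i < real (j i) + 1" for i
      using y01(1)[of i] by (auto simp: j_def)
    have "j i < N" for i
    proof -
      have "real N * y $ i < real N * 1" using y01(2)[of i] N by (intro mult_strict_left_mono) auto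
      then show ?thesis using jr(1)[of i] by simp
    qed
    then have "j \<in> ?J" by auto
    then have "j \<in> e ` {0..<N ^ CARD('n)}" using e by (simp add: bij_betw_def)
    then obtain i where i: "i < N ^ CARD('n)" "e i = j" by auto
    have "y \<in> cbox (\<chi> i. real (j i) / N) (\<chi> i. (real (j i) + 1) / N)"
      using jr N by (auto simp: mem_box_cart field_simps less_imp_le)
    then have "q \<in> U i" using i by (auto simp: U_def Q_def q)
    then show ?thesis by blast
  qed
  show ?thesis
  proof (rule that[of U])
    show "(\<Union>i. U i) = UNIV" using cov by blast
    show "bounded (U i)" for i
    proof (cases "i < N ^ CARD('n)")
      case True
      then show ?thesis using Qd unfolding U_def bounded_two_points by auto
    qed (simp add: U_def)
    show "diameter (U i) \<le> CARD('n) / N" for i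
    proof (cases "U i = {}")
      case False
      then show ?thesis
        unfolding diameter_def by (auto simp: U_def intro!: cSUP_least Qd split: if_splits)
    qed simp
  qed (simp add: U_def)
qed

text \<open>For s > d the grid of mesh 1 / N has total N^d (d / N)^s = d^s N^(d - s), which tends to
  0; every subset of the torus inherits this bound.\<close>

lemma hausdorff_dim_torus_le:
  fixes A :: "'n::finite torus set"
  shows "hausdorff_dim A \<le> of_nat CARD('n)"
proof -
  let ?d = "CARD('n)"
  have meas0: "hausdorff_measure s A = 0" if s: "real ?d < s" for s
  proof -
    have "hausdorff_premeasure s \<delta> A = 0" if \<delta>: "0 < \<delta>" for \<delta>
    proof -
      have bound: "hausdorff_premeasure s \<delta> A \<le> ennreal (?d powr s * N powr (?d - s))"
        if N: "0 < N" "?d / N \<le> \<delta>" for N :: nat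
      proof -
        obtain U :: "nat \<Rightarrow> 'n torus set" where U: "(\<Union>i. U i) = UNIV" "\<And>i. bounded (U i)"
          "\<And>i. diameter (U i) \<le> ?d / N" "\<And>i. N ^ ?d \<le> i \<Longrightarrow> U i = {}"
          using torus_grid_cover[OF N(1)] by metis
        have "hausdorff_premeasure s \<delta> A \<le> (\<Sum>i. diam_powr s (U i))"
          unfolding hausdorff_premeasure_def
        proof (rule Inf_lower, intro CollectI exI conjI allI)
          show "A \<subseteq> (\<Union>i. U i)" using U(1) by simp
          show "diameter (U i) \<le> \<delta>" for i using U(3)[of i] N(2) by simp
        qed (use U(2) in auto)
        also have "\<dots> = (\<Sum>i<N ^ ?d. diam_powr s (U i))"
          by (rule suminf_finite) (auto simp: U(4) diam_powr_def)
        also have "\<dots> \<le> (\<Sum>i<N ^ ?d. ennreal ((?d / N) powr s))"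
          using s by (intro sum_mono diam_powr_le U(2,3)) auto
        also have "\<dots> = ennreal (real (N ^ ?d) * (?d / N) powr s)"
          by (simp add: ennreal_mult ennreal_of_nat_eq_real_of_nat)
        also have "real (N ^ ?d) * (?d / N) powr s = ?d powr s * N powr (?d - s)"
          using N(1) by (simp add: powr_divide powr_diff powr_realpow)
        finally show ?thesis .
      qed
      have "(\<lambda>N. real N powr (?d - s)) \<longlonglongrightarrow> 0"
        using s by (intro tendsto_neg_powr filterlim_real_sequentially) simp
      then have "(\<lambda>N. ennreal (?d powr s * real N powr (?d - s))) \<longlonglongrightarrow> ennreal (?d powr s * 0)"
        by (intro tendsto_ennrealI tendsto_mult tendsto_const)
      moreover have "\<exists>N0. \<forall>N\<ge>N0. hausdorff_premeasure s \<delta> A \<le> ennreal (?d powr s * real N powr (?d - s))"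
      proof -
        obtain N0 :: nat where N0: "?d / \<delta> < N0" using reals_Archimedean2 by blast
        have "hausdorff_premeasure s \<delta> A \<le> ennreal (?d powr s * real N powr (?d - s))" if "N \<ge> max N0 1" for N
        proof (rule bound)
          show "0 < N" using that by simp
          have "?d / \<delta> < N" using N0 that by simp
          then show "?d / N \<le> \<delta>" using \<delta> \<open>0 < N\<close> by (simp add: field_simps)
        qed
        then show ?thesis by blast
      qed
      ultimately have "hausdorff_premeasure s \<delta> A \<le> ennreal (?d powr s * 0)"
        by (rule LIMSEQ_le_const)
      then show ?thesis by simp
    qed
    then show ?thesis by (auto simp: hausdorff_measure_def intro!: antisym SUP_least)
  qed
  have "hausdorff_dim A \<le> ennreal (?d + e)" if "0 < e" for e :: real
    unfolding hausdorff_dim_def using that by (intro Inf_lower) (auto intro!: exI[of _ "?d + e"] meas0)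
  then have eps: "hausdorff_dim A \<le> ennreal ?d + ennreal e" if "0 < e" for e :: real
    using that by (simp add: ennreal_plus)
  have "hausdorff_dim A \<le> ennreal ?d" by (rule ennreal_le_epsilon) (rule eps)
  then show ?thesis by (simp add: ennreal_of_nat_eq_real_of_nat)
qed

section \<open>Orbits that stay away from the origin\<close>

lemma infinite_ball_torus:
  assumes r: "0 < r"
  shows "infinite (ball (0 :: 'n::finite torus) r)"
proof
  assume fin: "finite (ball (0 :: 'n torus) r)"
  define c where "c = min (r / 2) (1 / 2)"
  obtain i :: 'n where True by blast
  define w where "w n = torus_proj ((c / Suc n) *\<^sub>R axis i 1 :: real ^ 'n)" for n
  have c: "0 < c" "c < r" "c \<le> 1/2" using r by (auto simp: c_def)
  have cn: "0 < c / Suc n" "c / Suc n \<le> c" for n using c by (auto simp: field_simps)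
  have "w n \<in> ball 0 r" for n
  proof -
    have "dist (torus_proj 0) (w n) \<le> norm (0 - (c / Suc n) *\<^sub>R axis i 1 :: real ^ 'n)"
      unfolding w_def by (rule dist_torus_proj_le)
    also have "\<dots> = c / Suc n" using c by (simp add: norm_axis_1)
    also have "\<dots> < r" using cn[of n] c by simp
    finally show ?thesis by (simp add: zero_torus_def torus_proj_def)
  qed
  moreover have "inj w"
  proof (rule injI)
    fix n m assume "w n = w m"
    then have "(c / Suc n) *\<^sub>R axis i 1 - (c / Suc m) *\<^sub>R axis i 1 \<in> (int_lattice :: (real ^ 'n) set)"
      by (simp add: w_def torus_proj_eq_iff)
    then have "c / Suc n - c / Suc m \<in> \<int>" by (auto simp: int_lattice_def dest!: spec[of _ i])
    moreover have "\<bar>c / Suc n - c / Suc m\<bar> < 1" using cn[of n] cn[of m] c by linarith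
    ultimately have "c / Suc n - c / Suc m = 0" by (metis Ints_nonzero_abs_less1)
    then show "n = m" using c by simp
  qed
  ultimately show False using fin by (meson finite_imageD finite_subset image_subset_iff infinite_UNIV_nat)
qed

lemma linear_funpow_int_lattice:
  "v \<in> int_lattice \<Longrightarrow> ((*v) (real_matrix M) ^^ n) v \<in> int_lattice"
  by (induction n) (auto intro: real_matrix_int_lattice)

text \<open>Only times divisible by N are controlled. A point very near the lattice at another time
  would still be near it at the next multiple of N, because the matrix preserves the lattice and is
  Lipschitz. The orbit of x follows that of u from some time on.\<close>

lemma ND_setI_avoiding:
  fixes M :: "int ^ 'n ^ 'n"
  assumes N: "0 < N"
    and av: "\<And>k z. z \<in> int_lattice \<Longrightarrow> 1/16 \<le> dist (((*v) (real_matrix M) ^^ (N * k)) u) z"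
    and x: "x - u \<in> stable_space ((*v) (real_matrix M))"
  shows "torus_proj x \<in> ND_set (torus_map M)"
proof -
  let ?f = "(*v) (real_matrix M)"
  have lin: "linear (?f ^^ n)" for n by (rule linear_funpow) simp
  obtain K0 where K0: "\<And>y. norm (?f y) \<le> K0 * norm y" using linear_bounded[of ?f] by auto
  define K where "K = max K0 1"
  have K1: "1 \<le> K" by (simp add: K_def)
  have K: "norm (?f y) \<le> K * norm y" for y
    using K0[of y] mult_right_mono[of K0 K "norm y"] by (simp add: K_def)
  have Kn: "norm ((?f ^^ n) y) \<le> K ^ n * norm y" for n y
  proof (induction n)
    case (Suc n)
    have "norm ((?f ^^ Suc n) y) \<le> K * norm ((?f ^^ n) y)" using K by simp
    also have "\<dots> \<le> K * (K ^ n * norm y)" using Suc K1 by (intro mult_left_mono) auto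
    finally show ?case by simp
  qed simp
  define \<rho> where "\<rho> = 1 / (16 * K ^ N)"
  have KN: "0 < K ^ N" using K1 by simp
  have \<rho>: "0 < \<rho>" using KN by (simp add: \<rho>_def)
  have av': "\<rho> \<le> norm ((?f ^^ k) u - z)" if z: "z \<in> int_lattice" for k z
  proof -
    \<comment> \<open>The number of steps to the next multiple of N, between 1 and N; a full N when
      k is itself a multiple.\<close>
    define i where "i = N - k mod N"
    have i: "i + k = N * (k div N + 1)" "i \<le> N"
      using mod_less_divisor[OF N, of k] mult_div_mod_eq[of N k] unfolding i_def distrib_left by linarith+
    have "1/16 \<le> norm ((?f ^^ (i + k)) u - (?f ^^ i) z)"
      using av[OF linear_funpow_int_lattice[OF z], where k = "k div N + 1"] unfolding i(1) by (simp add: dist_norm)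
    also have "\<dots> = norm ((?f ^^ i) ((?f ^^ k) u - z))" by (simp add: funpow_add linear_diff[OF lin])
    also have "\<dots> \<le> K ^ i * norm ((?f ^^ k) u - z)" by (rule Kn)
    also have "\<dots> \<le> K ^ N * norm ((?f ^^ k) u - z)"
      using i(2) K1 by (intro mult_right_mono power_increasing) auto
    finally show ?thesis using KN by (simp add: \<rho>_def field_simps)
  qed
  have "(\<lambda>n. (?f ^^ n) (x - u)) \<longlonglongrightarrow> 0" using x by (simp add: stable_space_def)
  from LIMSEQ_D[OF this, of "\<rho> / 2"] \<rho> obtain k0 where
    k0: "\<And>k. k \<ge> k0 \<Longrightarrow> norm ((?f ^^ k) x - (?f ^^ k) u) < \<rho> / 2" by (auto simp: linear_diff[OF lin])
  let ?O = "\<lambda>k. (torus_map M ^^ k) (torus_proj x)"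
  have far: "\<rho> / 2 \<le> dist 0 (?O k)" if k: "k \<ge> k0" for k
  proof -
    obtain z where z: "torus_proj z = (0 :: 'n torus)" "norm ((?f ^^ k) x - z) = dist (torus_proj ((?f ^^ k) x)) 0"
      by (rule torus_lift_near)
    have "torus_proj z = torus_proj 0" using z(1) by (simp add: zero_torus_def torus_proj_def)
    then have zl: "z \<in> int_lattice" by (simp add: torus_proj_eq_iff)
    have "(?f ^^ k) u - z = ((?f ^^ k) x - z) - ((?f ^^ k) x - (?f ^^ k) u)" by simp
    then have "norm ((?f ^^ k) u - z) \<le> norm ((?f ^^ k) x - z) + norm ((?f ^^ k) x - (?f ^^ k) u)"
      by (simp only: norm_triangle_ineq4)
    then show ?thesis using av'[OF zl, of k] k0[OF k] z(2) by (simp add: torus_map_funpow_proj dist_commute)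
  qed
  have "closure {?O k | k. True} \<noteq> UNIV"
  proof
    assume dense: "closure {?O k | k. True} = UNIV"
    \<comment> \<open>The finitely many early orbit points may enter the ball about 0. Removing them
      leaves a nonempty open set, as balls in the torus are infinite, and this set is never
      visited.\<close>
    let ?E = "?O ` {..<k0}" and ?B = "ball (0 :: 'n torus) (\<rho> / 2)"
    have "infinite (?B - ?E)" using \<rho> by (intro Diff_infinite_finite infinite_ball_torus) auto
    then have "?B - ?E \<noteq> {}" by (metis finite.emptyI)
    moreover have "open (?B - ?E)" by (intro open_Diff open_ball finite_imp_closed) auto
    ultimately have "(?B - ?E) \<inter> {?O k | k. True} \<noteq> {}"
      using open_Int_closure_eq_empty[of "?B - ?E" "{?O k | k. True}"] dense by auto
    then obtain k where k: "?O k \<in> ?B" "?O k \<notin> ?E" by blast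
    then have "k \<ge> k0" by (metis imageI lessThan_iff not_le)
    then show False using far[of k] k(1) by simp
  qed
  then show ?thesis by (simp add: ND_set_def D_set_def)
qed

text \<open>Substituting \<open>z = z' + y\<close> turns \<open>\<sigma> y + \<tau> z\<close> into \<open>y + \<tau> z'\<close>, a translation of \<open>y\<close> that
  preserves \<open>F\<close>.\<close>

lemma product_cover_bound:
  fixes F B G V :: "'a::euclidean_space set"
  assumes [measurable]: "F \<in> sets borel" "B \<in> sets borel" "G \<in> sets borel" "V \<in> sets borel"
    and \<sigma>: "linear \<sigma>" and \<tau>: "linear \<tau>" and sum: "\<And>x. \<sigma> x + \<tau> x = x"
    and inv: "\<And>y z. y \<in> F \<Longrightarrow> y + \<tau> z \<in> F"
    and b: "B \<subseteq> cball 0 b" and c: "G \<subseteq> cball 0 c" and k: "0 \<le> k" "\<And>x. norm (\<tau> x) \<le> k * norm x"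
  shows "(\<integral>\<^sup>+y. (\<integral>\<^sup>+z. indicator (F \<inter> B) y * indicator G z * indicator V (\<sigma> y + \<tau> z) \<partial>lborel) \<partial>lborel)
    \<le> emeasure lborel (cball 0 (b + c) :: 'a set) * emeasure lborel (F \<inter> V \<inter> cball 0 (b + k * (b + c)))"
    (is "?L \<le> emeasure lborel ?K * emeasure lborel (F \<inter> V \<inter> ?R)")
proof -
  have [measurable]: "\<sigma> \<in> borel_measurable borel" "\<tau> \<in> borel_measurable borel"
    using \<sigma> \<tau> by (auto intro!: borel_measurable_continuous_onI linear_continuous_on simp: linear_conv_bounded_linear)
  have mR: "?R \<in> sets borel" "?K \<in> sets borel" by auto
  note [measurable] = mR
  have eq: "\<sigma> y + \<tau> (y + z) = y + \<tau> z" for y z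
    using sum[of y] by (simp add: linear_add[OF \<tau>] add.assoc[symmetric])
  have "?L = (\<integral>\<^sup>+y. (\<integral>\<^sup>+z. indicator (F \<inter> B) y * indicator G (y + z) * indicator V (y + \<tau> z) \<partial>lborel) \<partial>lborel)"
  proof (rule nn_integral_cong)
    fix y :: 'a
    show "(\<integral>\<^sup>+z. indicator (F \<inter> B) y * indicator G z * indicator V (\<sigma> y + \<tau> z) \<partial>lborel)
      = (\<integral>\<^sup>+z. indicator (F \<inter> B) y * indicator G (y + z) * indicator V (y + \<tau> z) \<partial>lborel)"
      using nn_integral_lborel_translate[of "\<lambda>z. indicator (F \<inter> B) y * indicator G z * indicator V (\<sigma> y + \<tau> z)" y]
      by (simp add: eq)
  qed
  \<comment> \<open>Now z is confined to a ball, and for fixed z the variable y appears only through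
    its translate by \<tau> z. Exchanging the integrals makes the inner one a measure independent of
    z.\<close>
  also have "\<dots> \<le> (\<integral>\<^sup>+y. (\<integral>\<^sup>+z. indicator ?K z * indicator (F \<inter> V \<inter> ?R) (\<tau> z + y) \<partial>lborel) \<partial>lborel)"
  proof (intro nn_integral_mono)
    fix y z :: 'a
    show "indicator (F \<inter> B) y * indicator G (y + z) * indicator V (y + \<tau> z)
      \<le> (indicator ?K z * indicator (F \<inter> V \<inter> ?R) (\<tau> z + y) :: ennreal)"
    proof (cases "y \<in> F \<and> y \<in> B \<and> y + z \<in> G \<and> y + \<tau> z \<in> V")
      case True
      then have y: "norm y \<le> b" "norm (y + z) \<le> c" using b c by auto
      then have z: "norm z \<le> b + c" using norm_triangle_ineq4[of "y + z" y] by simp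
      have "norm (\<tau> z) \<le> k * (b + c)" using k(2)[of z] mult_left_mono[OF z k(1)] by simp
      then have "norm (\<tau> z + y) \<le> b + k * (b + c)" using y(1) norm_triangle_ineq[of "\<tau> z" y] by simp
      then show ?thesis using True z inv[of y z] by (simp add: add.commute)
    qed (auto simp: indicator_def)
  qed
  also have "\<dots> = (\<integral>\<^sup>+z. (\<integral>\<^sup>+y. indicator ?K z * indicator (F \<inter> V \<inter> ?R) (\<tau> z + y) \<partial>lborel) \<partial>lborel)"
    by (rule lborel_pair.Fubini'[symmetric]) measurable
  also have "\<dots> = (\<integral>\<^sup>+z. indicator ?K z * emeasure lborel (F \<inter> V \<inter> ?R) \<partial>lborel)"
  proof (rule nn_integral_cong)
    fix z :: 'a
    have "(\<integral>\<^sup>+y. indicator (F \<inter> V \<inter> ?R) (\<tau> z + y) \<partial>lborel) = (\<integral>\<^sup>+y. indicator (F \<inter> V \<inter> ?R) y \<partial>lborel)"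
      by (rule nn_integral_lborel_translate) measurable
    also have "\<dots> = emeasure lborel (F \<inter> V \<inter> ?R)" by (rule nn_integral_indicator) measurable
    finally have "(\<integral>\<^sup>+y. indicator (F \<inter> V \<inter> ?R) (\<tau> z + y) \<partial>lborel) = emeasure lborel (F \<inter> V \<inter> ?R)" .
    then show "(\<integral>\<^sup>+y. indicator ?K z * indicator (F \<inter> V \<inter> ?R) (\<tau> z + y) \<partial>lborel)
      = indicator ?K z * emeasure lborel (F \<inter> V \<inter> ?R)"
      by (subst nn_integral_cmult) simp_all
  qed
  also have "\<dots> = emeasure lborel ?K * emeasure lborel (F \<inter> V \<inter> ?R)"
    by (subst nn_integral_multc) (simp_all add: mR)
  finally show ?thesis .
qed

text \<open>P and Q may intersect, so decompositions are not unique; choosing them on a basis and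
  extending makes them linear.\<close>

lemma linear_splitting:
  fixes P Q :: "'a::euclidean_space set"
  assumes P: "subspace P" and Q: "subspace Q" and PQ: "\<And>x. \<exists>u\<in>P. \<exists>v\<in>Q. x = u + v"
  obtains \<sigma> \<tau> where "linear \<sigma>" "linear \<tau>" "\<And>x. \<sigma> x + \<tau> x = x" "\<And>x. \<sigma> x \<in> P" "\<And>x. \<tau> x \<in> Q"
proof -
  obtain u v where uv: "\<And>x. u x \<in> P" "\<And>x. v x \<in> Q" "\<And>x. x = u x + v x" using PQ by metis
  let ?L = "\<lambda>w x. \<Sum>b\<in>Basis. (x \<bullet> b) *\<^sub>R (w b :: 'a)"
  have lin: "linear (?L w)" for w
    by (rule linearI) (simp_all add: inner_add_left scaleR_add_left sum.distrib scaleR_sum_right)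
  have "?L u x + ?L v x = x" for x
  proof -
    have "?L u x + ?L v x = (\<Sum>b\<in>Basis. (x \<bullet> b) *\<^sub>R (u b + v b))"
      by (simp add: sum.distrib scaleR_add_right)
    also have "\<dots> = x" by (simp add: uv(3)[symmetric] euclidean_representation)
    finally show ?thesis .
  qed
  moreover have "?L u x \<in> P" "?L v x \<in> Q" for x
    using uv P Q by (auto intro!: subspace_sum subspace_scale)
  ultimately show ?thesis using lin that[of "?L u" "?L v"] by blast
qed

text \<open>For diameters up to 1 a larger exponent gives a smaller value. A positive s' also
  removes the special value at s = 0, where \<open>diam_powr\<close> is 1 even for a point.\<close>

lemma diam_powr_ge:
  assumes "0 \<le> s" "s \<le> s'" "0 < s'" "bounded U" "diameter U \<le> 1"
  shows "ennreal (diameter U powr s') \<le> diam_powr s U"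
proof (cases "U = {} \<or> s = 0")
  case True
  have "diameter U powr s' \<le> 1 powr s'"
    using assms by (intro powr_mono2) (auto simp: diameter_ge_0)
  then show ?thesis using True assms by (auto simp: diam_powr_def diameter_empty)
next
  case False
  have "diameter U powr s' \<le> diameter U powr s"
    using assms diameter_ge_0[of U] by (intro powr_mono') auto
  then show ?thesis using False by (simp add: diam_powr_def ennreal_leI)
qed

text \<open>Enlarging each set slightly gives balls of positive radius, which are easier to handle
  than sets whose diameter may vanish.\<close>

lemma hausdorff_null_ball_cover:
  fixes A :: "'a::metric_space set"
  assumes s: "0 \<le> s" "s \<le> s'" "0 < s'" and null: "hausdorff_measure s A = 0" and \<epsilon>: "0 < \<epsilon>"
  obtains c :: "nat \<Rightarrow> 'a" and r :: "nat \<Rightarrow> real" where "A \<subseteq> (\<Union>i. ball (c i) (r i))"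
    "\<And>i. 0 < r i" "\<And>i. r i \<le> 1" "\<And>n. (\<Sum>i<n. r i powr s') \<le> \<epsilon>"
proof -
  have "hausdorff_premeasure s (1/2) A \<le> hausdorff_measure s A"
    unfolding hausdorff_measure_def by (rule SUP_upper) simp
  then have "hausdorff_premeasure s (1/2) A < ennreal (\<epsilon> / 2)" using null \<epsilon> by simp
  then obtain U :: "nat \<Rightarrow> 'a set" where U: "A \<subseteq> (\<Union>i. U i)" "\<And>i. bounded (U i)"
    "\<And>i. diameter (U i) \<le> 1/2" "(\<Sum>i. diam_powr s (U i)) < ennreal (\<epsilon> / 2)"
    unfolding hausdorff_premeasure_def Inf_less_iff by auto
  define w where "w i = diameter (U i)" for i
  have w: "0 \<le> w i" "w i \<le> 1/2" for i using U by (simp_all add: w_def diameter_ge_0)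
  define \<eta> where "\<eta> i = \<epsilon> / 2 * (1/2) ^ Suc i" for i
  have \<eta>0: "0 < \<eta> i" for i using \<epsilon> by (simp add: \<eta>_def)
  \<comment> \<open>The radius solves r^s' = w^s' + \<eta>, capped at 1 because the Frostman bound
    is available only for such radii. As w \<le> 1/2, the cap leaves r > w.\<close>
  define r where "r i = min 1 ((w i powr s' + \<eta> i) powr (1 / s'))" for i
  have r0: "w i < r i" for i
  proof -
    have "w i = (w i powr s') powr (1 / s')" using s w(1)[of i] by (simp add: powr_powr)
    also have "\<dots> < (w i powr s' + \<eta> i) powr (1 / s')"
      using s \<eta>0[of i] by (intro powr_less_mono2) auto
    finally show ?thesis using w(2)[of i] by (simp add: r_def)
  qed
  have rs: "r i powr s' \<le> w i powr s' + \<eta> i" for i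
  proof -
    have "r i powr s' \<le> ((w i powr s' + \<eta> i) powr (1 / s')) powr s'"
      using s r0[of i] w(1)[of i] by (intro powr_mono2) (auto simp: r_def)
    also have "\<dots> = w i powr s' + \<eta> i" using s \<eta>0[of i] add_nonneg_pos[OF powr_ge_zero \<eta>0, of "w i" s' i]
      by (simp add: powr_powr)
    finally show ?thesis .
  qed
  \<comment> \<open>For an empty U i the centre is arbitrary, which does no harm.\<close>
  define c where "c i = (SOME x. x \<in> U i)" for i
  have cU: "U i \<subseteq> ball (c i) (r i)" for i
  proof
    fix x assume x: "x \<in> U i"
    then have "c i \<in> U i" unfolding c_def by (rule someI)
    then have "dist (c i) x \<le> w i" unfolding w_def using U(2) x by (intro diameter_bounded_bound)
    then show "x \<in> ball (c i) (r i)" using r0[of i] by simp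
  qed
  have sum: "(\<Sum>i<n. r i powr s') \<le> \<epsilon>" for n
  proof -
    have "ennreal (\<Sum>i<n. w i powr s') = (\<Sum>i<n. ennreal (w i powr s'))" by simp
    also have "\<dots> \<le> (\<Sum>i<n. diam_powr s (U i))"
    proof (rule sum_mono)
      fix i
      have "diameter (U i) \<le> 1" using U(3)[of i] by simp
      then show "ennreal (w i powr s') \<le> diam_powr s (U i)"
        unfolding w_def by (intro diam_powr_ge s U(2))
    qed
    also have "\<dots> \<le> (\<Sum>i. diam_powr s (U i))" by (intro sum_le_suminf) auto
    also have "\<dots> \<le> ennreal (\<epsilon> / 2)" using U(4) by simp
    finally have 1: "(\<Sum>i<n. w i powr s') \<le> \<epsilon> / 2" using \<epsilon> by (subst (asm) ennreal_le_iff) auto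
    have "(\<Sum>i<n. (1/2::real) ^ Suc i) = 1 - (1/2) ^ n" by (induction n) simp_all
    then have "(\<Sum>i<n. (1/2::real) ^ Suc i) \<le> 1" by simp
    from mult_left_mono[OF this, of "\<epsilon> / 2"] have 2: "(\<Sum>i<n. \<eta> i) \<le> \<epsilon> / 2"
      using \<epsilon> by (simp add: \<eta>_def sum_distrib_left)
    have "(\<Sum>i<n. r i powr s') \<le> (\<Sum>i<n. w i powr s' + \<eta> i)" by (intro sum_mono rs)
    then show ?thesis using 1 2 by (simp add: sum.distrib)
  qed
  show ?thesis
  proof (rule that[of c r])
    show "A \<subseteq> (\<Union>i. ball (c i) (r i))" using U(1) cU by blast
    show "0 < r i" for i using r0[of i] w(1)[of i] by simp
    show "r i \<le> 1" for i by (simp add: r_def)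
  qed (rule sum)
qed

text \<open>Removing the first n sets of the cover from the n-th product gives decreasing compact
  sets with empty intersection, so one of them is empty. The finite cover serves all later stages at
  once: the stage is fixed only when the finitely many radii are known.\<close>

lemma nested_product_cover:
  fixes F :: "nat \<Rightarrow> 'a::euclidean_space set" and G :: "'b::euclidean_space set" and V :: "nat \<Rightarrow> ('a \<times> 'b) set"
  assumes F: "\<And>n. compact (F n)" "\<And>n. F (Suc n) \<subseteq> F n" and G: "compact G"
    and V: "\<And>i. open (V i)" and cov: "(\<Inter>n. F n) \<times> G \<subseteq> (\<Union>i. V i)"
  shows "\<exists>n. \<forall>m\<ge>n. F m \<times> G \<subseteq> (\<Union>i<n. V i)"
proof -
  define Q where "Q n = F n \<times> G - (\<Union>i<n. V i)" for n
  have cQ: "compact (Q n)" for n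
    unfolding Q_def by (intro compact_diff compact_Times F G open_UN ballI V)
  have Fmono: "F n \<subseteq> F m" if "m \<le> n" for m n
    using lift_Suc_antimono_le[of F] F(2) that by blast
  have mono: "Q n \<subseteq> Q m" if "m \<le> n" for m n
    using Fmono[OF that] that unfolding Q_def by fastforce
  have "(\<Inter>n. Q n) = {}"
  proof (rule ccontr)
    assume "\<not> ?thesis"
    then obtain x where x: "\<And>n. x \<in> Q n" by blast
    then have "x \<in> (\<Inter>n. F n) \<times> G" by (auto simp: Q_def mem_Times_iff)
    then obtain i where "x \<in> V i" using cov by blast
    then show False using x[of "Suc i"] by (auto simp: Q_def)
  qed
  then obtain n where "Q n = {}" using compact_nest[of Q, OF cQ _ mono] by blast
  then have "F m \<times> G \<subseteq> (\<Union>i<n. V i)" if "m \<ge> n" for m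
    using Fmono[OF that] by (auto simp: Q_def)
  then show ?thesis by blast
qed

section \<open>The lower bound for the dimension\<close>

lemma int_lattice_separated:
  assumes "z \<in> int_lattice" "z' \<in> int_lattice" "z \<noteq> z'"
  shows "1 \<le> dist z z'"
proof -
  obtain i where i: "z $ i \<noteq> z' $ i" using assms(3) by (auto simp: vec_eq_iff)
  have "z $ i - z' $ i \<in> \<int>" using assms by (auto simp: int_lattice_def)
  then have "1 \<le> \<bar>z $ i - z' $ i\<bar>" using i by (intro Ints_nonzero_abs_ge1) auto
  also have "\<dots> \<le> norm (z - z')" using component_le_norm_cart[of "z - z'" i] by simp
  finally show ?thesis by (simp add: dist_norm)
qed

lemma finite_bounded_int_lattice: "bounded A \<Longrightarrow> finite (int_lattice \<inter> A :: (real ^ 'n) set)"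
proof -
  assume A: "bounded A"
  have "uniform_discrete (int_lattice \<inter> A :: (real ^ 'n) set)"
    unfolding uniform_discrete_def using int_lattice_separated by (intro exI[of _ 1]) force
  then show ?thesis using uniform_discrete_finite_iff bounded_Int A by blast
qed

text \<open>A comparison of masses: the product of \<open>F m \<inter> B\<close> and G has mass
  \<mu> times the volume of G, yet a cover with small sum of \<open>r i powr s'\<close> can account
  for at most M \<epsilon> \<mu>, which is less.\<close>

lemma hausdorff_measure_Eq_ND_nonzero:
  fixes S T :: "int ^ 'n ^ 'n" and s :: real
  assumes S: "hyperbolic_endo S" and T: "hyperbolic_endo T"
    and span: "{u + v | u v. u \<in> contracted_subspace S \<and> v \<in> contracted_subspace T} = UNIV"
    and s: "0 \<le> s" "s < CARD('n)"
  shows "hausdorff_measure s (Eq_set (torus_map S) \<inter> ND_set (torus_map T)) \<noteq> 0"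
proof
  let ?Z = "Eq_set (torus_map S) \<inter> ND_set (torus_map T)"
  let ?f = "(*v) (real_matrix T)" and ?h = "(*v) (real_matrix S)"
  assume null: "hausdorff_measure s ?Z = 0"
  \<comment> \<open>An exponent strictly above s, hence positive even for s = 0, and still below
    d.\<close>
  define s' where "s' = (s + CARD('n)) / 2"
  have s': "s \<le> s'" "0 < s'" "s' < CARD('n)" using s by (auto simp: s'_def)
  obtain g p where g: "linear g" "\<And>x. g (?f x) = x" "\<And>x. ?f (g x) = x"
    and p: "linear p" "\<And>x. p x \<in> stable_space g" "\<And>x. x - p x \<in> stable_space ?f"
      "\<And>x. x \<in> stable_space g \<Longrightarrow> p x = x" "\<And>x. x \<in> stable_space ?f \<Longrightarrow> p x = 0"
  proof (rule hyperbolic_splitting[OF T], goal_cases)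
    case (1 g p)
    show ?case by (rule that[OF 1(2-)])
  qed
  have f: "linear ?f" by simp
  note sf = subspace_stable[OF f]
  have sh: "subspace (stable_space ?h)" by (rule subspace_stable) simp
  have pf: "p (?f x) = ?f (p x)" for x
  proof -
    have "?f x = ?f (p x) + ?f (x - p x)" by (simp flip: matrix_vector_right_distrib)
    then have "p (?f x) = p (?f (p x)) + p (?f (x - p x))" by (metis linear_add[OF p(1)])
    moreover have "p (?f (p x)) = ?f (p x)" by (intro p(4) inverse_stable[OF f g(2,3) p(2)])
    moreover have "p (?f (x - p x)) = 0" by (intro p(5) stable_commute[OF f _ p(3)] refl)
    ultimately show ?thesis by simp
  qed
  have ex: "\<exists>N>0. \<forall>x. L * norm (p x) \<le> norm ((?f ^^ N) (p x))" if L: "0 < L" for L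
  proof -
    obtain N where N: "\<forall>n\<ge>N. \<forall>x\<in>stable_space g. L * norm x \<le> norm ((?f ^^ n) x)"
      using eventually_expanding_on_stable_inverse[OF f g L] by blast
    then have "\<forall>x. L * norm (p x) \<le> norm ((?f ^^ Suc N) (p x))"
      using p(2) by (meson le_SucI order_refl)
    then show ?thesis by (intro exI[of _ "Suc N"]) simp
  qed
  \<comment> \<open>If p vanished, every vector would be contracted by T. But the iterates of a
    nonzero integer vector are nonzero integer vectors and have norm at least 1.\<close>
  have nontriv: "\<exists>x. p x \<noteq> 0"
  proof (rule ccontr)
    assume "\<not> ?thesis"
    then have p0: "p x = 0" for x by blast
    obtain i :: 'n where True by blast
    let ?e = "axis i 1 :: real ^ 'n"
    have e: "?e \<in> int_lattice" "?e \<noteq> 0" by (auto simp: int_lattice_def axis_def vec_eq_iff)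
    have "(?f ^^ n) ?e \<noteq> 0" for n
    proof
      assume "(?f ^^ n) ?e = 0"
      then have "(g ^^ n) ((?f ^^ n) ?e) = 0" by (simp add: linear_0[OF linear_funpow[OF g(1)]])
      moreover have "(g ^^ n) ((?f ^^ n) ?e) = ?e" by (rule funpow_inverse) (rule g(2))
      ultimately show False using e(2) by simp
    qed
    then have "1 \<le> norm ((?f ^^ n) ?e)" for n
      using int_lattice_separated[OF linear_funpow_int_lattice[OF e(1), where M = T] int_lattice_0]
      by (simp add: dist_norm)
    moreover have "(\<lambda>n. norm ((?f ^^ n) ?e)) \<longlonglongrightarrow> 0"
      using p(3)[of ?e] by (simp add: p0 stable_space_def tendsto_norm_zero)
    ultimately have "1 \<le> (0::real)" by (intro LIMSEQ_le_const[of "\<lambda>n. norm ((?f ^^ n) ?e)"]) auto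
    then show False by simp
  qed
  have split: "\<exists>u\<in>stable_space ?h. \<exists>v\<in>stable_space ?f. x = u + v" for x
  proof -
    have "x \<in> {u + v | u v. u \<in> contracted_subspace S \<and> v \<in> contracted_subspace T}" using span by simp
    then show ?thesis using contracted_subspace_subset_stable[of S] contracted_subspace_subset_stable[of T] by blast
  qed
  obtain \<sigma> \<tau> where \<sigma>: "linear \<sigma>" and \<tau>: "linear \<tau>" and \<sigma>\<tau>: "\<And>x. \<sigma> x + \<tau> x = x"
    and \<sigma>h: "\<And>x. \<sigma> x \<in> stable_space ?h" and \<tau>f: "\<And>x. \<tau> x \<in> stable_space ?f"
  proof (rule linear_splitting[OF sh sf split], goal_cases)
    case (1 \<sigma> \<tau>)
    show ?case by (rule that[OF 1(2-)])
  qed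
  have pp: "p (p x) = p x" for x by (rule p(4)[OF p(2)])
  have sd: "s' < DIM(real ^ 'n)" using s' by simp
  obtain N F C and \<rho> :: "nat \<Rightarrow> real" and B where "0 < N" and B: "compact B"
    and Fc: "\<And>n. closed (F n)" and Fd: "\<And>n. F (Suc n) \<subseteq> F n"
    and Fp: "\<And>n y b. y \<in> F n \<Longrightarrow> p b = 0 \<Longrightarrow> y + b \<in> F n"
    and Fav: "\<And>y z k. (\<And>n. y \<in> F n) \<Longrightarrow> z \<in> int_lattice \<Longrightarrow> 1/16 \<le> dist ((?f ^^ (N * k)) (p y)) z"
    and Fr: "\<And>n a r. \<rho> n \<le> r \<Longrightarrow> r \<le> 1 \<Longrightarrow> measure lborel (F n \<inter> ball a r) \<le> C * r powr s' * measure lborel (F n \<inter> B)"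
    and F0: "\<And>n. 0 < measure lborel (F n \<inter> B)" and \<rho>: "\<rho> \<longlonglongrightarrow> 0"
  proof (rule avoiding_sets_exist[where f = ?f and g = g and p = p and s = s' and Z = int_lattice], goal_cases)
    case 1 show ?case by (fact f)
  next
    case 2 show ?case by (fact g(1))
  next
    case (3 x) show ?case by (fact g(2))
  next
    case (4 x) show ?case by (fact g(3))
  next
    case 5 show ?case by (fact p(1))
  next
    case (6 x) show ?case by (fact pp)
  next
    case (7 x) show ?case by (fact pf)
  next
    case (8 L) show ?case by (rule ex[OF 8(2)])
  next
    case (9 z z') show ?case by (rule int_lattice_separated[OF 9(2-)])
  next
    case 10 show ?case by (fact sd)
  next
    case 11 show ?case by (fact nontriv)
  next
    case (12 N F C \<rho> B)
    show ?case by (rule that[of N B F \<rho> C, OF 12(2-)])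
  qed
  obtain G where G: "compact G" "0 < measure lborel G" "\<And>z. z \<in> G \<Longrightarrow> torus_proj z \<in> Eq_set (torus_map S)"
  proof (rule compact_Eq_set_lift[OF S], goal_cases)
    case (1 G)
    show ?case by (rule that[OF 1(2-)])
  qed
  obtain b where b: "B \<subseteq> cball 0 b"
    using bounded_subset_ballD[OF compact_imp_bounded[OF B], of 0] ball_subset_cball by blast
  obtain c where c: "G \<subseteq> cball 0 c"
    using bounded_subset_ballD[OF compact_imp_bounded[OF G(1)], of 0] ball_subset_cball by blast
  obtain k where k0: "0 < k" and k: "\<And>x. norm (\<tau> x) \<le> k * norm x"
  proof (rule linear_bounded_pos[OF \<tau>], goal_cases)
    case (1 k)
    show ?case by (rule that[OF 1(2-)])
  qed
  define R where "R = b + k * (b + c)"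
  \<comment> \<open>The translates that matter: a ball of radius at most 1 about u + v, where u in
    the unit cube has norm at most d, meets \<open>cball 0 R\<close> only if v has norm at most R +
    1 + d.\<close>
  define \<Lambda> where "\<Lambda> = (int_lattice \<inter> cball 0 (R + 1 + CARD('n)) :: (real ^ 'n) set)"
  have fin\<Lambda>: "finite \<Lambda>" unfolding \<Lambda>_def by (intro finite_bounded_int_lattice bounded_cball)
  let ?K = "cball 0 (b + c) :: (real ^ 'n) set"
  define M where "M = measure lborel ?K * (card \<Lambda> * \<bar>C\<bar>)"
  have M0: "0 \<le> M" by (simp add: M_def)
  \<comment> \<open>Chosen so that M \<epsilon> is less than the measure of G; M + 1 keeps the
    denominator positive.\<close>
  define \<epsilon> where "\<epsilon> = measure lborel G / (2 * (M + 1))"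
  have \<epsilon>: "0 < \<epsilon>" using G(2) M0 by (simp add: \<epsilon>_def)
  obtain ct and r :: "nat \<Rightarrow> real" where ct: "?Z \<subseteq> (\<Union>i. ball (ct i) (r i))" and r: "\<And>i. 0 < r i" "\<And>i. r i \<le> 1"
    and rsum: "\<And>n. (\<Sum>i<n. r i powr s') \<le> \<epsilon>"
  proof (rule hausdorff_null_ball_cover[OF s(1) s'(1,2) null \<epsilon>], goal_cases)
    case (1 ct r)
    show ?case by (rule that[OF 1(2-)])
  qed
  have "\<exists>u\<in>unit_cube. torus_proj u = ct i" for i
  proof -
    obtain x where x: "ct i = torus_proj x" by (rule torus_proj_cases)
    obtain v where "v \<in> int_lattice" "x - v \<in> unit_cube" using unit_cube_decomp by blast
    then show ?thesis by (intro bexI[of _ "x - v"]) (simp_all add: x torus_proj_eq_iff int_lattice_minus)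
  qed
  then obtain u where u: "\<And>i. u i \<in> unit_cube" "\<And>i. torus_proj (u i) = ct i" by metis
  have u_norm: "norm (u i) \<le> CARD('n)" for i
  proof -
    have "norm (u i) \<le> (\<Sum>j\<in>UNIV. \<bar>u i $ j\<bar>)" by (rule norm_le_l1_cart)
    also have "\<dots> \<le> (\<Sum>j\<in>(UNIV :: 'n set). 1)"
      using u(1)[of i] by (intro sum_mono) (auto simp: unit_cube_def less_imp_le)
    finally show ?thesis by simp
  qed
  define V where "V i = (\<Union>v\<in>int_lattice. ball (u i + v) (r i))" for i
  have V_open: "open (V i)" for i unfolding V_def by (intro open_UN ballI open_ball)
  have bl: "bounded_linear \<sigma>" "bounded_linear \<tau>"
    using \<sigma> \<tau> by (simp_all add: linear_conv_bounded_linear)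
  define L where "L w = \<sigma> (fst w) + \<tau> (snd w)" for w
  define V' where "V' i = L -` V i" for i
  have "continuous_on UNIV L"
    unfolding L_def[abs_def]
    by (rule continuous_on_add[OF bounded_linear.continuous_on[OF bl(1) continuous_on_fst[OF continuous_on_id]]
          bounded_linear.continuous_on[OF bl(2) continuous_on_snd[OF continuous_on_id]]])
  then have V'_open: "open (V' i)" for i
    unfolding V'_def using V_open[of i] open_vimage by blast
  have cov: "(\<Inter>n. F n \<inter> B) \<times> G \<subseteq> (\<Union>i. V' i)"
  proof clarify
    fix y z assume y: "y \<in> (\<Inter>n. F n \<inter> B)" and z: "z \<in> G"
    define x where "x = \<sigma> y + \<tau> z"
    have "x - z = \<sigma> y - \<sigma> z" using \<sigma>\<tau>[of z] by (simp add: x_def algebra_simps)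
    then have "x - z \<in> stable_space ?h" using subspace_diff[OF sh \<sigma>h \<sigma>h] by simp
    then have "torus_proj x \<in> Eq_set (torus_map S)" by (rule Eq_set_stable[OF G(3)[OF z]])
    \<comment> \<open>Avoidance is known for the orbit of p y, not of y; the difference y - p y is
      contracted by T as well.\<close>
    moreover have "x - p y = (\<tau> z - \<tau> y) + (y - p y)" using \<sigma>\<tau>[of y] by (simp add: x_def algebra_simps)
    then have xp: "x - p y \<in> stable_space ?f"
      by (simp only: subspace_add[OF sf subspace_diff[OF sf \<tau>f \<tau>f] p(3)])
    have "y \<in> F n" for n using y by blast
    then have "torus_proj x \<in> ND_set (torus_map T)"
      using ND_setI_avoiding[OF \<open>0 < N\<close> Fav xp] by blast
    ultimately have "torus_proj x \<in> ?Z" by blast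
    then obtain i where i: "torus_proj x \<in> ball (ct i) (r i)" using ct by blast
    obtain w where w: "torus_proj w = ct i" "norm (x - w) = dist (torus_proj x) (ct i)"
      by (rule torus_lift_near)
    have "w - u i \<in> int_lattice" using w(1) u(2)[of i] by (simp flip: torus_proj_eq_iff)
    moreover have "x \<in> ball (u i + (w - u i)) (r i)"
      using i w(2) by (simp add: dist_norm dist_commute norm_minus_commute)
    ultimately have "x \<in> V i" unfolding V_def by blast
    then show "(y, z) \<in> (\<Union>i. V' i)" by (auto simp: V'_def L_def x_def)
  qed
  have FB: "compact (F n \<inter> B)" for n using closed_Int_compact[OF Fc B] .
  obtain n where n: "\<And>m. m \<ge> n \<Longrightarrow> (F m \<inter> B) \<times> G \<subseteq> (\<Union>i<n. V' i)"
    using nested_product_cover[of "\<lambda>n. F n \<inter> B" G V', OF FB _ G(1) V'_open cov] Fd by blast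
  have "\<forall>\<^sub>F m in sequentially. \<forall>i\<in>{..<n}. \<rho> m < r i"
    using r(1) \<rho> by (intro eventually_ball_finite finite_lessThan ballI order_tendstoD(2))
  with eventually_ge_at_top[of n] have "\<forall>\<^sub>F m in sequentially. n \<le> m \<and> (\<forall>i\<in>{..<n}. \<rho> m < r i)"
    by (rule eventually_conj)
  then have "\<exists>m. n \<le> m \<and> (\<forall>i\<in>{..<n}. \<rho> m < r i)"
    by (rule eventually_happens'[OF sequentially_bot])
  \<comment> \<open>The Frostman bound at stage m holds for radii from \<rho> m on, so m is taken
    beyond n and late enough for the n radii in play.\<close>
  then obtain m where m: "n \<le> m" "\<And>i. i < n \<Longrightarrow> \<rho> m < r i" by (elim exE conjE) auto
  define \<mu> where "\<mu> = measure lborel (F m \<inter> B)"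
  have \<mu>0: "0 < \<mu>" unfolding \<mu>_def by (rule F0)
  have FmB: "F m \<in> sets borel" "B \<in> sets borel" "G \<in> sets borel" "\<And>i. V i \<in> sets borel"
    using Fc B G(1) V_open by (auto intro: borel_closed borel_open compact_imp_closed)
  note [measurable] = FmB
  have [measurable]: "\<sigma> \<in> borel_measurable borel" "\<tau> \<in> borel_measurable borel"
    using \<sigma> \<tau> by (auto intro!: borel_measurable_continuous_onI linear_continuous_on simp: linear_conv_bounded_linear)
  have piece: "emeasure lborel (F m \<inter> V i \<inter> cball 0 R) \<le> ennreal (card \<Lambda> * (\<bar>C\<bar> * r i powr s' * \<mu>))" if i: "i < n" for i
  proof -
    have "F m \<inter> V i \<inter> cball 0 R \<subseteq> (\<Union>v\<in>\<Lambda>. F m \<inter> ball (u i + v) (r i))"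
    proof
      fix x assume x: "x \<in> F m \<inter> V i \<inter> cball 0 R"
      then obtain v where v: "v \<in> int_lattice" "x \<in> ball (u i + v) (r i)" by (auto simp: V_def)
      have "v = x - u i - (x - (u i + v))" by simp
      then have "norm v \<le> norm (x - u i) + norm (x - (u i + v))" by (metis norm_triangle_ineq4)
      also have "norm (x - u i) \<le> norm x + norm (u i)" by (rule norm_triangle_ineq4)
      finally have "norm v \<le> R + 1 + CARD('n)"
        using x v(2) u_norm[of i] r(2)[of i] by (auto simp: dist_norm norm_minus_commute)
      then show "x \<in> (\<Union>v\<in>\<Lambda>. F m \<inter> ball (u i + v) (r i))" using x v by (auto simp: \<Lambda>_def)
    qed
    then have "emeasure lborel (F m \<inter> V i \<inter> cball 0 R) \<le> emeasure lborel (\<Union>v\<in>\<Lambda>. F m \<inter> ball (u i + v) (r i))"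
      by (intro emeasure_mono sets.finite_UN fin\<Lambda>) auto
    also have "\<dots> \<le> (\<Sum>v\<in>\<Lambda>. emeasure lborel (F m \<inter> ball (u i + v) (r i)))"
      by (intro emeasure_subadditive_finite fin\<Lambda>) auto
    also have "\<dots> \<le> (\<Sum>v\<in>\<Lambda>. ennreal (\<bar>C\<bar> * r i powr s' * \<mu>))"
    proof (rule sum_mono)
      fix v
      have "emeasure lborel (F m \<inter> ball (u i + v) (r i)) \<noteq> \<infinity>"
        using emeasure_bounded_finite[of "F m \<inter> ball (u i + v) (r i)"] by (auto simp: bounded_Int)
      then have "emeasure lborel (F m \<inter> ball (u i + v) (r i)) = ennreal (measure lborel (F m \<inter> ball (u i + v) (r i)))"
        by (intro emeasure_eq_ennreal_measure) auto
      also have "\<dots> \<le> ennreal (\<bar>C\<bar> * r i powr s' * \<mu>)"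
      proof (rule ennreal_leI)
        have "measure lborel (F m \<inter> ball (u i + v) (r i)) \<le> C * r i powr s' * \<mu>"
          unfolding \<mu>_def using m(2)[OF i] r(2)[of i] by (intro Fr) auto
        also have "\<dots> \<le> \<bar>C\<bar> * r i powr s' * \<mu>" using \<mu>0 by (intro mult_right_mono) auto
        finally show "measure lborel (F m \<inter> ball (u i + v) (r i)) \<le> \<bar>C\<bar> * r i powr s' * \<mu>" .
      qed
      finally show "emeasure lborel (F m \<inter> ball (u i + v) (r i)) \<le> ennreal (\<bar>C\<bar> * r i powr s' * \<mu>)" .
    qed
    also have "\<dots> = ennreal (card \<Lambda> * (\<bar>C\<bar> * r i powr s' * \<mu>))"
      by (simp add: ennreal_mult' ennreal_of_nat_eq_real_of_nat)
    finally show ?thesis .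
  qed
  have K_fin: "emeasure lborel ?K = ennreal (measure lborel ?K)"
    using emeasure_bounded_finite[of ?K] by (intro emeasure_eq_ennreal_measure) auto
  let ?I = "\<lambda>y z i. indicator (F m \<inter> B) y * indicator G z * indicator (V i) (\<sigma> y + \<tau> z) :: ennreal"
  have "ennreal (\<mu> * measure lborel G) = emeasure lborel (F m \<inter> B) * emeasure lborel G"
  proof -
    have "emeasure lborel (F m \<inter> B) = ennreal \<mu>" unfolding \<mu>_def
      using emeasure_bounded_finite[OF compact_imp_bounded[OF FB[of m]]] by (intro emeasure_eq_ennreal_measure) auto
    moreover have "emeasure lborel G = ennreal (measure lborel G)"
      using emeasure_bounded_finite[OF compact_imp_bounded[OF G(1)]] by (intro emeasure_eq_ennreal_measure) auto
    ultimately show ?thesis using \<mu>0 by (simp add: ennreal_mult)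
  qed
  also have "\<dots> = (\<integral>\<^sup>+y. (\<integral>\<^sup>+z. indicator (F m \<inter> B) y * indicator G z \<partial>lborel) \<partial>lborel)"
    by (simp add: nn_integral_cmult nn_integral_multc)
  also have "\<dots> \<le> (\<integral>\<^sup>+y. (\<integral>\<^sup>+z. (\<Sum>i<n. ?I y z i) \<partial>lborel) \<partial>lborel)"
  proof (intro nn_integral_mono)
    fix y z :: "real ^ 'n"
    show "indicator (F m \<inter> B) y * indicator G z \<le> (\<Sum>i<n. ?I y z i)"
    proof (cases "y \<in> F m \<inter> B \<and> z \<in> G")
      case True
      then obtain i where i: "i < n" "\<sigma> y + \<tau> z \<in> V i" using n[OF m(1)] by (auto simp: V'_def L_def)
      have "indicator (F m \<inter> B) y * indicator G z = ?I y z i" using i(2) by simp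
      also have "\<dots> \<le> (\<Sum>i<n. ?I y z i)" using i(1) by (intro member_le_sum) auto
      finally show ?thesis .
    qed (auto simp: indicator_def)
  qed
  also have "\<dots> = (\<integral>\<^sup>+y. (\<Sum>i<n. \<integral>\<^sup>+z. ?I y z i \<partial>lborel) \<partial>lborel)"
    by (rule nn_integral_cong) (rule nn_integral_sum, measurable)
  also have "\<dots> = (\<Sum>i<n. \<integral>\<^sup>+y. (\<integral>\<^sup>+z. ?I y z i \<partial>lborel) \<partial>lborel)"
    by (rule nn_integral_sum) measurable
  also have "\<dots> \<le> (\<Sum>i<n. emeasure lborel ?K * emeasure lborel (F m \<inter> V i \<inter> cball 0 R))"
    unfolding R_def
    by (intro sum_mono product_cover_bound FmB \<sigma> \<tau> \<sigma>\<tau> b c less_imp_le[OF k0] k Fp p(5) \<tau>f)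
  also have "\<dots> \<le> (\<Sum>i<n. ennreal (measure lborel ?K) * ennreal (card \<Lambda> * (\<bar>C\<bar> * r i powr s' * \<mu>)))"
    unfolding K_fin by (intro sum_mono mult_left_mono piece) auto
  also have "\<dots> = ennreal (\<Sum>i<n. measure lborel ?K * (card \<Lambda> * (\<bar>C\<bar> * r i powr s' * \<mu>)))"
    using \<mu>0 by (subst sum_ennreal[symmetric]) (auto simp: ennreal_mult intro!: sum.cong)
  also have "(\<Sum>i<n. measure lborel ?K * (card \<Lambda> * (\<bar>C\<bar> * r i powr s' * \<mu>))) = \<mu> * (M * (\<Sum>i<n. r i powr s'))"
    by (simp add: M_def sum_distrib_left mult_ac)
  finally have "\<mu> * measure lborel G \<le> \<mu> * (M * (\<Sum>i<n. r i powr s'))"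
    using \<mu>0 M0 by (subst (asm) ennreal_le_iff) (auto intro!: mult_nonneg_nonneg sum_nonneg)
  then have "measure lborel G \<le> M * (\<Sum>i<n. r i powr s')" using \<mu>0 by simp
  also have "\<dots> \<le> M * \<epsilon>" by (intro mult_left_mono rsum M0)
  also have "\<dots> < measure lborel G"
  proof -
    have "M * measure lborel G < 2 * (M + 1) * measure lborel G"
      using G(2) M0 by (intro mult_strict_right_mono) auto
    then show ?thesis using M0 by (simp add: \<epsilon>_def divide_less_eq mult_ac)
  qed
  finally show False by simp
qed

theorem theorem3p1:
  fixes S T :: "int ^ 'n ^ 'n"
  assumes "hyperbolic_endo S" and "hyperbolic_endo T"
    and "contracted_subspace S \<noteq> {0}" and "contracted_subspace T \<noteq> {0}"
    and "{u + v | u v. u \<in> contracted_subspace S \<and> v \<in> contracted_subspace T} = UNIV"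
  shows "hausdorff_dim (Eq_set (torus_map S) \<inter> ND_set (torus_map T)) = of_nat CARD('n)"
proof (rule antisym[OF hausdorff_dim_torus_le])
  let ?Z = "Eq_set (torus_map S) \<inter> ND_set (torus_map T)"
  have "ennreal CARD('n) \<le> ennreal s" if "0 \<le> s" "hausdorff_measure s ?Z = 0" for s
    using hausdorff_measure_Eq_ND_nonzero[OF assms(1,2,5) that(1)] that(2) by (intro ennreal_leI) force
  then show "of_nat CARD('n) \<le> hausdorff_dim ?Z"
    unfolding hausdorff_dim_def ennreal_of_nat_eq_real_of_nat by (intro Inf_greatest) auto
qed

end
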